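(* Let $k$ be an even positive integer. A graph $G$ is $(2k,k)$-connected if and only if $G$ can be obtained from $kK_3$ by a (possibly empty) sequence of the following operations: (a) adding a new edge (between existing vertices; loops and parallel edges are allowed); (b) pinching a set $F$ of $k$ edges such that, for all vertices $v$, $d_F(v)\le k$.
   Context: All graphs are finite and undirected; loops and parallel edges are allowed; graphs are considered up to isomorphism. A graph is $\ell$-edge-connected if deleting any fewer than $\ell$ edges leaves it connected. A graph $G=(V,E)$ is $(2k,k)$-connected if $|V|\ge 3$, $G$ is $2k$-edge-connected, and $G-v$ is $k$-edge-connected for every $v\in V$. $kK_3$ is the graph on $3$ vertices in which each pair of distinct vertices is connected by exactly $k$ parallel edges (and there are no loops). Pinching a set $F$ of edges consists of adding a new vertex in the middle of each edge of $F$ (subdividing it) and then identifying all these new vertices into a single new vertex $s$; thus an edge $uv\in F$ is replaced by the edges $su$ and $sv$, and a loop at $u$ in $F$ is replaced by two parallel edges $su$. For a vertex $v$, $d_F(v)$ is the degree of $v$ in the graph formed by the edges in $F$, a loop at $v$ being counted twice. *)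

theory Defs
  imports Main "HOL-Library.Multiset" "HOL-Library.Uprod"
begin

text \<open>
  A finite undirected multigraph consists of a vertex set and a finite multiset of unordered pairs
  of vertices. The pair \<open>Upair v v\<close> is a loop at \<open>v\<close>, and the multiplicity of \<open>Upair u v\<close> is the
  number of parallel edges between \<open>u\<close> and \<open>v\<close>. Parallel edges carry no names, so sets of edges of a
  graph are represented by sub-multisets of its multiset of edges.
\<close>

record 'a multigraph =
  verts :: "'a set"
  edges :: "'a uprod multiset"

definition wf_multigraph :: "'a multigraph \<Rightarrow> bool" where
  "wf_multigraph G \<longleftrightarrow> finite (verts G) \<and> (\<forall>e \<in># edges G. set_uprod e \<subseteq> verts G)"

definition isomorphic :: "'a multigraph \<Rightarrow> 'b multigraph \<Rightarrow> bool" where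
  "isomorphic G H \<longleftrightarrow>
     (\<exists>f. bij_betw f (verts G) (verts H) \<and> edges H = image_mset (map_uprod f) (edges G))"

definition adjacent :: "'a multigraph \<Rightarrow> 'a \<Rightarrow> 'a \<Rightarrow> bool" where
  "adjacent G u v \<longleftrightarrow> Upair u v \<in># edges G"

definition connected_multigraph :: "'a multigraph \<Rightarrow> bool" where
  "connected_multigraph G \<longleftrightarrow>
     verts G \<noteq> {} \<and> (\<forall>u \<in> verts G. \<forall>v \<in> verts G. (adjacent G)\<^sup>*\<^sup>* u v)"

definition delete_edges :: "'a multigraph \<Rightarrow> 'a uprod multiset \<Rightarrow> 'a multigraph" where
  "delete_edges G D = \<lparr>verts = verts G, edges = edges G - D\<rparr>"

definition delete_vertex :: "'a multigraph \<Rightarrow> 'a \<Rightarrow> 'a multigraph" where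
  "delete_vertex G v =
     \<lparr>verts = verts G - {v}, edges = filter_mset (\<lambda>e. v \<notin> set_uprod e) (edges G)\<rparr>"

definition edge_connected :: "nat \<Rightarrow> 'a multigraph \<Rightarrow> bool" where
  "edge_connected l G \<longleftrightarrow>
     (\<forall>D. D \<subseteq># edges G \<and> size D < l \<longrightarrow> connected_multigraph (delete_edges G D))"

text \<open>For \<open>l = 2 * k\<close> this is \<open>(2k,k)\<close>-connectivity.\<close>

definition mixed_connected :: "nat \<Rightarrow> nat \<Rightarrow> 'a multigraph \<Rightarrow> bool" where
  "mixed_connected l k G \<longleftrightarrow>
     card (verts G) \<ge> 3 \<and> edge_connected l G \<and>
     (\<forall>v \<in> verts G. edge_connected k (delete_vertex G v))"

definition multi_K3 :: "nat \<Rightarrow> nat multigraph" where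
  "multi_K3 k =
     \<lparr>verts = {0, 1, 2},
      edges = replicate_mset k (Upair 0 1) + replicate_mset k (Upair 1 2)
            + replicate_mset k (Upair 0 2)\<rparr>"

text \<open>The two ends of an edge, where a loop at \<open>v\<close> contributes \<open>v\<close> twice.\<close>

lift_definition ends :: "'a uprod \<Rightarrow> 'a multiset" is "\<lambda>(u, v). {#u, v#}"
  by (auto simp: eq_upair_def)

lemma ends_Upair [simp]: "ends (Upair u v) = {#u, v#}"
  by transfer simp

definition degree_in :: "'a uprod multiset \<Rightarrow> 'a \<Rightarrow> nat" where
  "degree_in F v = (\<Sum>e \<in># F. count (ends e) v)"

definition add_edge :: "'a \<Rightarrow> 'a \<Rightarrow> 'a multigraph \<Rightarrow> 'a multigraph" where
  "add_edge u v G = \<lparr>verts = verts G, edges = add_mset (Upair u v) (edges G)\<rparr>"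

text \<open>Each edge \<open>uv\<close> of \<open>F\<close> is replaced by \<open>su\<close> and \<open>sv\<close>, where \<open>s\<close> is meant to be a new vertex.\<close>

definition pinch :: "'a uprod multiset \<Rightarrow> 'a \<Rightarrow> 'a multigraph \<Rightarrow> 'a multigraph" where
  "pinch F s G =
     \<lparr>verts = insert s (verts G),
      edges = (edges G - F) + (\<Sum>e \<in># F. image_mset (Upair s) (ends e))\<rparr>"

inductive operation :: "nat \<Rightarrow> 'a multigraph \<Rightarrow> 'a multigraph \<Rightarrow> bool" for k where
  adding: "operation k G (add_edge u v G)" if "u \<in> verts G" "v \<in> verts G"
| pinching: "operation k G (pinch F s G)"
    if "F \<subseteq># edges G" "size F = k" "\<forall>v \<in> verts G. degree_in F v \<le> k" "s \<notin> verts G"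

end

theory Submission
  imports Defs
begin

text \<open>
  Connectivity is expressed by bisets: pairs of an inner set \<open>I\<close> and an outer set \<open>J \<supseteq> I\<close> with wall
  \<open>J - I\<close>. A graph is \<open>(2k,k)\<close>-connected iff \<open>f(I,J) = d(I,J) + k * card (J - I) \<ge> 2k\<close> whenever \<open>I\<close> is
  nonempty and \<open>J\<close> is not everything, and \<open>f\<close> is submodular. Both operations preserve this inequality.
  Conversely, undo additions of edges until deleting any edge destroys the property. In such a minimal
  graph on at least four vertices a pinching can be undone at a suitable vertex \<open>s\<close> of degree \<open>2k\<close>, by
  pairing up its edges (splitting off); on three vertices, minimality leaves only \<open>kK\<^sub>3\<close>.

  The only obstruction to a complete splitting at \<open>s\<close> is a vertex \<open>t\<close> joined to \<open>s\<close> by an odd number of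
  edges such that every other neighbour of \<open>s\<close> lies in a tight biset with wall \<open>{t}\<close>: uncrossing shows
  that an edge at \<open>s\<close> of maximum multiplicity without admissible partner yields such a \<open>t\<close>, and that
  an admissible pair can be chosen so that no obstruction arises. Finally, take a tight biset with a
  one-element wall whose inner set is smallest; it contains a vertex of degree \<open>2k\<close>, and an obstruction
  there would force exactly \<open>k\<close> edges to a vertex where their number has to be odd, or more than \<open>2k\<close>
  edges in total.
\<close>

section \<open>Cuts of bisets\<close>

text \<open>A wall with two vertices pays \<open>2 * k\<close> by itself, which rescues many of
  these degenerate cases; the others have to be pinned down to explicit configurations, such as the
  complement of a single vertex. Contradictions come from strictness: two bisets that share a
  neighbour of \<open>s\<close> lose its edges when they are replaced by their differences.
  Minimality has a double use. It provides, for every edge, a tight biset crossed by that edge,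
  which is the raw material for finding a vertex of degree \<open>2 * k\<close>; and it excludes
  loops, so that the edges at this vertex are described by a multiset of neighbours. The evenness of
  \<open>k\<close> pays off at the very end: a vertex joined to the chosen one by exactly
  \<open>k\<close> edges cannot be an obstacle.\<close>

definition cross :: "'a set \<Rightarrow> 'a set \<Rightarrow> 'a uprod \<Rightarrow> bool" where
  "cross I J e \<longleftrightarrow> (\<exists>p q. e = Upair p q \<and> p \<in> I \<and> q \<notin> J)"

lemma cross_Upair [simp]:
  "cross I J (Upair p q) \<longleftrightarrow> (p \<in> I \<and> q \<notin> J) \<or> (q \<in> I \<and> p \<notin> J)"
  unfolding cross_def by auto

definition cut :: "'a uprod multiset \<Rightarrow> 'a set \<Rightarrow> 'a set \<Rightarrow> nat" where
  "cut E I J = size (filter_mset (cross I J) E)"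

lemma cut_empty [simp]: "cut {#} I J = 0"
  by (simp add: cut_def)

lemma cut_add_mset [simp]: "cut (add_mset e E) I J = of_bool (cross I J e) + cut E I J"
  by (simp add: cut_def)

lemma cut_union [simp]: "cut (D + E) I J = cut D I J + cut E I J"
  by (simp add: cut_def)

section \<open>Counting neighbours with multiplicity\<close>

definition weight :: "'a multiset \<Rightarrow> 'a set \<Rightarrow> nat" where
  "weight N A = size (filter_mset (\<lambda>v. v \<in> A) N)"

lemma weight_empty_mset [simp]: "weight {#} A = 0"
  by (simp add: weight_def)

lemma weight_add_mset [simp]: "weight (add_mset v N) A = of_bool (v \<in> A) + weight N A"
  by (simp add: weight_def)

lemma weight_union_mset [simp]: "weight (M + N) A = weight M A + weight N A"
  by (simp add: weight_def)

lemma weight_empty [simp]: "weight N {} = 0"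
  by (induction N) auto

lemma weight_singleton [simp]: "weight N {v} = count N v"
  by (induction N) auto

lemma weight_Un_Int: "weight N (A \<union> B) + weight N (A \<inter> B) = weight N A + weight N B"
  by (induction N) auto

lemma weight_mono: "(\<And>v. v \<in># N \<Longrightarrow> v \<in> A \<Longrightarrow> v \<in> B) \<Longrightarrow> weight N A \<le> weight N B"
  by (induction N) auto

lemma weight_size: "set_mset N \<subseteq> A \<Longrightarrow> weight N A = size N"
  by (induction N) auto

lemma weight_pos_iff: "0 < weight N A \<longleftrightarrow> (\<exists>v. v \<in># N \<and> v \<in> A)"
  by (induction N) auto

lemma weight_Diff: "B \<subseteq> A \<Longrightarrow> weight N (A - B) + weight N B = weight N A"
  by (induction N) auto

lemma weight_disj: "A \<inter> B = {} \<Longrightarrow> weight N (A \<union> B) = weight N A + weight N B"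
  using weight_Un_Int[of N A B] by simp

lemma weight_insert: "x \<notin> A \<Longrightarrow> weight N (insert x A) = count N x + weight N A"
  using weight_disj[of "{x}" A N] by simp

section \<open>Uncrossing inequalities for cuts and walls\<close>

lemma cut_Int_Un:
  assumes "I \<subseteq> J" "I' \<subseteq> J'"
  shows "cut E (I \<inter> I') (J \<inter> J') + cut E (I \<union> I') (J \<union> J') \<le> cut E I J + cut E I' J'"
proof (induction E)
  case (add e E)
  show ?case by (cases e) (use add assms in \<open>auto split: if_splits\<close>)
qed simp

lemma cut_Diff:
  assumes "I \<subseteq> J" "I' \<subseteq> J'"
  shows "cut E (I - J') (J - I') + cut E (I' - J) (J' - I) \<le> cut E I J + cut E I' J'"
proof (induction E)
  case (add e E)
  show ?case by (cases e) (use add assms in \<open>auto split: if_splits\<close>)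
qed simp

lemma cut_compl:
  assumes "\<forall>e\<in>#E. set_uprod e \<subseteq> V"
  shows "cut E (V - J) (V - I) = cut E I J"
  using assms
proof (induction E)
  case (add e E)
  show ?case by (cases e) (use add in \<open>auto split: if_splits\<close>)
qed simp

text \<open>The four inner sets on the left are pairwise disjoint, so a single edge crosses at most
  two of these bisets; the inequality is checked edge by edge.\<close>

lemma cut_three:
  assumes "I \<subseteq> J" "I' \<subseteq> J'" "I'' \<subseteq> J''"
  shows "cut E (I \<inter> I' \<inter> I'') (J \<inter> J' \<inter> J'')
     + cut E (I - J' - J'') (J - I' - I'') + cut E (I' - J - J'') (J' - I - I'')
     + cut E (I'' - J - J') (J'' - I - I')
     \<le> cut E I J + cut E I' J' + cut E I'' J''"
proof (induction E)
  case (add e E)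
  obtain p q where e: "e = Upair p q" by (cases e)
  have "of_bool (cross (I \<inter> I' \<inter> I'') (J \<inter> J' \<inter> J'') e)
     + of_bool (cross (I - J' - J'') (J - I' - I'') e) + of_bool (cross (I' - J - J'') (J' - I - I'') e)
     + of_bool (cross (I'' - J - J') (J'' - I - I') e)
     \<le> (of_bool (cross I J e) + of_bool (cross I' J' e) + of_bool (cross I'' J'' e) :: nat)"
    unfolding e cross_Upair of_bool_def using assms
    by (smt (verit, ccfv_threshold) DiffE DiffI IntE IntI add.commute add.left_commute add_0 le_numeral_extra(3) le_numeral_extra(4) subsetD add_le_mono zero_le)
  then show ?case using add by simp
qed simp

lemma card_wall_Int_Un:
  assumes "finite J" "finite J'" "I \<subseteq> J" "I' \<subseteq> J'"
  shows "card (J \<inter> J' - I \<inter> I') + card ((J \<union> J') - (I \<union> I')) = card (J - I) + card (J' - I')"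
proof -
  have "(J \<inter> J' - I \<inter> I') \<union> ((J \<union> J') - (I \<union> I')) = (J - I) \<union> (J' - I')"
    "(J \<inter> J' - I \<inter> I') \<inter> ((J \<union> J') - (I \<union> I')) = (J - I) \<inter> (J' - I')"
    using assms by auto
  then show ?thesis
    using card_Un_Int[of "J \<inter> J' - I \<inter> I'" "(J \<union> J') - (I \<union> I')"] card_Un_Int[of "J - I" "J' - I'"] assms
    by simp
qed

lemma card_wall_Diff:
  assumes "finite J" "finite J'" "I \<subseteq> J" "I' \<subseteq> J'"
  shows "card ((J - I') - (I - J')) + card ((J' - I) - (I' - J)) = card (J - I) + card (J' - I')"
proof -
  have "((J - I') - (I - J')) \<union> ((J' - I) - (I' - J)) = (J - I) \<union> (J' - I')"
    "((J - I') - (I - J')) \<inter> ((J' - I) - (I' - J)) = (J - I) \<inter> (J' - I')"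
    using assms by auto
  then show ?thesis
    using card_Un_Int[of "(J - I') - (I - J')" "(J' - I) - (I' - J)"] card_Un_Int[of "J - I" "J' - I'"] assms
    by simp
qed

text \<open>A vertex in all three walls lies in all four walls on the left, hence the correction
  term. Cardinalities are turned into sums of indicators over \<open>V\<close>, and the inequality
  holds vertex by vertex.\<close>

lemma card_wall_three:
  assumes "finite V" "I \<subseteq> J" "I' \<subseteq> J'" "I'' \<subseteq> J''" "J \<subseteq> V" "J' \<subseteq> V" "J'' \<subseteq> V"
  shows "card (J \<inter> J' \<inter> J'' - I \<inter> I' \<inter> I'') + card ((J - I' - I'') - (I - J' - J''))
     + card ((J' - I - I'') - (I' - J - J'')) + card ((J'' - I - I') - (I'' - J - J'))
     \<le> card (J - I) + card (J' - I') + card (J'' - I'') + card ((J - I) \<inter> (J' - I') \<inter> (J'' - I''))"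
proof -
  have c: "card A = (\<Sum>v\<in>V. of_bool (v \<in> A))" if "A \<subseteq> V" for A
    using assms(1) that by (simp add: of_bool_def sum.If_cases Int_absorb1 Collect_mem_eq)
  have S: "A \<subseteq> V \<Longrightarrow> A - B \<subseteq> V" "A \<subseteq> V \<Longrightarrow> A \<inter> B \<subseteq> V" for A B by auto
  show ?thesis
    apply (subst c, use assms S in blast)+
    unfolding sum.distrib[symmetric]
    apply (rule sum_mono)
    using assms by (auto simp: of_bool_def split: if_splits)
qed

section \<open>Uncrossing tight and dangerous bisets\<close>

text \<open>
  The multiset \<open>N\<close> records the other ends of the edges at an additional vertex \<open>s\<close> outside \<open>V\<close> that is to
  be split off; \<open>E\<close> contains the remaining edges. As \<open>s\<close> lies outside every \<open>J\<close>, the vertex \<open>s\<close> itself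
  never has to be named.
\<close>

definition mix_conn :: "nat \<Rightarrow> 'a set \<Rightarrow> 'a uprod multiset \<Rightarrow> 'a multiset \<Rightarrow> bool" where
  "mix_conn k V E N \<longleftrightarrow> (\<forall>I J. I \<subseteq> J \<and> J \<subseteq> V \<and> I \<noteq> {} \<and> J \<noteq> V \<longrightarrow>
     2 * k \<le> cut E I J + weight N I + k * card (J - I))"

locale split_graph =
  fixes k :: nat and V :: "'a set" and E :: "'a uprod multiset" and N :: "'a multiset"
  assumes fin: "finite V" and k_ge: "k \<ge> 2"
    and E_V: "\<forall>e\<in>#E. set_uprod e \<subseteq> V" and N_V: "set_mset N \<subseteq> V"
    and even_N: "even (size N)" and conn: "mix_conn k V E N"
begin

abbreviation n :: "'a set \<Rightarrow> nat" where "n \<equiv> weight N"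

definition F :: "'a set \<Rightarrow> 'a set \<Rightarrow> nat" where
  "F I J = cut E I J + n I + k * card (J - I)"

text \<open>Pairing an edge to \<open>x\<close> with an edge to a vertex of \<open>A\<close> lowers
  \<open>F\<close> by one, because the new edge ends in the wall. The value \<open>2 * k\<close>
  therefore forbids every such pair.\<close>

definition tight :: "'a \<Rightarrow> 'a set \<Rightarrow> bool" where
  "tight x A \<longleftrightarrow> x \<in> V \<and> A \<subseteq> V - {x} \<and> A \<noteq> {} \<and> insert x A \<noteq> V \<and> F A (insert x A) = 2 * k"

text \<open>A pair with both ends in \<open>I\<close> lowers \<open>F\<close> by two, so already the
  value \<open>2 * k + 1\<close> forbids it.\<close>

definition dangerous :: "'a set \<Rightarrow> 'a set \<Rightarrow> bool" where
  "dangerous I J \<longleftrightarrow> I \<subseteq> J \<and> J \<subseteq> V \<and> J \<noteq> V \<and> 2 \<le> n I \<and> F I J \<le> 2 * k + 1"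

definition max_dangerous :: "'a set \<Rightarrow> 'a set \<Rightarrow> bool" where
  "max_dangerous I J \<longleftrightarrow> dangerous I J \<and> (\<forall>I' J'. dangerous I' J' \<longrightarrow> I \<subseteq> I' \<longrightarrow> J \<subseteq> J' \<longrightarrow> I' = I \<and> J' = J)"

text \<open>A true obstruction: an edge to \<open>t\<close> cannot be paired with an edge to another
  neighbour, now or after further splittings, since tight bisets stay tight. The edges to
  \<open>t\<close> could only be paired among themselves, which fails for an odd number.\<close>

definition obstacle :: "'a \<Rightarrow> bool" where
  "obstacle t \<longleftrightarrow> odd (count N t) \<and> (\<forall>v\<in>#N. v \<noteq> t \<longrightarrow> (\<exists>A. tight t A \<and> v \<in> A))"

section \<open>Lower bounds and balance of tight and dangerous bisets\<close>

lemma F_ge: "I \<subseteq> J \<Longrightarrow> J \<subseteq> V \<Longrightarrow> I \<noteq> {} \<Longrightarrow> J \<noteq> V \<Longrightarrow> 2 * k \<le> F I J"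
  using conn unfolding mix_conn_def F_def by blast

lemma F_ge_wall: "2 \<le> card (J - I) \<Longrightarrow> 2 * k + n I \<le> F I J"
  unfolding F_def using mult_le_mono2[of 2 "card (J - I)" k] by linarith

lemma sub_finite: "A \<subseteq> V \<Longrightarrow> finite A"
  using fin finite_subset by blast

lemma wall2: "A \<subseteq> V \<Longrightarrow> x \<in> A \<Longrightarrow> y \<in> A \<Longrightarrow> x \<noteq> y \<Longrightarrow> 2 \<le> card A"
  using card_mono[OF sub_finite, of A "{x, y}"] by simp

lemma F_Int_Un:
  assumes "I \<subseteq> J" "I' \<subseteq> J'" "J \<subseteq> V" "J' \<subseteq> V"
  shows "F (I \<inter> I') (J \<inter> J') + F (I \<union> I') (J \<union> J') \<le> F I J + F I' J'"
proof -
  have "k * card (J \<inter> J' - I \<inter> I') + k * card ((J \<union> J') - (I \<union> I')) = k * card (J - I) + k * card (J' - I')"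
    using card_wall_Int_Un[OF sub_finite sub_finite assms(1,2)] assms
    by (metis distrib_left)
  then show ?thesis
    unfolding F_def using cut_Int_Un[OF assms(1,2), of E] weight_Un_Int[of N I I'] by linarith
qed

text \<open>A neighbour in both inner sets is missing from both differences, one in an inner set and
  the opposite wall from one of them. Keeping these terms on the left is the source of the strict
  inequalities later on.\<close>

lemma F_Diff:
  assumes "I \<subseteq> J" "I' \<subseteq> J'" "J \<subseteq> V" "J' \<subseteq> V"
  shows "F (I - J') (J - I') + F (I' - J) (J' - I) + 2 * n (I \<inter> I') + n (I \<inter> (J' - I')) + n (I' \<inter> (J - I))
    \<le> F I J + F I' J'"
proof -
  have "k * card ((J - I') - (I - J')) + k * card ((J' - I) - (I' - J)) = k * card (J - I) + k * card (J' - I')"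
    using card_wall_Diff[OF sub_finite sub_finite assms(1,2)] assms
    by (metis distrib_left)
  moreover have "n I = n (I - J') + (n (I \<inter> I') + n (I \<inter> (J' - I')))"
    using assms by (subst weight_disj[symmetric], blast)+ (rule arg_cong[where f = n], blast)
  moreover have "n I' = n (I' - J) + (n (I \<inter> I') + n (I' \<inter> (J - I)))"
    using assms by (subst weight_disj[symmetric], blast)+ (rule arg_cong[where f = n], blast)
  ultimately show ?thesis
    unfolding F_def using cut_Diff[OF assms(1,2), of E] by linarith
qed

lemma F_compl:
  assumes "I \<subseteq> J" "J \<subseteq> V"
  shows "F (V - J) (V - I) + n I = F I J + n (V - J)"
proof -
  have "V - I - (V - J) = J - I" using assms by blast
  then show ?thesis unfolding F_def using cut_compl[OF E_V, of J I] by simp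
qed

lemma n_V: "n V = size N"
  using weight_size[OF N_V] .

lemma n_ge_count: "v \<in> A \<Longrightarrow> count N v \<le> n A"
  using weight_mono[of N "{v}" A] by simp

text \<open>The connectivity bound is applied to the complementary biset. As \<open>s\<close> stays
  outside both, complementation changes \<open>F\<close> exactly by the difference of the two
  neighbour counts. Thus a biset of small value cannot contain many more neighbours than lie outside
  it.\<close>

lemma n_half:
  assumes "I \<subseteq> J" "J \<subseteq> V" "I \<noteq> {}" "J \<noteq> V"
  shows "n I + 2 * k \<le> n (V - J) + F I J"
  using F_compl[OF assms(1,2)] F_ge[of "V - J" "V - I"] assms by force

lemma n_split: "I \<subseteq> J \<Longrightarrow> J \<subseteq> V \<Longrightarrow> n I + n (J - I) + n (V - J) = size N"
  using weight_Diff[of I J N] weight_Diff[of J V N] n_V by simp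

lemma tightD:
  assumes "tight x A"
  shows "x \<in> V" "A \<subseteq> V" "x \<notin> A" "A \<noteq> {}" "insert x A \<noteq> V" "insert x A \<subseteq> V"
    "F A (insert x A) = 2 * k" "A \<subseteq> insert x A"
  using assms unfolding tight_def by auto

lemma tight_half:
  assumes "tight x A"
  shows "n A \<le> n (V - insert x A)" "n A + count N x + n (V - insert x A) = size N"
proof -
  note D = tightD[OF assms]
  show "n A \<le> n (V - insert x A)" using n_half[of A "insert x A"] D by auto
  have "insert x A - A = {x}" using D by auto
  then show "n A + count N x + n (V - insert x A) = size N"
    using n_split[of A "insert x A"] D by auto
qed

lemma tight_half_odd:
  assumes "tight x A" "odd (count N x)"
  shows "n A < n (V - insert x A)"
  using tight_half[OF assms(1)] assms(2) even_N
  by (metis even_add le_neq_implies_less)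

text \<open>The neighbour \<open>u\<close> in \<open>I\<close> pushes the bound of
  \<open>F_ge_wall\<close> above \<open>2 * k\<close>, so the wall has no second vertex besides
  \<open>x\<close>.\<close>

lemma tightI:
  assumes "I \<subseteq> J" "J \<subseteq> V" "J \<noteq> V" "x \<in> J - I" "u \<in># N" "u \<in> I" "F I J \<le> 2 * k"
  shows "tight x I" "J = insert x I"
proof -
  have n: "0 < n I" using assms weight_pos_iff by blast
  have "\<not> 2 \<le> card (J - I)" using F_ge_wall[of J I] n assms by linarith
  then show J: "J = insert x I" using wall2[of "J - I" x] assms by blast
  show "tight x I" unfolding tight_def using J assms F_ge[of I J] by fastforce
qed

lemma dangerousD:
  assumes "dangerous I J"
  shows "I \<subseteq> J" "J \<subseteq> V" "J \<noteq> V" "2 \<le> n I" "F I J \<le> 2 * k + 1" "I \<noteq> {}" "\<not> 2 \<le> card (J - I)"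
    "n I \<le> n (V - J) + 1" "2 * n I \<le> size N" "I \<subseteq> V"
proof -
  show 1: "I \<subseteq> J" "J \<subseteq> V" "J \<noteq> V" "2 \<le> n I" "F I J \<le> 2 * k + 1"
    using assms unfolding dangerous_def by auto
  then show "I \<subseteq> V" by blast
  show 2: "I \<noteq> {}" using 1 by auto
  show "\<not> 2 \<le> card (J - I)" using F_ge_wall[of J I] 1 by linarith
  show 3: "n I \<le> n (V - J) + 1" using n_half[of I J] 1 2 by linarith
  have "n I + n (J - I) + n (V - J) = size N" using n_split 1 by blast
  \<comment> \<open>The balance only gives \<open>size N + 1\<close> on the right; the evenness of
    \<open>size N\<close> removes the 1.\<close>
  then show "2 * n I \<le> size N" using 3 even_N by presburger
qed

lemma dangerous_wall: "dangerous I J \<Longrightarrow> x \<in> J - I \<Longrightarrow> J = insert x I"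
  using dangerousD[of I J] wall2[of "J - I" x] by blast

lemma dangerous_half_wall:
  assumes "dangerous I J" "x \<in> J - I"
  shows "2 * n I + count N x \<le> size N + 1"
proof -
  have "J - I = {x}" using dangerous_wall[OF assms] assms by auto
  then show ?thesis using n_split[of I J] dangerousD[OF assms(1)] by auto
qed

lemma dangerous_not_cover: "dangerous I J \<Longrightarrow> \<exists>v\<in>#N. v \<notin> I"
proof (rule ccontr)
  assume a: "dangerous I J" "\<not> (\<exists>v\<in>#N. v \<notin> I)"
  then have "n I = size N" using weight_size[of N I] by auto
  then show False using dangerousD[OF a(1)] by linarith
qed

lemma max_dangerousD:
  assumes "max_dangerous I J"
  shows "dangerous I J" "\<And>I' J'. dangerous I' J' \<Longrightarrow> I \<subseteq> I' \<Longrightarrow> J \<subseteq> J' \<Longrightarrow> I' = I \<and> J' = J"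
  using assms unfolding max_dangerous_def by blast+

lemma ex_max_dangerous:
  assumes "dangerous I J"
  obtains I' J' where "max_dangerous I' J'" "I \<subseteq> I'" "J \<subseteq> J'"
proof -
  let ?P = "\<lambda>(A, B). dangerous A B \<and> I \<subseteq> A \<and> J \<subseteq> B"
  let ?f = "\<lambda>(A, B). card A + card B"
  have b: "\<forall>y. ?P y \<longrightarrow> ?f y < 2 * card V + 1"
  proof (clarify)
    fix A B assume "dangerous A B"
    then have "card A \<le> card V" "card B \<le> card V"
      using dangerousD[of A B] fin by (auto intro!: card_mono)
    then show "card A + card B < 2 * card V + 1" by linarith
  qed
  obtain X where X: "?P X" "\<forall>y. ?P y \<longrightarrow> ?f y \<le> ?f X"
    using ex_has_greatest_nat[of ?P "(I, J)" ?f "2 * card V + 1"] b assms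
    by (metis (mono_tags, lifting) case_prodI order_refl less_imp_le)
  obtain A B where AB: "X = (A, B)" by fastforce
  have "max_dangerous A B" unfolding max_dangerous_def
  proof (intro conjI allI impI)
    show "dangerous A B" using X AB by auto
  next
    fix I' J' assume h: "dangerous I' J'" "A \<subseteq> I'" "B \<subseteq> J'"
    have "I \<subseteq> I'" "J \<subseteq> J'" using X AB h by auto
    then have "card I' + card J' \<le> card A + card B" using X(2)[rule_format, of "(I', J')"] AB h(1) by simp
    moreover have "finite I'" "finite J'" using dangerousD[OF h(1)] sub_finite by auto
    ultimately show "I' = A" "J' = B"
      using h card_mono[of I' A] card_mono[of J' B] card_subset_eq[of I' A] card_subset_eq[of J' B]
      by (metis add_le_cancel_left add_le_mono1 le_add1 le_antisym order.trans add.commute)+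
  qed
  then show thesis using that X AB by auto
qed

section \<open>Uncrossing two tight or maximal dangerous bisets\<close>

lemma max_dangerous_Un:
  assumes "max_dangerous I J" "I' \<subseteq> J'" "J' \<subseteq> V" "J \<union> J' \<noteq> V" "F (I \<union> I') (J \<union> J') \<le> 2 * k + 1"
  shows "I' \<subseteq> I" "J' \<subseteq> J"
proof -
  note D = dangerousD[OF max_dangerousD(1)[OF assms(1)]]
  have "n I \<le> n (I \<union> I')" by (rule weight_mono) auto
  then have "dangerous (I \<union> I') (J \<union> J')" unfolding dangerous_def using D assms by auto
  then show "I' \<subseteq> I" "J' \<subseteq> J" using max_dangerousD(2)[OF assms(1)] by blast+
qed

text \<open>The degenerate case of \<open>tight_nested\<close>: the inner set of one difference is
  empty, so that \<open>F_ge\<close> says nothing about it. Intersection and union are used instead;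
  if the conclusion failed, one of them would have both \<open>x\<close> and \<open>y\<close> in its
  wall.\<close>

lemma tight_nested_diff:
  assumes A: "tight x A" and B: "tight y B" and xy: "x \<noteq> y" and u: "u \<in># N" "u \<in> A" "u \<in> B"
    and sub: "A \<subseteq> insert y B" and w: "\<not> 2 \<le> card ((insert x A - B) - (A - insert y B))"
  shows "insert x A \<subseteq> B"
proof -
  note a = tightD[OF A] and b = tightD[OF B]
  have P: "F (A \<inter> B) (insert x A \<inter> insert y B) + F (A \<union> B) (insert x A \<union> insert y B) \<le> 4 * k"
    using F_Int_Un[of A "insert x A" B "insert y B"] a b by auto
  have nu: "0 < n (A \<inter> B)" "0 < n (A \<union> B)" using u weight_pos_iff by blast+
  have w': "\<not> (x \<notin> B \<and> y \<in> A)"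
  proof
    assume h: "x \<notin> B \<and> y \<in> A"
    show False using w wall2[of "(insert x A - B) - (A - insert y B)" x y] h xy a b by blast
  qed
  show ?thesis
  proof (cases "y \<in> A")
    case True
    then have x: "x \<in> B" using w' by blast
    have e: "insert x A \<union> insert y B = insert y B" using x sub by blast
    have f: "A \<union> B = insert y B" using sub True by blast
    have "2 * k \<le> F (A \<union> B) (insert x A \<union> insert y B)"
      unfolding e f by (rule F_ge) (use b in auto)
    moreover have "2 * k + n (A \<inter> B) \<le> F (A \<inter> B) (insert x A \<inter> insert y B)"
      by (rule F_ge_wall, rule wall2[of _ x y]) (use x True a b xy in auto)
    ultimately show ?thesis using P nu by linarith
  next
    case False
    then have AB: "A \<subseteq> B" using sub by blast
    show ?thesis
    proof (rule ccontr)
      assume "\<not> insert x A \<subseteq> B"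
      then have x: "x \<notin> B" using AB by blast
      have e: "insert x A \<inter> insert y B = A" "A \<inter> B = A" using x xy AB a by auto
      have "2 * k \<le> F (A \<inter> B) (insert x A \<inter> insert y B)"
        unfolding e by (rule F_ge) (use a in auto)
      moreover have "2 * k + n (A \<union> B) \<le> F (A \<union> B) (insert x A \<union> insert y B)"
        by (rule F_ge_wall, rule wall2[of _ x y]) (use x AB a b xy in auto)
      ultimately show False using P nu by linarith
    qed
  qed
qed

text \<open>The common neighbour makes the difference inequality strict, so one difference falls
  below \<open>2 * k\<close>. Its inner set must then be empty and its wall small, and
  \<open>tight_nested_diff\<close> turns this into nesting.\<close>

lemma tight_nested:
  assumes A: "tight x A" and B: "tight y B" and xy: "x \<noteq> y" and u: "u \<in># N" "u \<in> A" "u \<in> B"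
  shows "insert x A \<subseteq> B \<or> insert y B \<subseteq> A"
proof (rule ccontr)
  assume neg: "\<not> ?thesis"
  note a = tightD[OF A] and b = tightD[OF B]
  have nu: "0 < n (A \<inter> B)" using u weight_pos_iff by blast
  have D: "F (A - insert y B) (insert x A - B) + F (B - insert x A) (insert y B - A) + 2 * n (A \<inter> B) \<le> 4 * k"
    using F_Diff[of A "insert x A" B "insert y B"] a b by auto
  have "2 * k \<le> F (A - insert y B) (insert x A - B)"
  proof (cases "A \<subseteq> insert y B")
    case True
    then show ?thesis using tight_nested_diff[OF A B xy u True] neg F_ge_wall by fastforce
  next
    case False
    then show ?thesis by (intro F_ge) (use a b in auto)
  qed
  moreover have "2 * k \<le> F (B - insert x A) (insert y B - A)"
  proof (cases "B \<subseteq> insert x A")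
    case True
    then show ?thesis using tight_nested_diff[OF B A xy[symmetric] u(1,3,2) True] neg F_ge_wall by fastforce
  next
    case False
    then show ?thesis by (intro F_ge) (use a b in auto)
  qed
  ultimately show False using D nu by linarith
qed

lemma tight_Diff:
  assumes A: "tight t A" and B: "tight t B" and ne: "A - B \<noteq> {}" "B - A \<noteq> {}"
  shows "tight t (A - B)" "tight t (B - A)" "n (A \<inter> B) = 0"
proof -
  note a = tightD[OF A] and b = tightD[OF B]
  have e: "A - insert t B = A - B" "insert t A - B = insert t (A - B)"
    "B - insert t A = B - A" "insert t B - A = insert t (B - A)" using a b by auto
  have D: "F (A - B) (insert t (A - B)) + F (B - A) (insert t (B - A)) + 2 * n (A \<inter> B) \<le> 4 * k"
    using F_Diff[of A "insert t A" B "insert t B"] a b unfolding e by auto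
  have "2 * k \<le> F (A - B) (insert t (A - B))" "2 * k \<le> F (B - A) (insert t (B - A))"
    by (rule F_ge; use a b ne in blast)+
  then show "tight t (A - B)" "tight t (B - A)" "n (A \<inter> B) = 0"
    unfolding tight_def using D a b ne by auto
qed

lemma tight_comparable:
  assumes A: "tight t A" and B: "tight t B" and u: "u \<in># N" "u \<in> A" "u \<in> B"
  shows "A \<subseteq> B \<or> B \<subseteq> A"
proof -
  have "0 < n (A \<inter> B)" using u weight_pos_iff by blast
  then show ?thesis using tight_Diff[OF A B] by auto
qed

text \<open>If the outer sets do not cover \<open>V\<close>, maximality absorbs the union. If they
  do, one of the differences is degenerate, and the only configuration that survives is the
  complement of \<open>x\<close> with empty wall.\<close>

lemma tight_max_dangerous:
  assumes W: "tight x W" and Y: "max_dangerous I J" and u: "u \<in># N" "u \<in> W" "u \<in> I"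
  shows "(W \<subseteq> I \<and> x \<in> J) \<or> (I = V - {x} \<and> J = V - {x})"
proof -
  note w = tightD[OF W] and y = dangerousD[OF max_dangerousD(1)[OF Y]]
  have nu: "0 < n (W \<inter> I)" "0 < n (W \<union> I)" using u weight_pos_iff by blast+
  have P: "F (W \<inter> I) (insert x W \<inter> J) + F (I \<union> W) (J \<union> insert x W) \<le> 4 * k + 1"
    using F_Int_Un[of W "insert x W" I J] w y by (auto simp: Un_commute)
  have D: "F (W - J) (insert x W - I) + F (I - insert x W) (J - W) + 2 * n (W \<inter> I) \<le> 4 * k + 1"
    using F_Diff[of W "insert x W" I J] w y by auto
  have F1: "2 * k \<le> F (W \<inter> I) (insert x W \<inter> J)"
    by (rule F_ge) (use w y u in auto)
  show ?thesis
  proof (cases "J \<union> insert x W = V")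
    case False
    then show ?thesis using max_dangerous_Un[OF Y, of W "insert x W"] P F1 w by fastforce
  next
    case V: True
    have nI: "n I \<le> n (I \<union> W)" by (rule weight_mono) auto
    have card1: "\<not> 2 \<le> card (J \<union> insert x W - (I \<union> W))"
      using F_ge_wall[of "J \<union> insert x W" "I \<union> W"] P F1 nI y by linarith
    have "\<not> (2 * k \<le> F (W - J) (insert x W - I) \<and> 2 * k \<le> F (I - insert x W) (J - W))"
      using D nu by linarith
    then consider "\<not> 2 * k \<le> F (W - J) (insert x W - I)" | "\<not> 2 * k \<le> F (I - insert x W) (J - W)"
      by blast
    then show ?thesis
    proof cases
      case 1
      have WJ: "W \<subseteq> J"
        using 1 F_ge[of "W - J" "insert x W - I"] w y by blast
      have c: "\<not> 2 \<le> card ((insert x W - I) - (W - J))"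
        using 1 F_ge_wall[of "insert x W - I" "W - J"] by linarith
      have x: "x \<notin> J" using V WJ y by blast
      have WI: "W \<subseteq> I"
      proof
        fix z assume z: "z \<in> W"
        show "z \<in> I"
        proof (rule ccontr)
          assume "z \<notin> I"
          then have "2 \<le> card ((insert x W - I) - (W - J))"
            by (intro wall2[of _ x z]) (use z x WJ w(1,2,3) y(1,2) in auto)
          then show False using c by blast
        qed
      qed
      have "J \<subseteq> I"
      proof
        fix z assume z: "z \<in> J"
        show "z \<in> I"
        proof (rule ccontr)
          assume "z \<notin> I"
          then have "2 \<le> card (J \<union> insert x W - (I \<union> W))"
            by (intro wall2[of _ x z]) (use z x WI WJ w(1,2,3) y(1,2) in auto)
          then show False using card1 by blast
        qed
      qed
      then show ?thesis using V WJ x y by blast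
    next
      case 2
      have IW: "I \<subseteq> insert x W"
        using 2 F_ge[of "I - insert x W" "J - W"] w y u by blast
      have c: "\<not> 2 \<le> card ((J - W) - (I - insert x W))"
        using 2 F_ge_wall[of "J - W" "I - insert x W"] by linarith
      obtain z where z: "z \<in> J" "z \<notin> insert x W" using V w by blast
      then have zI: "z \<notin> I" using IW by blast
      have xI: "x \<in> I"
      proof (rule ccontr)
        assume "x \<notin> I"
        then have "2 \<le> card (J \<union> insert x W - (I \<union> W))"
          by (intro wall2[of _ x z]) (use z zI w(1,2,3) y(1,2) in auto)
        then show False using card1 by blast
      qed
      have "2 \<le> card ((J - W) - (I - insert x W))"
        by (rule wall2[of _ x z]) (use z zI xI w(1,2,3) y(1,2) in auto)
      then show ?thesis using c by blast
    qed
  qed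
qed

text \<open>If the outer sets do not cover \<open>V\<close>, maximality forces the value of the
  union up to \<open>2 * k + 2\<close>, which leaves at most \<open>2 * k\<close> for the
  intersection; \<open>v\<close> lies in its wall.\<close>

lemma max_dangerous_wall_tset:
  assumes X: "max_dangerous I J" and Y: "max_dangerous I' J'" and u: "u \<in># N" "u \<in> I" "u \<in> I'"
    and v: "v \<in># N" "v \<in> I" "v \<in> J'" "v \<notin> I'"
  shows "tight v (I \<inter> I')"
proof -
  note x = dangerousD[OF max_dangerousD(1)[OF X]] and y = dangerousD[OF max_dangerousD(1)[OF Y]]
  have nu: "0 < n (I \<inter> I')" "0 < n (I \<inter> (J' - I'))" using u v weight_pos_iff by blast+
  have P: "F (I \<inter> I') (J \<inter> J') + F (I' \<union> I) (J' \<union> J) \<le> 4 * k + 2"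
    using F_Int_Un[of I J I' J'] x y by (auto simp: Un_commute)
  have D: "F (I - J') (J - I') + F (I' - J) (J' - I) + 2 * n (I \<inter> I') + n (I \<inter> (J' - I')) \<le> 4 * k + 2"
    using F_Diff[of I J I' J'] x y by auto
  show ?thesis
  proof (cases "J' \<union> J = V")
    case False
    have "\<not> F (I' \<union> I) (J' \<union> J) \<le> 2 * k + 1"
      using max_dangerous_Un[OF Y, of I J] False x v by blast
    then have "F (I \<inter> I') (J \<inter> J') \<le> 2 * k" using P by linarith
    then show ?thesis
      by (intro tightI(1)[of "I \<inter> I'" "J \<inter> J'" v u]) (use x y u v in auto)
  next
    case V: True
    \<comment> \<open>The shared neighbour \<open>u\<close> counts twice and \<open>v\<close> once:
      together at least 3, one more than the slack 2 of two dangerous bisets.\<close>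
    have "\<not> (2 * k \<le> F (I - J') (J - I') \<and> 2 * k \<le> F (I' - J) (J' - I))"
      using D nu by linarith
    then consider "\<not> 2 * k \<le> F (I - J') (J - I')" | "\<not> 2 * k \<le> F (I' - J) (J' - I)" by blast
    then show ?thesis
    proof cases
      case 1
      have IJ: "I \<subseteq> J'" using 1 F_ge[of "I - J'" "J - I'"] x y u by blast
      obtain z where z: "z \<in> J" "z \<notin> J'" using V x y by blast
      have "2 \<le> card ((J - I') - (I - J'))"
        by (rule wall2[of _ v z]) (use z IJ x y v in auto)
      then show ?thesis using 1 F_ge_wall by fastforce
    next
      case 2
      have IJ: "I' \<subseteq> J" using 2 F_ge[of "I' - J" "J' - I"] x y u by blast
      obtain z where z: "z \<in> J'" "z \<notin> J" using V x y by blast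
      then show ?thesis using dangerous_wall[OF max_dangerousD(1)[OF Y], of v] IJ v x by blast
    qed
  qed
qed

text \<open>
  If all three walls are the same vertex, the three-set inequality loses \<open>k\<close>; it still gives
  \<open>8k + 2 \<le> 6k + 3 + k\<close>, so this is where \<open>k \<ge> 2\<close> is essential.
\<close>

lemma no_three_dangerous:
  assumes X: "dangerous I J" and Y: "dangerous I' J'" and Z: "dangerous I'' J''"
    and u: "u \<in># N" "u \<in> I" "u \<in> I'" "u \<in> I''"
    and ne: "I - J' - J'' \<noteq> {}" "I' - J - J'' \<noteq> {}" "I'' - J - J' \<noteq> {}"
  shows False
proof -
  note x = dangerousD[OF X] and y = dangerousD[OF Y] and z = dangerousD[OF Z]
  have "card ((J - I) \<inter> (J' - I') \<inter> (J'' - I'')) \<le> 1"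
    using x(7) card_mono[of "J - I" "(J - I) \<inter> (J' - I') \<inter> (J'' - I'')"] sub_finite[OF x(2)] by fastforce
  then have "k * card ((J - I) \<inter> (J' - I') \<inter> (J'' - I'')) \<le> k" by simp
  moreover have "k * card (J \<inter> J' \<inter> J'' - I \<inter> I' \<inter> I'') + k * card ((J - I' - I'') - (I - J' - J''))
     + k * card ((J' - I - I'') - (I' - J - J'')) + k * card ((J'' - I - I') - (I'' - J - J'))
     \<le> k * card (J - I) + k * card (J' - I') + k * card (J'' - I'') + k * card ((J - I) \<inter> (J' - I') \<inter> (J'' - I''))"
    using mult_le_mono2[OF card_wall_three[OF fin x(1) y(1) z(1) x(2) y(2) z(2)], of k]
    by (simp only: distrib_left)
  moreover have "n (I \<inter> I' \<inter> I'') + n (I - J' - J'') + n (I' - J - J'') + n (I'' - J - J')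
    + 2 * n (I \<inter> I' \<inter> I'') \<le> n I + n I' + n I''"
  proof -
    have "n (I \<inter> I' \<inter> I'') + n (I - J' - J'') = n ((I \<inter> I' \<inter> I'') \<union> (I - J' - J''))"
      using y by (intro weight_disj[symmetric]) blast
    also have "\<dots> \<le> n I" by (rule weight_mono) auto
    finally have 1: "n (I \<inter> I' \<inter> I'') + n (I - J' - J'') \<le> n I" .
    have "n (I \<inter> I' \<inter> I'') + n (I' - J - J'') = n ((I \<inter> I' \<inter> I'') \<union> (I' - J - J''))"
      using x by (intro weight_disj[symmetric]) blast
    also have "\<dots> \<le> n I'" by (rule weight_mono) auto
    finally have 2: "n (I \<inter> I' \<inter> I'') + n (I' - J - J'') \<le> n I'" .
    have "n (I \<inter> I' \<inter> I'') + n (I'' - J - J') = n ((I \<inter> I' \<inter> I'') \<union> (I'' - J - J'))"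
      using x by (intro weight_disj[symmetric]) blast
    also have "\<dots> \<le> n I''" by (rule weight_mono) auto
    finally show ?thesis using 1 2 by linarith
  qed
  ultimately have "F (I \<inter> I' \<inter> I'') (J \<inter> J' \<inter> J'')
     + F (I - J' - J'') (J - I' - I'') + F (I' - J - J'') (J' - I - I'')
     + F (I'' - J - J') (J'' - I - I') + 2 * n (I \<inter> I' \<inter> I'')
     \<le> F I J + F I' J' + F I'' J'' + k"
    unfolding F_def using cut_three[OF x(1) y(1) z(1), of E] by linarith
  moreover have "2 * k \<le> F (I \<inter> I' \<inter> I'') (J \<inter> J' \<inter> J'')"
    by (rule F_ge; use x y z u in blast)
  moreover have "2 * k \<le> F (I - J' - J'') (J - I' - I'')" "2 * k \<le> F (I' - J - J'') (J' - I - I'')"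
     "2 * k \<le> F (I'' - J - J') (J'' - I - I')"
    by (rule F_ge; use x y z u ne in blast)+
  moreover have "0 < n (I \<inter> I' \<inter> I'')" using u weight_pos_iff by blast
  ultimately show False using x y z k_ge by linarith
qed

end

section \<open>Blocked pairs\<close>

text \<open>An edge that stops crossing when \<open>u\<close> is put into the wall ends at
  \<open>u\<close>; as \<open>A\<close> and \<open>B\<close> are disjoint, no edge is lost
  twice.\<close>

lemma cut_disjoint_vertex:
  assumes "A \<inter> B = {}" "u \<notin> A" "u \<notin> B"
  shows "cut E A A + cut E B B \<le> cut E A (insert u A) + cut E B (insert u B) + cut E {u} {u}"
proof (induction E)
  case (add e E)
  show ?case by (cases e) (use add assms in \<open>auto split: if_splits\<close>)
qed simp

context split_graph
begin

text \<open>An admissible pair. The case \<open>u = v\<close> asks for two edges to the same vertex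
  and produces a loop there.\<close>

definition split_ok :: "'a \<Rightarrow> 'a \<Rightarrow> bool" where
  "split_ok u v \<longleftrightarrow> {#u, v#} \<subseteq># N \<and> mix_conn k V (add_mset (Upair u v) E) (N - {#u, v#})"

text \<open>A biset violated after the splitting has lost one for each end in \<open>I\<close> and
  regained one if the new edge crosses it. A net loss needs both ends in \<open>I\<close>, or one in
  \<open>I\<close> and the other in the wall.\<close>

lemma split_blocked:
  assumes uv: "{#u, v#} \<subseteq># N" and not: "\<not> split_ok u v"
  shows "(\<exists>I J. max_dangerous I J \<and> u \<in> I \<and> v \<in> I) \<or> (\<exists>A. tight v A \<and> u \<in> A) \<or> (\<exists>A. tight u A \<and> v \<in> A)"
proof -
  obtain I J where IJ: "I \<subseteq> J" "J \<subseteq> V" "I \<noteq> {}" "J \<noteq> V"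
    and lt: "cut (add_mset (Upair u v) E) I J + weight (N - {#u, v#}) I + k * card (J - I) < 2 * k"
    using not uv unfolding split_ok_def mix_conn_def by (metis not_less)
  obtain N' where N': "N = add_mset u (add_mset v N')"
    using uv by (metis add_mset_add_single subset_mset.add_diff_inverse union_mset_add_mset_left add.left_neutral)
  have "n I = of_bool (u \<in> I) + of_bool (v \<in> I) + weight (N - {#u, v#}) I"
    unfolding N' by simp
  then have lt2: "F I J + of_bool (cross I J (Upair u v)) < 2 * k + of_bool (u \<in> I) + of_bool (v \<in> I)"
    unfolding F_def using lt by simp
  have uN: "u \<in># N" "v \<in># N" unfolding N' by auto
  have ge: "2 * k \<le> F I J" using F_ge IJ by blast
  consider "u \<in> I" "v \<in> I" | "u \<in> I" "v \<notin> I" "v \<in> J" | "v \<in> I" "u \<notin> I" "u \<in> J"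
    using lt2 ge by (auto simp: of_bool_def split: if_splits)
  then show ?thesis
  proof cases
    case 1
    have "2 \<le> n I" unfolding N' using 1 by simp
    then have "dangerous I J" unfolding dangerous_def using IJ lt2 1 by auto
    then show ?thesis using ex_max_dangerous 1 by (metis subsetD)
  next
    case 2
    then have "tight v I" using tightI(1)[of I J v u] IJ uN lt2 by auto
    then show ?thesis using 2 by blast
  next
    case 3
    then have "tight u I" using tightI(1)[of I J u v] IJ uN lt2 by auto
    then show ?thesis using 3 by blast
  qed
qed

lemma pair_subset: "u \<in># N \<Longrightarrow> v \<in># N \<Longrightarrow> u \<noteq> v \<Longrightarrow> {#u, v#} \<subseteq># N"
  by (auto simp: insert_subset_eq_iff in_diff_count)

lemma pair_subset_same: "2 \<le> count N u \<Longrightarrow> {#u, u#} \<subseteq># N"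
  by (simp add: subseteq_mset_def)

lemma cover_count:
  assumes "\<And>v. v \<in># N \<Longrightarrow> v \<in> A \<or> v \<in> B"
  shows "n A + n B = size N + n (A \<inter> B)"
proof -
  have "n (A \<union> B) = size N" by (rule weight_size) (use assms in blast)
  then show ?thesis using weight_Un_Int[of N A B] by simp
qed

text \<open>Each inner set holds at most half of the neighbours, and \<open>u\<close> is counted in
  both.\<close>

lemma dangerous_not_cover2:
  assumes "dangerous I J" "dangerous I' J'" "u \<in># N" "u \<in> I" "u \<in> I'"
  shows "\<exists>v\<in>#N. v \<notin> I \<and> v \<notin> I'"
proof (rule ccontr)
  assume "\<not> ?thesis"
  then have "n I + n I' = size N + n (I \<inter> I')" by (intro cover_count) blast
  moreover have "0 < n (I \<inter> I')" using assms weight_pos_iff by blast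
  ultimately show False using dangerousD(9)[OF assms(1)] dangerousD(9)[OF assms(2)] by linarith
qed

text \<open>Two blocking bisets, possibly equal, are chosen to cover as much of \<open>M\<close> as
  possible. An uncovered \<open>v\<close> would have a third one, and the choice gives each of the
  first two a private vertex in \<open>M\<close>. If a private vertex lay in the wall of another of
  the three, \<open>max_dangerous_wall_tset\<close> would make it the wall of a tight biset around
  \<open>u\<close>, which \<open>notw\<close> forbids. So all three private parts are nonempty,
  against \<open>no_three_dangerous\<close>.\<close>

lemma cover_two:
  assumes u: "u \<in># N" and M: "M \<subseteq> set_mset N" "M \<noteq> {}"
    and covered: "\<And>v. v \<in> M \<Longrightarrow> \<exists>I J. max_dangerous I J \<and> u \<in> I \<and> v \<in> I"
    and notw: "\<And>v A. v \<in> M \<Longrightarrow> tight v A \<Longrightarrow> u \<notin> A"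
  obtains I J I' J' where "max_dangerous I J" "max_dangerous I' J'" "u \<in> I" "u \<in> I'" "I \<inter> M \<noteq> {}" "I' \<inter> M \<noteq> {}"
    "M \<subseteq> I \<union> I'"
proof -
  let ?D = "\<lambda>(I, J). max_dangerous I J \<and> u \<in> I \<and> I \<inter> M \<noteq> {}"
  let ?P = "\<lambda>(X, Y). ?D X \<and> ?D Y"
  let ?f = "\<lambda>(X, Y). card ((fst X \<union> fst Y) \<inter> M)"
  have finM: "finite M" using M finite_subset by blast
  have b: "\<forall>y. ?P y \<longrightarrow> ?f y < card M + 1"
    using finM by (auto simp: less_Suc_eq_le intro!: card_mono)
  obtain v where v: "v \<in> M" using M by blast
  obtain I0 J0 where "?P ((I0, J0), (I0, J0))" using covered[OF v] v by auto
  then obtain Z where Z: "?P Z" "\<forall>y. ?P y \<longrightarrow> ?f y \<le> ?f Z"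
    using ex_has_greatest_nat[of ?P "((I0, J0), (I0, J0))" ?f "card M + 1"] b less_imp_le by blast
  obtain I J I' J' where Ze: "Z = ((I, J), (I', J'))" by (metis surj_pair)
  have X: "max_dangerous I J" "u \<in> I" "I \<inter> M \<noteq> {}" and Y: "max_dangerous I' J'" "u \<in> I'" "I' \<inter> M \<noteq> {}"
    using Z Ze by auto
  have max: "card ((A \<union> C) \<inter> M) \<le> card ((I \<union> I') \<inter> M)" if "?D (A, B)" "?D (C, D)" for A B C D
    using Z(2)[rule_format, of "((A, B), (C, D))"] that Ze by simp
  have "M \<subseteq> I \<union> I'"
  proof (rule ccontr)
    assume "\<not> M \<subseteq> I \<union> I'"
    then obtain v where v: "v \<in> M" "v \<notin> I" "v \<notin> I'" by blast
    obtain I'' J'' where W: "max_dangerous I'' J''" "u \<in> I''" "v \<in> I''" using covered[OF v(1)] by blast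
    have priv: "\<exists>x\<in>M. x \<in> A \<and> x \<notin> B \<and> x \<notin> I''"
      if AB: "?D (A, A')" "?D (B, B')" "A \<union> B = I \<union> I'" for A A' B B'
    proof (rule ccontr)
      assume "\<not> ?thesis"
      then have "insert v ((A \<union> B) \<inter> M) \<subseteq> (B \<union> I'') \<inter> M" using v W by blast
      moreover have "card ((B \<union> I'') \<inter> M) \<le> card ((I \<union> I') \<inter> M)"
        using max[OF AB(2), of I'' J''] W v by auto
      moreover have "card (insert v ((A \<union> B) \<inter> M)) = Suc (card ((I \<union> I') \<inter> M))"
        using v AB(3) finM by simp
      ultimately show False using card_mono[of "(B \<union> I'') \<inter> M" "insert v ((A \<union> B) \<inter> M)"] finM by simp
    qed
    obtain x where x: "x \<in> M" "x \<in> I" "x \<notin> I'" "x \<notin> I''" using priv[of I J I' J'] X Y by auto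
    obtain y where y: "y \<in> M" "y \<in> I'" "y \<notin> I" "y \<notin> I''" using priv[of I' J' I J] X Y by auto
    have out: "z \<notin> B'" if "z \<in> M" "z \<in> A" "z \<notin> B" "max_dangerous A A'" "max_dangerous B B'" "u \<in> A" "u \<in> B" for z A A' B B'
      using max_dangerous_wall_tset[OF that(4,5) u that(6,7)] notw[OF that(1)] that M by blast
    have "x \<in> I - J' - J''" "y \<in> I' - J - J''" "v \<in> I'' - J - J'"
      using out x y v X Y W by blast+
    then show False
      using no_three_dangerous[OF max_dangerousD(1)[OF X(1)] max_dangerousD(1)[OF Y(1)] max_dangerousD(1)[OF W(1)] u X(2) Y(2) W(2)] by blast
  qed
  then show thesis using that X Y by blast
qed

text \<open>If \<open>Z\<close> left \<open>J\<close>, removing \<open>insert u Z\<close> from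
  \<open>I\<close> would yield a tight biset with wall \<open>u\<close> around \<open>v\<close>.
  Once \<open>Z \<subseteq> J\<close>, submodularity and maximality pull \<open>Z\<close> into
  \<open>I\<close>.\<close>

lemma tight_subset_max_dangerous:
  assumes Z: "tight u Z" and Y: "max_dangerous I J" and u: "u \<in># N" "u \<in> I"
    and v: "v \<in># N" "v \<noteq> u" "v \<in> I" and out: "\<And>A. tight u A \<Longrightarrow> v \<notin> A"
  shows "Z \<subseteq> I"
proof -
  note z = tightD[OF Z] and y = dangerousD[OF max_dangerousD(1)[OF Y]]
  have vZ: "v \<notin> Z" using out Z by blast
  have D: "F (I - insert u Z) (J - Z) + F (Z - J) (insert u Z - I) + n (I \<inter> {u}) \<le> 4 * k + 1"
    using F_Diff[OF y(1) z(8) y(2) z(6)] y(5) z(7) insert_Diff_if[of u Z Z] z(3) by simp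
  have "0 < n (I \<inter> {u})" using u weight_pos_iff by blast
  then have le: "F (I - insert u Z) (J - Z) + F (Z - J) (insert u Z - I) \<le> 4 * k" using D by linarith
  have "Z \<subseteq> J"
  proof (rule ccontr)
    assume h: "\<not> Z \<subseteq> J"
    have "2 * k \<le> F (Z - J) (insert u Z - I)"
      by (rule F_ge) (use z y h in auto)
    then have "tight u (I - insert u Z)"
      by (intro tightI(1)[of "I - insert u Z" "J - Z" u v]) (use le z y u v vZ in auto)
    then show False using out v vZ by blast
  qed
  then have e: "J \<inter> insert u Z = insert u Z" "J \<union> insert u Z = J" using u y by auto
  have P: "F (I \<inter> Z) (insert u Z) + F (I \<union> Z) (J \<union> insert u Z) \<le> 4 * k + 1"
    using F_Int_Un[of I J Z "insert u Z"] z y unfolding e by auto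
  have "2 * k \<le> F (I \<inter> Z) (insert u Z)"
  proof (cases "I \<inter> Z = {}")
    case True
    obtain a where "a \<in> Z" using z by blast
    then have "2 \<le> card (insert u Z - I \<inter> Z)"
      by (intro wall2[of _ u a]) (use z True in auto)
    then show ?thesis using F_ge_wall by fastforce
  next
    case False
    then show ?thesis by (intro F_ge) (use z in auto)
  qed
  then show ?thesis using max_dangerous_Un(1)[OF Y, of Z "insert u Z"] P z e y by fastforce
qed

text \<open>Otherwise the difference of \<open>W\<close> by \<open>Z\<close> has both
  \<open>u\<close> and \<open>v\<close> in its wall, and the edges at \<open>u\<close> make the
  difference inequality too tight.\<close>

lemma tight_subset_tset:
  assumes W: "tight v W" and Z: "tight u Z" and u: "u \<in># N" "u \<in> W" and v: "v \<notin> Z"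
  shows "Z \<subseteq> W"
proof (rule ccontr)
  assume h: "\<not> Z \<subseteq> W"
  note z = tightD[OF Z] and w = tightD[OF W]
  have D: "F (W - insert u Z) (insert v W - Z) + F (Z - insert v W) (insert u Z - W) + n (W \<inter> {u}) \<le> 4 * k"
    using F_Diff[OF w(8) z(8) w(6) z(6)] w(7) z(7) insert_Diff_if[of u Z Z] z(3) by simp
  have "0 < n (W \<inter> {u})" using u weight_pos_iff by blast
  moreover have "2 \<le> card ((insert v W - Z) - (W - insert u Z))"
    by (rule wall2[of _ u v]) (use z w u v in auto)
  then have "2 * k \<le> F (W - insert u Z) (insert v W - Z)" using F_ge_wall by fastforce
  moreover have "2 * k \<le> F (Z - insert v W) (insert u Z - W)"
    by (rule F_ge) (use z w u v h in auto)
  ultimately show False using D by linarith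
qed

text \<open>The variant for a pair of edges that both go to \<open>t\<close>. With no second end
  available, the case \<open>I = J = {t}\<close> has to be excluded separately: tightness forces at
  least \<open>k\<close> edges of \<open>E\<close> from \<open>t\<close> into each of the disjoint
  sets \<open>B\<close> and \<open>C\<close>, which together with two edges to \<open>s\<close> is
  too much for a dangerous biset.\<close>

lemma tight_subset_max_dangerous_loop:
  assumes t: "2 \<le> count N t" and B: "tight t B" "tight t C" "B \<inter> C = {}"
    and Y: "max_dangerous I J" "t \<in> I" and Z: "tight t Z"
  shows "Z \<subseteq> I"
proof (rule ccontr)
  assume nZ: "\<not> Z \<subseteq> I"
  note z = tightD[OF Z] and y = dangerousD[OF max_dangerousD(1)[OF Y(1)]]
  have D: "F (I - insert t Z) (J - Z) + F (Z - J) (insert t Z - I) + n (I \<inter> {t}) \<le> 4 * k + 1"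
    using F_Diff[OF y(1) z(8) y(2) z(6)] y(5) z(7) insert_Diff_if[of t Z Z] z(3) by simp
  have "I \<inter> {t} = {t}" using Y by auto
  then have D': "F (I - insert t Z) (J - Z) + F (Z - J) (insert t Z - I) < 4 * k" using t D by simp
  have P: "F (I \<inter> Z) (J \<inter> insert t Z) + F (I \<union> Z) (J \<union> insert t Z) \<le> 4 * k + 1"
    using F_Int_Un[of I J Z "insert t Z"] z y by auto
  have noP: "J \<union> insert t Z = V \<or> \<not> 2 * k \<le> F (I \<inter> Z) (J \<inter> insert t Z)"
    using max_dangerous_Un(1)[OF Y(1), of Z "insert t Z"] P z nZ by fastforce
  have nZJ: "\<not> Z \<subseteq> J"
  proof
    assume ZJ: "Z \<subseteq> J"
    then have e: "J \<inter> insert t Z = insert t Z" "J \<union> insert t Z = J" using Y y by auto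
    have "2 * k \<le> F (I \<inter> Z) (insert t Z)"
    proof (cases "I \<inter> Z = {}")
      case True
      obtain a where "a \<in> Z" using z by blast
      then have "2 \<le> card (insert t Z - I \<inter> Z)"
        by (intro wall2[of _ t a]) (use z True in auto)
      then show ?thesis using F_ge_wall by fastforce
    next
      case False
      then show ?thesis by (intro F_ge) (use z in auto)
    qed
    then show False using noP e y by simp
  qed
  then have "2 * k \<le> F (Z - J) (insert t Z - I)" by (intro F_ge) (use z y in auto)
  then have lt: "F (I - insert t Z) (J - Z) < 2 * k" using D' by linarith
  have IZ: "I \<subseteq> insert t Z"
  proof (rule ccontr)
    assume "\<not> I \<subseteq> insert t Z"
    then have "2 * k \<le> F (I - insert t Z) (J - Z)" by (intro F_ge) (use z(2,4) y(1,2) in auto)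
    then show False using lt by linarith
  qed
  have JZ: "J \<subseteq> insert t Z"
  proof
    fix a assume a: "a \<in> J"
    show "a \<in> insert t Z"
    proof (rule ccontr)
      assume "a \<notin> insert t Z"
      then have "2 \<le> card ((J - Z) - (I - insert t Z))"
        by (intro wall2[of _ t a]) (use a z y Y IZ in auto)
      then show False using lt F_ge_wall[of "J - Z" "I - insert t Z"] by linarith
    qed
  qed
  have lt2: "\<not> 2 * k \<le> F (I \<inter> Z) (J \<inter> insert t Z)" using noP JZ z by auto
  have I1: "I \<inter> Z = {}"
  proof (rule ccontr)
    assume "I \<inter> Z \<noteq> {}"
    then have "2 * k \<le> F (I \<inter> Z) (J \<inter> insert t Z)" by (intro F_ge) (use z(5,6) y(1,2,3) in auto)
    then show False using lt2 by linarith
  qed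
  then have I: "I = {t}" using IZ Y by auto
  have J: "J = {t}"
  proof (rule ccontr)
    assume "J \<noteq> {t}"
    then obtain a where "a \<in> J" "a \<noteq> t" using I y by blast
    then have "2 \<le> card (J \<inter> insert t Z - I \<inter> Z)"
      by (intro wall2[of _ t a]) (use I1 JZ z(2,3) y(1,2) Y(2) in auto)
    then show False using lt2 F_ge_wall[of "J \<inter> insert t Z" "I \<inter> Z"] by linarith
  qed
  note b = tightD[OF B(1)] and c = tightD[OF B(2)]
  have "2 * k \<le> F B B" "2 * k \<le> F C C"
    by (rule F_ge; use b c in blast)+
  moreover have "insert t B - B = {t}" "insert t C - C = {t}" using b c by auto
  ultimately have "cut E B (insert t B) + cut E C (insert t C) + 2 * k \<le> cut E B B + cut E C C"
    using b(7) c(7) unfolding F_def by simp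
  then have "2 * k \<le> cut E {t} {t}" using cut_disjoint_vertex[OF B(3) b(3) c(3), of E] by linarith
  then show False using y(5) t unfolding I J F_def by simp
qed

text \<open>A largest tight biset around \<open>b\<close> holds at most as many neighbours as lie
  outside it and its wall. A tight biset around an outer neighbour can therefore be reduced by it
  using \<open>tight_Diff\<close>.\<close>

lemma tight_disjoint:
  assumes all: "\<And>v. v \<in># N \<Longrightarrow> v \<noteq> t \<Longrightarrow> \<exists>A. tight t A \<and> v \<in> A" and b: "b \<in># N" "b \<noteq> t"
  obtains B C where "tight t B" "b \<in> B" "tight t C" "B \<inter> C = {}"
proof -
  let ?P = "\<lambda>A. tight t A \<and> b \<in> A"
  have bd: "\<forall>y. ?P y \<longrightarrow> card y < Suc (card V)" using tightD(2) fin card_mono le_imp_less_Suc by metis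
  obtain B0 where "?P B0" using all b by blast
  then obtain B where B: "?P B" "\<forall>y. ?P y \<longrightarrow> card y \<le> card B"
    using ex_has_greatest_nat[of ?P B0 card "Suc (card V)"] bd by blast
  have "0 < n B" using B b weight_pos_iff by blast
  then have "0 < n (V - insert t B)" using tight_half[of t B] B by linarith
  then obtain c where c: "c \<in># N" "c \<notin> insert t B" using weight_pos_iff[of N "V - insert t B"] by blast
  then obtain C where C: "tight t C" "c \<in> C" using all by blast
  have "B - C \<noteq> {}"
  proof
    assume "B - C = {}"
    then have "B \<subset> C" using C c by blast
    then have "card B < card C" using psubset_card_mono sub_finite tightD(2)[OF C(1)] by blast
    then show False using B C \<open>B \<subset> C\<close> by (meson leD psubsetD)
  qed
  then have "tight t (C - B)" using tight_Diff(2)[of t B C] B C c by blast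
  then show thesis using that B by blast
qed

text \<open>The inner sets of tight bisets around \<open>u\<close> form a chain by
  \<open>tight_comparable\<close> and \<open>tight_nested\<close>, so a largest one dominates all
  others.\<close>

lemma tight_maximal:
  assumes u: "u \<in># N" and ex: "tight x0 W0" "u \<in> W0"
  obtains x W where "tight x W" "u \<in> W" "\<And>y B. tight y B \<Longrightarrow> u \<in> B \<Longrightarrow> B \<subseteq> W \<and> (y = x \<or> y \<in> W)"
proof -
  let ?P = "\<lambda>(x, A). tight x A \<and> u \<in> A"
  let ?f = "\<lambda>(x, A). card A"
  have bd: "\<forall>y. ?P y \<longrightarrow> ?f y < Suc (card V)"
    using tightD(2) card_mono[OF fin] by (auto simp: less_Suc_eq_le)
  have "?P (x0, W0)" using ex by simp
  then obtain Z where Z: "?P Z" "\<forall>y. ?P y \<longrightarrow> ?f y \<le> ?f Z"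
    using ex_has_greatest_nat[of ?P "(x0, W0)" ?f "Suc (card V)"] bd by blast
  obtain x W where "Z = (x, W)" by fastforce
  then have W: "tight x W" "u \<in> W" and max: "\<And>y B. tight y B \<Longrightarrow> u \<in> B \<Longrightarrow> card B \<le> card W"
    using Z by auto
  have "B \<subseteq> W \<and> (y = x \<or> y \<in> W)" if B: "tight y B" "u \<in> B" for y B
  proof -
    have ns: "\<not> W \<subset> B"
      using max[OF B] psubset_card_mono[OF sub_finite[OF tightD(2)[OF B(1)]]] by (meson leD)
    show ?thesis
    proof (cases "y = x")
      case True
      then show ?thesis using tight_comparable[of x W B u] W B u ns by blast
    next
      case False
      then show ?thesis using tight_nested[OF W(1) B(1) _ u W(2) B(2)] ns tightD(3)[OF W(1)] by blast
    qed
  qed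
  then show thesis using that W by blast
qed

text \<open>
  The maximal dangerous bisets blocking \<open>u\<close> cover all neighbours outside one tight biset and its wall
  \<open>x\<close>. By \<open>cover_two\<close> two of them suffice, and as neither contains more than half of the neighbours,
  their two differences must be tight with wall \<open>{x}\<close>.
\<close>

lemma stuck_imp_obstacle:
  assumes u: "u \<in># N" and umax: "\<And>x. count N x \<le> count N u" and stuck: "\<And>v. \<not> split_ok u v"
  shows "\<exists>t. obstacle t"
proof (rule ccontr)
  assume noobs: "\<nexists>t. obstacle t"
  \<comment> \<open>The neighbours whose pairing with \<open>u\<close> is not already blocked by a
    tight biset with wall \<open>u\<close>; only for these does blocking carry new
    information.\<close>
  define R where "R = {v. v \<in># N \<and> v \<noteq> u \<and> (\<forall>A. tight u A \<longrightarrow> v \<notin> A)}"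
  have cu: "0 < count N u" using u by simp
  have R_D: "v \<in># N" "v \<noteq> u" "\<And>A. tight u A \<Longrightarrow> v \<notin> A" if "v \<in> R" for v
    using that unfolding R_def by auto
  have not_R: "v = u \<or> (\<exists>A. tight u A \<and> v \<in> A)" if "v \<in># N" "v \<notin> R" for v
    using that unfolding R_def by auto
  have blockR: "(\<exists>I J. max_dangerous I J \<and> u \<in> I \<and> v \<in> I) \<or> (\<exists>A. tight v A \<and> u \<in> A)" if "v \<in> R" for v
    using split_blocked[OF pair_subset[of u v]] stuck R_D[OF that] u by metis
  show False
  proof (cases "R = {}")
    case True
    then have all: "\<And>v. v \<in># N \<Longrightarrow> v \<noteq> u \<Longrightarrow> \<exists>A. tight u A \<and> v \<in> A" using not_R by blast
    \<comment> \<open>Every other neighbour is blocked through the wall \<open>u\<close>, so only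
      parity keeps \<open>u\<close> from being an obstacle. An even count supplies two edges to
      \<open>u\<close>, and the blocked pair to examine is the loop.\<close>
    then have "even (count N u)" using noobs unfolding obstacle_def by blast
    then have c2: "2 \<le> count N u" using cu by presburger
    obtain I J where Y: "max_dangerous I J" "u \<in> I"
      using split_blocked[OF pair_subset_same[OF c2]] stuck tightD(3) by metis
    obtain v where v: "v \<in># N" "v \<notin> I" using dangerous_not_cover max_dangerousD(1)[OF Y(1)] by blast
    then have vu: "v \<noteq> u" using Y by blast
    obtain B C where BC: "tight u B" "v \<in> B" "tight u C" "B \<inter> C = {}"
      using tight_disjoint[OF all v(1) vu] by blast
    then show False using tight_subset_max_dangerous_loop[OF c2 BC(1,3,4) Y BC(1)] v by blast
  next
    case False
    have Zsub: "Z \<subseteq> I" if "max_dangerous I J" "u \<in> I" "I \<inter> R \<noteq> {}" "tight u Z" for I J Z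
      using that tight_subset_max_dangerous[OF that(4,1) u that(2)] R_D by blast
    show False
    proof (cases "\<exists>x W. tight x W \<and> u \<in> W")
      case no: False
      obtain I J I' J' where XY: "max_dangerous I J" "max_dangerous I' J'" "u \<in> I" "u \<in> I'" "I \<inter> R \<noteq> {}" "I' \<inter> R \<noteq> {}"
        "R \<subseteq> I \<union> I'"
        using cover_two[of u R] u R_D(1) False blockR no by (metis subsetI)
      have "v \<in> I \<or> v \<in> I'" if "v \<in># N" for v
        using not_R[OF that] XY Zsub[OF XY(1,3,5)] by blast
      then show False
        using dangerous_not_cover2[OF max_dangerousD(1)[OF XY(1)] max_dangerousD(1)[OF XY(2)] u XY(3,4)] by blast
    next
      case True
      then obtain x W where W: "tight x W" "u \<in> W"
        and Wmax: "\<And>y B. tight y B \<Longrightarrow> u \<in> B \<Longrightarrow> B \<subseteq> W \<and> (y = x \<or> y \<in> W)"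
        using tight_maximal[OF u] by metis
      note w = tightD[OF W(1)]
      have nW: "count N u \<le> n W" using n_ge_count[OF W(2)] .
      \<comment> \<open>In the exceptional outcome \<open>x\<close> would carry at least half of the
        edges at \<open>s\<close>. But \<open>W\<close> and the part outside it each carry at least
        \<open>count N u\<close>, which is at least \<open>count N x\<close> by the choice of
        \<open>u\<close>.\<close>
      have WY: "W \<subseteq> I \<and> x \<in> J" if Y: "max_dangerous I J" "u \<in> I" for I J
      proof (rule ccontr)
        assume "\<not> ?thesis"
        then have I: "I = V - {x}" using tight_max_dangerous[OF W(1) Y(1) u W(2) Y(2)] by blast
        have "n (V - {x}) + count N x = size N" using weight_Diff[of "{x}" V N] w n_V by simp
        moreover have "2 * n (V - {x}) \<le> size N" using dangerousD(9)[OF max_dangerousD(1)[OF Y(1)]] I by simp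
        ultimately show False
          using tight_half[OF W(1)] nW umax[of x] cu by linarith
      qed
      \<comment> \<open>Every maximal dangerous biset around \<open>u\<close> already contains
        \<open>W\<close>, so \<open>W\<close> and its wall need no covering. Outside them no vertex
        is the wall of a tight biset around \<open>u\<close>, as \<open>cover_two\<close>
        requires.\<close>
      define M where "M = R - insert x W"
      have "\<exists>I J I' J'. max_dangerous I J \<and> max_dangerous I' J' \<and> u \<in> I \<and> u \<in> I' \<and> (\<forall>v\<in>#N. v \<in> I \<or> v \<in> I' \<or> v = x)"
      proof (cases "M = {}")
        case M: True
        obtain v where v: "v \<in> R" using False by blast
        from blockR[OF v] show ?thesis
        proof
          assume "\<exists>I J. max_dangerous I J \<and> u \<in> I \<and> v \<in> I"
          then obtain I J where Y: "max_dangerous I J" "u \<in> I" "v \<in> I" by blast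
          have "\<forall>v\<in>#N. v \<in> I \<or> v = x"
          proof
            fix a assume a: "a \<in># N"
            show "a \<in> I \<or> a = x"
              using not_R[OF a] M WY[OF Y(1,2)] Y v Zsub[OF Y(1,2)] unfolding M_def by blast
          qed
          then show ?thesis using Y by blast
        next
          assume "\<exists>A. tight v A \<and> u \<in> A"
          then obtain A where A: "tight v A" "u \<in> A" by blast
          have "Z \<subseteq> W" if "tight u Z" for Z
            using tight_subset_tset[OF A(1) that u A(2)] R_D(3)[OF v that] Wmax[OF A] by blast
          then have "a \<in> insert x W" if "a \<in># N" for a
            using not_R[OF that] M W(2) unfolding M_def by blast
          then have "n (V - insert x W) \<le> 0" using weight_mono[of N "V - insert x W" "{}"] by simp
          then show ?thesis using tight_half[OF W(1)] nW cu by linarith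
        qed
      next
        case M: False
        have 1: "\<exists>I J. max_dangerous I J \<and> u \<in> I \<and> v \<in> I" if "v \<in> M" for v
          using blockR[of v] that Wmax[of v] unfolding M_def by blast
        have 2: "u \<notin> A" if "v \<in> M" "tight v A" for v A
          using that Wmax[of v] unfolding M_def by blast
        have 3: "M \<subseteq> set_mset N" using R_D(1) unfolding M_def by blast
        obtain I J I' J' where XY: "max_dangerous I J" "max_dangerous I' J'" "u \<in> I" "u \<in> I'" "I \<inter> M \<noteq> {}" "I' \<inter> M \<noteq> {}"
          "M \<subseteq> I \<union> I'"
          by (rule cover_two[OF u 3 M]) (use 1 2 in blast)+
        have IR: "I \<inter> R \<noteq> {}" using XY unfolding M_def by blast
        have "v \<in> I \<or> v \<in> I' \<or> v = x" if v: "v \<in># N" for v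
          using not_R[OF v] XY Zsub[OF XY(1,3) IR] WY[OF XY(1,3)] unfolding M_def by blast
        then show ?thesis using XY by blast
      qed
      then obtain I J I' J' where XY: "max_dangerous I J" "max_dangerous I' J'" "u \<in> I" "u \<in> I'"
        and covered: "\<And>v. v \<in># N \<Longrightarrow> v \<in> I \<or> v \<in> I' \<or> v = x" by blast
      note X = max_dangerousD(1)[OF XY(1)] and Y = max_dangerousD(1)[OF XY(2)]
      note dx = dangerousD[OF X] and dy = dangerousD[OF Y]
      have xI: "x \<notin> I" "x \<notin> I'" using dangerous_not_cover2[OF X Y u XY(3,4)] covered by blast+
      have xJ: "x \<in> J - I" "x \<in> J' - I'" using WY[OF XY(1,3)] WY[OF XY(2,4)] xI by auto
      have J: "J = insert x I" "J' = insert x I'" using dangerous_wall[OF X xJ(1)] dangerous_wall[OF Y xJ(2)] .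
      have hx: "2 * n I + count N x \<le> size N + 1" "2 * n I' + count N x \<le> size N + 1"
        using dangerous_half_wall[OF X xJ(1)] dangerous_half_wall[OF Y xJ(2)] .
      have "n (insert x (I \<union> I')) = size N" by (rule weight_size) (use covered in blast)
      then have sz: "size N = count N x + n (I \<union> I')" using weight_insert[of x "I \<union> I'" N] xI by simp
      have UI: "n (I \<union> I') + n (I \<inter> I') = n I + n I'" by (rule weight_Un_Int)
      have pos: "0 < n (I \<inter> I')" using u XY weight_pos_iff by blast
      \<comment> \<open>Both inner sets together with \<open>x\<close> contain all neighbours, so
        adding the two half bounds leaves an overlap of at most one edge. An even count at
        \<open>x\<close> would sharpen both bounds and leave none.\<close>
      have n1: "n (I \<inter> I') = 1" using hx sz UI pos by linarith
      have odd: "odd (count N x)"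
      proof
        assume "even (count N x)"
        then have "2 * n I + count N x \<le> size N" "2 * n I' + count N x \<le> size N"
          using hx even_N by presburger+
        then show False using sz UI pos by linarith
      qed
      have D: "F (I - I') (insert x (I - I')) + F (I' - I) (insert x (I' - I)) \<le> 4 * k"
      proof -
        have e: "I - J' = I - I'" "J - I' = insert x (I - I')" "I' - J = I' - I" "J' - I = insert x (I' - I)"
          using J xI by auto
        show ?thesis using F_Diff[OF dx(1) dy(1) dx(2) dy(2)] dx(5) dy(5) n1 unfolding e by linarith
      qed
      have ne: "I - I' \<noteq> {}" "I' - I \<noteq> {}"
      proof -
        show "I - I' \<noteq> {}"
        proof
          assume "I - I' = {}"
          then have "I \<union> I' = I'" by blast
          then show False using sz hx dy(4) by simp
        qed
        show "I' - I \<noteq> {}"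
        proof
          assume "I' - I = {}"
          then have "I \<union> I' = I" by blast
          then show False using sz hx dx(4) by simp
        qed
      qed
      have "2 * k \<le> F (I - I') (insert x (I - I'))" "2 * k \<le> F (I' - I) (insert x (I' - I))"
        by (rule F_ge; use ne J dx(1-3) dy(1-3) in blast)+
      then have T: "tight x (I - I')" "tight x (I' - I)"
        unfolding tight_def using D ne J xI dx(1-3) dy(1-3) by auto
      have "\<exists>A. tight x A \<and> v \<in> A" if v: "v \<in># N" "v \<noteq> x" for v
      proof (cases "v \<in> I \<inter> I'")
        case True
        have "v = u"
        proof (rule ccontr)
          assume "v \<noteq> u"
          then have "count N v + count N u = n {v, u}" using weight_insert[of v "{u}" N] by simp
          also have "\<dots> \<le> n (I \<inter> I')" by (rule weight_mono) (use True XY in auto)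
          finally show False using n1 v(1) cu by (simp add: count_greater_zero_iff[symmetric] del: count_greater_zero_iff)
        qed
        then show ?thesis using W by blast
      next
        case False
        then show ?thesis using covered[OF v(1)] v T by blast
      qed
      then show False using noobs odd unfolding obstacle_def by blast
    qed
  qed
qed

end

section \<open>Complete splitting\<close>

context split_graph
begin

text \<open>Intended for the graph after splitting off \<open>u\<close> and \<open>v\<close>. The
  tight bisets excluded by the last condition are those that the splitting may have made tight;
  \<open>Y\<close> is a largest of them, and the remaining neighbours are covered by tight bisets
  disjoint from it, which were tight before.\<close>

lemma obstacle_structure:
  assumes obs: "obstacle t" and tu: "t \<noteq> u"
  obtains Y where "t \<notin> Y" "Y \<subseteq> V" "Y = {} \<or> (tight t Y \<and> u \<in> Y \<and> v \<in> insert t Y)"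
    "n Y < n (V - insert t Y)"
    "\<And>b. b \<in># N \<Longrightarrow> b \<noteq> t \<Longrightarrow> b \<notin> Y \<Longrightarrow>
       \<exists>B. tight t B \<and> b \<in> B \<and> B \<inter> Y = {} \<and> \<not> (u \<in> B \<and> v \<in> insert t B)"
proof -
  have odd: "odd (count N t)" and all: "\<And>v. v \<in># N \<Longrightarrow> v \<noteq> t \<Longrightarrow> \<exists>A. tight t A \<and> v \<in> A"
    using obs unfolding obstacle_def by blast+
  let ?P = "\<lambda>A. tight t A \<and> u \<in> A \<and> v \<in> insert t A"
  show thesis
  proof (cases "\<exists>A. ?P A")
    case False
    have tV: "t \<in> V" using odd N_V by (metis even_zero not_in_iff subsetD)
    have "n (V - {t}) + count N t = size N" using weight_Diff[of "{t}" V N] tV n_V by simp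
    then have "odd (n (V - {t}))" using odd even_N by (metis even_add)
    then have pos: "0 < n (V - {t})" by (metis even_zero gr0I)
    have "\<exists>B. tight t B \<and> b \<in> B \<and> B \<inter> {} = {} \<and> \<not> (u \<in> B \<and> v \<in> insert t B)"
      if "b \<in># N" "b \<noteq> t" for b
      using all[OF that] False by (metis Int_empty_right)
    from that[of "{}", OF _ _ _ _ this] show ?thesis using pos by simp
  next
    case True
    then obtain A0 where "?P A0" by blast
    moreover have "\<forall>y. ?P y \<longrightarrow> card y < Suc (card V)"
      using tightD(2) fin card_mono le_imp_less_Suc by metis
    ultimately obtain Y where Y: "?P Y" "\<forall>y. ?P y \<longrightarrow> card y \<le> card Y"
      using ex_has_greatest_nat[of ?P A0 card "Suc (card V)"] by blast
    have "\<exists>B. tight t B \<and> b \<in> B \<and> B \<inter> Y = {} \<and> \<not> (u \<in> B \<and> v \<in> insert t B)"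
      if b: "b \<in># N" "b \<noteq> t" "b \<notin> Y" for b
    proof -
      obtain B where B: "tight t B" "b \<in> B" using all b by blast
      have "Y - B \<noteq> {}"
      proof
        assume "Y - B = {}"
        then have "Y \<subset> B" "?P B" using B b Y by blast+
        then show False
          using Y(2) psubset_card_mono[OF sub_finite[OF tightD(2)[OF B(1)]]] by (meson leD)
      qed
      then have "tight t (B - Y)" using tight_Diff(2)[of t Y B] Y B b by blast
      then show ?thesis using B b Y by blast
    qed
    from that[of Y, OF _ _ _ _ this] show ?thesis using Y(1) tightD(2,3)[of t Y] tight_half_odd[OF _ odd, of Y] by simp
  qed
qed

section \<open>Near obstacles\<close>

definition covered :: "'a \<Rightarrow> 'a set" where
  "covered t = {v. v \<in># N \<and> v \<noteq> t \<and> (\<exists>A. tight t A \<and> v \<in> A)}"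

definition uncovered :: "'a \<Rightarrow> 'a set" where
  "uncovered t = {v. v \<in># N \<and> v \<noteq> t \<and> (\<forall>A. tight t A \<longrightarrow> v \<notin> A)}"

text \<open>
  This is what an obstacle at \<open>t\<close> created by splitting off two edges not ending at \<open>t\<close> looks like before
  the splitting.
\<close>

definition near_obstacle :: "'a \<Rightarrow> bool" where
  "near_obstacle t \<longleftrightarrow> odd (count N t) \<and> n (uncovered t) \<le> n (covered t) + 1"

lemma cov_or_unc: "v \<in># N \<Longrightarrow> v \<noteq> t \<Longrightarrow> v \<in> covered t \<or> v \<in> uncovered t"
  unfolding covered_def uncovered_def by blast

lemma obstacle_iff: "obstacle t \<longleftrightarrow> odd (count N t) \<and> uncovered t = {}"
  unfolding obstacle_def uncovered_def by blast

lemma n_insert_cov: "n (insert t (covered t)) = count N t + n (covered t)"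
  by (rule weight_insert) (simp add: covered_def)

text \<open>A biset blocking the pair would contain \<open>t\<close> and, by the inclusion lemmas
  for tight bisets with wall \<open>t\<close>, all of \<open>covered t\<close>. As these make up
  nearly half of the other neighbours, the biset would be too heavy for its balance.\<close>

lemma near_split_ok:
  assumes near_obstacle: "near_obstacle t" and w: "w \<in> uncovered t"
  shows "split_ok t w"
proof (rule ccontr)
  assume not: "\<not> split_ok t w"
  have odd: "odd (count N t)" and le: "n (uncovered t) \<le> n (covered t) + 1" using near_obstacle unfolding near_obstacle_def by auto
  have t: "t \<in># N" using odd by (metis even_zero not_in_iff)
  have ct: "0 < count N t" using t by simp
  have wN: "w \<in># N" "w \<noteq> t" "\<And>A. tight t A \<Longrightarrow> w \<notin> A" using w unfolding uncovered_def by auto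
  have cw: "0 < count N w" using wN by simp
  have uncovered: "n (uncovered t - {w}) + count N w = n (uncovered t)" using weight_Diff[of "{w}" "uncovered t" N] w by simp
  consider I J where "max_dangerous I J" "t \<in> I" "w \<in> I" | W where "tight w W" "t \<in> W" | A where "tight t A" "w \<in> A"
    using split_blocked[OF pair_subset[OF t wN(1) wN(2)[symmetric]] not] by blast
  then show False
  proof cases
    case 1
    have covI: "covered t \<subseteq> I"
      using tight_subset_max_dangerous[OF _ 1(1) t 1(2) wN(1,2) 1(3) wN(3)] unfolding covered_def by blast
    have "n (insert w (insert t (covered t))) \<le> n I" by (rule weight_mono) (use covI 1 in auto)
    moreover have "w \<notin> insert t (covered t)" using wN unfolding covered_def by auto
    then have "n (insert w (insert t (covered t))) = count N w + n (insert t (covered t))" by (rule weight_insert)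
    ultimately have a: "count N w + count N t + n (covered t) \<le> n I" using n_insert_cov[of t] by linarith
    have "n (V - J) \<le> n (uncovered t - {w})"
      by (rule weight_mono) (use covI 1 cov_or_unc[of _ t] dangerousD(1)[OF max_dangerousD(1)[OF 1(1)]] in blast)
    then show False using a dangerousD(8)[OF max_dangerousD(1)[OF 1(1)]] uncovered le ct cw by linarith
  next
    case 2
    have covW: "covered t \<subseteq> W"
      using tight_subset_tset[OF 2(1) _ t 2(2)] wN(3) unfolding covered_def by blast
    have "n (insert t (covered t)) \<le> n W" by (rule weight_mono) (use covW 2 in auto)
    moreover have "n (V - insert w W) \<le> n (uncovered t - {w})"
      by (rule weight_mono) (use covW 2 cov_or_unc[of _ t] in blast)
    ultimately show False using tight_half(1)[OF 2(1)] uncovered le ct cw n_insert_cov[of t] by linarith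
  next
    case 3
    then show False using wN by blast
  qed
qed

text \<open>The empty set is a default value for the case that no such biset exists, so that
  inclusions in \<open>Z\<close> can be used uniformly.\<close>

lemma tight_max_wall:
  assumes r: "r \<in># N"
  obtains Z where "(Z = {} \<and> (\<forall>A. tight p A \<longrightarrow> r \<notin> A)) \<or> (tight p Z \<and> r \<in> Z)"
    "\<And>A. tight p A \<Longrightarrow> r \<in> A \<Longrightarrow> A \<subseteq> Z"
proof (cases "\<exists>A. tight p A \<and> r \<in> A")
  case False
  then show ?thesis using that[of "{}"] by blast
next
  case True
  let ?P = "\<lambda>A. tight p A \<and> r \<in> A"
  obtain A0 where "?P A0" using True by blast
  moreover have "\<forall>y. ?P y \<longrightarrow> card y < Suc (card V)"
    using tightD(2) fin card_mono le_imp_less_Suc by metis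
  ultimately obtain Y where Y: "?P Y" "\<forall>y. ?P y \<longrightarrow> card y \<le> card Y"
    using ex_has_greatest_nat[of ?P A0 card "Suc (card V)"] by blast
  have "A \<subseteq> Y" if A: "?P A" for A
  proof -
    have "\<not> Y \<subset> A"
      using A Y(2) psubset_card_mono[OF sub_finite[OF tightD(2)], of p A Y] by (meson leD)
    then show ?thesis using tight_comparable[of p A Y r] r A Y(1) by blast
  qed
  then show ?thesis using that[of Y] Y by blast
qed

abbreviation obstacle_after :: "'a \<Rightarrow> 'a \<Rightarrow> 'a \<Rightarrow> bool" where
  "obstacle_after u v \<equiv> split_graph.obstacle k V (add_mset (Upair u v) E) (N - {#u, v#})"

end

section \<open>Comparing the graph before and after a splitting\<close>

locale split_step = split_graph +
  fixes u v
  assumes ok: "split_ok u v"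
begin

abbreviation "E' \<equiv> add_mset (Upair u v) E"
abbreviation "N' \<equiv> N - {#u, v#}"

lemma N_eq: "N = add_mset u (add_mset v N')"
proof -
  have "{#u, v#} + N' = N"
    by (rule subset_mset.add_diff_inverse) (use ok in \<open>simp add: split_ok_def\<close>)
  then show ?thesis by simp
qed

lemma uv_in: "u \<in># N" "v \<in># N" "u \<in> V" "v \<in> V"
proof -
  show "u \<in># N" "v \<in># N" by (subst N_eq, simp)+
  then show "u \<in> V" "v \<in> V" using N_V by auto
qed

sublocale S: split_graph k V E' N'
proof
  show "finite V" "2 \<le> k" using fin k_ge .
  show "\<forall>e\<in>#E'. set_uprod e \<subseteq> V" using E_V uv_in by auto
  show "set_mset N' \<subseteq> V" using N_V by (meson in_diffD subset_iff)
  have "size N = size N' + 2" by (subst N_eq) simp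
  then show "even (size N')" using even_N by simp
  show "mix_conn k V E' N'" using ok unfolding split_ok_def by blast
qed

lemma n_eq: "n A = S.n A + of_bool (u \<in> A) + of_bool (v \<in> A)"
  by (subst N_eq) simp

lemma in_N': "b \<in># N \<Longrightarrow> b \<noteq> u \<Longrightarrow> b \<noteq> v \<Longrightarrow> b \<in># N'"
  by (subst (asm) N_eq) simp

lemma N'_in: "b \<in># N' \<Longrightarrow> b \<in># N"
  by (meson in_diffD)

lemma n'_le: "S.n A \<le> n A"
  using n_eq by simp

lemma count_N: "count N b = count N' b + of_bool (u = b) + of_bool (v = b)"
  by (subst N_eq) simp

lemma F_eq: "F I J + of_bool (cross I J (Upair u v)) = S.F I J + of_bool (u \<in> I) + of_bool (v \<in> I)"
  unfolding F_def S.F_def using n_eq[of I] by simp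

text \<open>The splitting lowers \<open>F\<close> only if both ends lie in \<open>A\<close>, or one
  does and the other is the wall. As \<open>t\<close> is not \<open>u\<close>, the last assumption
  excludes all of this.\<close>

lemma tight_of_S:
  assumes "S.tight t A" "t \<noteq> u" "\<not> (u \<in> A \<and> v \<in> insert t A)"
  shows "tight t A"
proof -
  note D = S.tightD[OF assms(1)]
  have "F A (insert t A) = 2 * k"
    using F_eq[of A "insert t A"] D assms(2,3) by (auto simp: of_bool_def split: if_splits)
  then show ?thesis unfolding tight_def using D by auto
qed

text \<open>Neighbours remaining outside \<open>Y\<close> were covered before the splitting, and
  they outweigh those in \<open>Y\<close>. What is uncovered lies in \<open>Y\<close>, or consists
  of the two split edges if \<open>Y\<close> is empty; restoring these two edges costs 2 and the
  strict balance gains 1, which is the 1 in \<open>near_obstacle\<close>.\<close>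

lemma near_after:
  assumes obs: "S.obstacle t" and t: "t \<noteq> u" "t \<noteq> v"
  shows "near_obstacle t"
proof -
  obtain Y where Y: "t \<notin> Y" "Y \<subseteq> V" "Y = {} \<or> (S.tight t Y \<and> u \<in> Y \<and> v \<in> insert t Y)"
    "S.n Y < S.n (V - insert t Y)"
    "\<And>b. b \<in># N' \<Longrightarrow> b \<noteq> t \<Longrightarrow> b \<notin> Y \<Longrightarrow>
       \<exists>B. S.tight t B \<and> b \<in> B \<and> B \<inter> Y = {} \<and> \<not> (u \<in> B \<and> v \<in> insert t B)"
    using S.obstacle_structure[OF obs t(1), of v] by blast
  have c: "\<exists>B. tight t B \<and> b \<in> B" if "b \<in># N'" "b \<noteq> t" "b \<notin> Y" for b
    using Y(5)[OF that] tight_of_S[OF _ t(1)] by blast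
  have odd: "odd (count N t)" using obs count_N[of t] t unfolding S.obstacle_def by (metis add.right_neutral of_bool_eq(1))
  have "S.n (V - insert t Y) \<le> S.n (covered t)"
    by (rule weight_mono) (use c N'_in in \<open>auto simp: covered_def\<close>)
  then have n1: "S.n Y + 1 \<le> n (covered t)" using n'_le[of "covered t"] Y(4) by linarith
  have "n (uncovered t) \<le> S.n Y + 2"
  proof (cases "Y = {}")
    case True
    have "S.n (uncovered t) \<le> S.n {}"
      by (rule weight_mono) (use c True in \<open>auto simp: uncovered_def\<close>)
    then show ?thesis using n_eq[of "uncovered t"] by simp
  next
    case False
    have uv: "u \<in> Y" "v \<in> Y" using Y(3) t False by auto
    have "n (uncovered t) \<le> n Y"
    proof (rule weight_mono)
      fix b assume b: "b \<in># N" "b \<in> uncovered t"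
      show "b \<in> Y"
      proof (rule ccontr)
        assume h: "b \<notin> Y"
        then show False using c[OF in_N'[OF b(1)] _ h] uv b(2) unfolding uncovered_def by blast
      qed
    qed
    then show ?thesis using n_eq[of Y] uv by simp
  qed
  then show ?thesis unfolding near_obstacle_def using odd n1 by linarith
qed

end

context split_step
begin

lemma count_u: "u \<noteq> v \<Longrightarrow> count N u = Suc (count N' u)"
  by (subst N_eq) simp

lemma count_v: "u \<noteq> v \<Longrightarrow> count N v = Suc (count N' v)"
  by (subst N_eq) simp

lemma count_same: "u = v \<Longrightarrow> count N u = count N' u + 2"
  by (subst N_eq) simp

lemma count_other: "r \<noteq> u \<Longrightarrow> r \<noteq> v \<Longrightarrow> count N r = count N' r"
  by (subst N_eq) simp

lemma count_v_1: "u \<noteq> v \<Longrightarrow> v \<notin># N' \<Longrightarrow> count N v = 1"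
  using count_v by (metis One_nat_def not_in_iff)

text \<open>
  Here \<open>u\<close> is a near obstacle with as few uncovered neighbours as possible. An obstacle \<open>r\<close> after the
  splitting comes with tight bisets with wall \<open>{r}\<close>; they must be disjoint from, or nested with, those
  with wall \<open>{u}\<close>, and counting neighbours leaves no room for both families.
\<close>

lemma no_obstacle_after_near:
  assumes near_obstacle: "near_obstacle u" and min: "\<And>t. near_obstacle t \<Longrightarrow> n (uncovered u) \<le> n (uncovered t)"
    and noobs: "\<And>t. \<not> obstacle t" and vu: "v \<in> uncovered u"
  shows "\<not> S.obstacle r"
proof
  assume obs: "S.obstacle r"
  have odd_u: "odd (count N u)" and le: "n (uncovered u) \<le> n (covered u) + 1" using near_obstacle unfolding near_obstacle_def by auto
  have vN: "v \<noteq> u" "\<And>A. tight u A \<Longrightarrow> v \<notin> A" using vu unfolding uncovered_def by auto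
  have cu: "0 < count N u" and cv: "0 < count N v" using uv_in by auto
  \<comment> \<open>Exactly one edge to \<open>u\<close> is used, so an even number remains.\<close>
  have ru: "r \<noteq> u"
    using obs odd_u count_u[OF vN(1)[symmetric]] unfolding S.obstacle_def by (metis even_Suc)
  obtain Y where Y: "r \<notin> Y" "Y \<subseteq> V" "Y = {} \<or> (S.tight r Y \<and> u \<in> Y \<and> v \<in> insert r Y)"
    "S.n Y < S.n (V - insert r Y)"
    "\<And>b. b \<in># N' \<Longrightarrow> b \<noteq> r \<Longrightarrow> b \<notin> Y \<Longrightarrow>
       \<exists>B. S.tight r B \<and> b \<in> B \<and> B \<inter> Y = {} \<and> \<not> (u \<in> B \<and> v \<in> insert r B)"
    using S.obstacle_structure[OF obs ru, of v] by blast
  have c: "\<exists>B. tight r B \<and> b \<in> B \<and> B \<inter> Y = {} \<and> \<not> (u \<in> B \<and> v \<in> insert r B)"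
    if "b \<in># N'" "b \<noteq> r" "b \<notin> Y" for b
    using Y(5)[OF that] tight_of_S[OF _ ru] by blast
  have unc_v: "n (uncovered u - {v}) + count N v = n (uncovered u)" using weight_Diff[of "{v}" "uncovered u" N] vu by simp
  have covN: "b \<in># N'" "b \<in># N" "b \<noteq> u" "b \<noteq> v" "\<exists>A. tight u A \<and> b \<in> A" if "b \<in> covered u" for b
    using that vN in_N'[of b] unfolding covered_def by auto
  have oddr: "odd (count N' r)" using obs unfolding S.obstacle_def by blast
  then have rN: "r \<in># N" using N'_in by (metis even_zero not_in_iff)
  have cr: "0 < count N r" using rN by simp
  show False
  proof (cases "r = v")
    case True
    have "count N v = Suc (count N' v)" using count_v vN(1) by blast
    moreover have "count N' v \<noteq> 0" using oddr True by (metis even_zero)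
    ultimately have "0 < n (covered u)" using unc_v le by linarith
    then have covne: "covered u \<noteq> {}" by fastforce
    \<comment> \<open>Outside \<open>Y\<close>, a covered neighbour would lie in tight bisets with
      walls \<open>u\<close> and \<open>v\<close>. They would be nested, but neither contains the
      wall of the other.\<close>
    have covY: "covered u \<subseteq> Y"
    proof
      fix b assume b: "b \<in> covered u"
      show "b \<in> Y"
      proof (rule ccontr)
        assume "b \<notin> Y"
        then obtain B where B: "tight v B" "b \<in> B" "u \<notin> B"
          using c[of b] covN[OF b] True by auto
        obtain Z where Z: "tight u Z" "b \<in> Z" using covN[OF b] by blast
        then show False using tight_nested[OF Z(1) B(1) _ covN(2)[OF b] Z(2) B(2)] vN B by blast
      qed
    qed
    then have uY: "u \<in> Y" using Y(3) covne by blast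
    have "n (insert u (covered u)) \<le> n Y" by (rule weight_mono) (use covY uY in auto)
    moreover have "n Y = S.n Y + 1" using n_eq[of Y] uY Y(1) True by simp
    moreover have "n (V - insert v Y) \<le> n (uncovered u - {v})"
      by (rule weight_mono) (use covY uY cov_or_unc[of _ u] in blast)
    ultimately show False
      using n_insert_cov[of u] unc_v le cu cv n'_le[of "V - insert v Y"] Y(4)[unfolded True] by linarith
  next
    case rv: False
    have odd_r: "odd (count N r)" using oddr count_other[OF ru rv] by metis
    obtain Zh where Zh: "(Zh = {} \<and> (\<forall>A. tight u A \<longrightarrow> r \<notin> A)) \<or> (tight u Zh \<and> r \<in> Zh)"
      and Zmax: "\<And>A. tight u A \<Longrightarrow> r \<in> A \<Longrightarrow> A \<subseteq> Zh"
      using tight_max_wall[OF rN] by blast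
    \<comment> \<open>Nesting the tight bisets with walls \<open>u\<close> and \<open>r\<close>
      around \<open>b\<close> would put \<open>u\<close> into \<open>B\<close>, or \<open>r\<close>
      into a tight biset with wall \<open>u\<close>, which then lies in \<open>Zh\<close>.\<close>
    have key1: False if h: "b \<in> covered u" "b \<notin> Zh" "tight r B" "b \<in> B" "u \<notin> B" for b B
    proof -
      obtain Z where Z: "tight u Z" "b \<in> Z" using covN[OF h(1)] by blast
      then show False
        using tight_nested[OF Z(1) h(3) _ covN(2)[OF h(1)] Z(2) h(4)] ru h Zmax[OF Z(1)] by blast
    qed
    have key2: "B \<subseteq> Zh" if "Zh \<noteq> {}" "tight r B" "u \<notin> B" for B
      using tight_subset_tset[of u Zh r B] Zh that rN by blast
    have ne_r: "b \<noteq> r" if "b \<in> covered u" "b \<notin> Zh" for b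
      using that Zmax covN(5)[OF that(1)] by blast
    show False
    proof (cases "Y = {}")
      case False
      then have uvY: "u \<in> Y" "v \<in> Y" using Y(3) rv by auto
      have c': "\<exists>B. tight r B \<and> b \<in> B \<and> u \<notin> B" if "b \<in># N'" "b \<noteq> r" "b \<notin> Y" for b
        using c[OF that] uvY by blast
      have covY: "b \<in> Y" if "b \<in> covered u" "b \<notin> Zh" for b
        using key1[OF that] c'[OF covN(1)[OF that(1)] ne_r[OF that]] by blast
      have nY: "n Y = S.n Y + 2" using n_eq[of Y] uvY by simp
      have nVY: "S.n (V - insert r Y) \<le> n (V - insert r Y)" by (rule n'_le)
      show False
      proof (cases "Zh = {}")
        case True
        have r: "r \<in> uncovered u" using Zh True rN ru unfolding uncovered_def by blast
        have "n (insert v (insert u (covered u))) \<le> n Y" by (rule weight_mono) (use covY True uvY in auto)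
        moreover have "n (insert v (insert u (covered u))) = count N v + n (insert u (covered u))"
          by (rule weight_insert) (use vN(1) covN(4) in blast)
        moreover have "n (V - insert r Y) \<le> n (uncovered u - {v} - {r})"
          by (rule weight_mono) (use covY True uvY cov_or_unc[of _ u] in blast)
        moreover have "n (uncovered u - {v} - {r}) + count N r = n (uncovered u - {v})"
          using weight_Diff[of "{r}" "uncovered u - {v}" N] r rv by simp
        ultimately show False using n_insert_cov[of u] unc_v le cu cv cr nY nVY Y(4) by linarith
      next
        case False
        then have Z: "tight u Zh" "r \<in> Zh" using Zh by auto
        have uncY: "b \<in> Y" if "b \<in> uncovered u" for b
        proof (rule ccontr)
          assume h: "b \<notin> Y"
          have b: "b \<in># N" "b \<noteq> u" "b \<notin> Zh" using that Z unfolding uncovered_def by auto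
          then have "b \<in># N'" "b \<noteq> r" using in_N'[of b] h uvY Z by auto
          then show False using c'[of b] h key2[OF False] b by blast
        qed
        have "n (insert u (V - insert u Zh)) \<le> n Y"
          by (rule weight_mono) (use uncY covY cov_or_unc[of _ u] uvY in blast)
        moreover have "n (insert u (V - insert u Zh)) = count N u + n (V - insert u Zh)"
          by (rule weight_insert) simp
        moreover have "n (V - insert r Y) \<le> n (Zh - {r})"
          by (rule weight_mono) (use uncY covY cov_or_unc[of _ u] uvY in blast)
        moreover have "n (Zh - {r}) + count N r = n Zh" using weight_Diff[of "{r}" Zh N] Z by simp
        ultimately show False using tight_half_odd[OF Z(1) odd_u] nY nVY Y(4) cu cr by linarith
      qed
    next
      case Y0: True
      have c': "\<exists>B. tight r B \<and> b \<in> B" if "b \<in># N'" "b \<noteq> r" for b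
        using c[OF that] Y0 by blast
      have uncr: "b = u \<or> b = v" if "b \<in> uncovered r" for b
        using that c'[of b] in_N'[of b] unfolding uncovered_def by blast
      show False
      proof (cases "\<exists>B. tight r B \<and> u \<in> B")
        case False
        have covZ: "covered u \<subseteq> Zh"
          using key1 c' covN(1) ne_r False by blast
        show False
        proof (cases "Zh = {}")
          case True
          have r: "r \<in> uncovered u" using Zh True rN ru unfolding uncovered_def by blast
          then have "count N r \<le> n (uncovered u - {v})" by (intro n_ge_count) (use rv in auto)
          moreover have "n (covered u) = 0" using covZ True weight_empty[of N] by (metis subset_empty)
          ultimately show False using unc_v le cv cr by linarith
        next
          case ZF: False
          then have Z: "tight u Zh" "r \<in> Zh" using Zh by auto
          have bv: "b = v" if "b \<in> uncovered u" for b
          proof (rule ccontr)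
            assume h: "b \<noteq> v"
            have b: "b \<in># N" "b \<noteq> u" "b \<notin> Zh" using that Z unfolding uncovered_def by auto
            then have "b \<in># N'" "b \<noteq> r" using in_N'[of b] h Z by auto
            then show False using c'[of b] key2[OF ZF] b False by blast
          qed
          have "v \<notin># N'"
            using c'[of v] rv key2[OF ZF] False vN(2)[OF Z(1)] by blast
          then have "count N v = 1" using count_v_1 vN(1) by blast
          moreover have "n (V - insert u Zh) \<le> n {v}"
            by (rule weight_mono) (use covZ bv cov_or_unc[of _ u] in blast)
          ultimately show False
            using tight_half_odd[OF Z(1) odd_u] n_ge_count[OF Z(2)] cr by simp
        qed
      next
        case True
        then have uncr_v: "b = v" if "b \<in> uncovered r" for b
          using uncr[OF that] that unfolding uncovered_def by blast
        have "uncovered r \<noteq> {}" using noobs[of r] odd_r unfolding obstacle_iff by blast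
        then have vr: "v \<in> uncovered r" using uncr_v by blast
        then have "v \<notin># N'" using c'[of v] rv unfolding uncovered_def by blast
        then have cv1: "count N v = 1" using count_v_1 vN(1) by blast
        have "uncovered r = {v}" using vr uncr_v by blast
        \<comment> \<open>The minimal choice of \<open>u\<close> enters here: \<open>r\<close> was a
          near obstacle with a single uncovered edge, so \<open>u\<close> has no more than
          that.\<close>
        then have "n (uncovered u) \<le> 1" using min[OF near_after[OF obs ru rv]] cv1 by simp
        then have n0: "n (uncovered u - {v}) = 0" using unc_v cv1 by linarith
        have uncu: "b = v" if "b \<in> uncovered u" for b
        proof (rule ccontr)
          assume h: "b \<noteq> v"
          have "b \<in># N" using that unfolding uncovered_def by blast
          then have "0 < n (uncovered u - {v})" using that h weight_pos_iff by blast
          then show False using n0 by simp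
        qed
        have "r \<in> covered u" using uncu cov_or_unc[OF rN ru] rv by blast
        then have Z: "tight u Zh" "r \<in> Zh" using Zh unfolding covered_def by blast+
        obtain Yh where Yh: "tight r Yh" "u \<in> Yh" and Ymax: "\<And>A. tight r A \<Longrightarrow> u \<in> A \<Longrightarrow> A \<subseteq> Yh"
          using tight_max_wall[OF uv_in(1), of r] True by metis
        have covY: "b \<in> Yh" if "b \<in> covered u" "b \<notin> Zh" for b
          using key1[OF that] c'[OF covN(1)[OF that(1)] ne_r[OF that]] Ymax by blast
        have rest: "b = v" if "b \<in># N" "b \<notin> Zh" "b \<notin> Yh" for b
          using cov_or_unc[of b u] that uncu covY Yh by blast
        note z = tightD[OF Z(1)] and y = tightD[OF Yh(1)]
        have "insert r Yh - Yh = {r}" using y by auto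
        then have "n (Zh \<inter> (insert r Yh - Yh)) = count N r" using Z by simp
        \<comment> \<open>The vertex \<open>r\<close> lies in \<open>Zh\<close> and is the wall of
          \<open>Yh\<close>, so its edges to \<open>s\<close> make the inequality strict and one of
          the two inner sets must be swallowed.\<close>
        then have D: "F (Zh - insert r Yh) (insert u Zh - Yh) + F (Yh - insert u Zh) (insert r Yh - Zh) < 4 * k"
          using F_Diff[OF z(8) y(8) z(6) y(6)] z(7) y(7) cr by linarith
        have "Zh \<subseteq> insert r Yh \<or> Yh \<subseteq> insert u Zh"
        proof (rule ccontr)
          assume "\<not> ?thesis"
          then have "2 * k \<le> F (Zh - insert r Yh) (insert u Zh - Yh)"
            "2 * k \<le> F (Yh - insert u Zh) (insert r Yh - Zh)"
            by (intro F_ge; use y(1-6) z(1-6) in blast)+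
          then show False using D by linarith
        qed
        then show False
        proof
          assume h: "Zh \<subseteq> insert r Yh"
          have "n (V - insert r Yh) \<le> n {v}" by (rule weight_mono) (use h rest in blast)
          then show False using tight_half_odd[OF Yh(1) odd_r] n_ge_count[OF Yh(2)] cu cv1 by simp
        next
          assume h: "Yh \<subseteq> insert u Zh"
          have "n (V - insert u Zh) \<le> n {v}" by (rule weight_mono) (use h rest in blast)
          then show False using tight_half_odd[OF Z(1) odd_u] n_ge_count[OF Z(2)] cr cv1 by simp
        qed
      qed
    qed
  qed
qed

text \<open>An odd count remains at \<open>v\<close>, so the original count is even and at least 2.
  A dangerous biset blocking the loop would contain all old tight bisets with wall \<open>v\<close>,
  hence every remaining neighbour outside \<open>Y\<close>. These outweigh \<open>Y\<close>, and the
  biset would violate its balance.\<close>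

lemma loop_split_ok:
  assumes uv: "u \<noteq> v" and obs: "S.obstacle v"
  shows "split_ok v v" "even (count N v)"
proof -
  have odd': "odd (count N' v)" using obs unfolding S.obstacle_def by blast
  have cnt: "count N v = Suc (count N' v)" using count_v uv by blast
  then show "even (count N v)" using odd' by (metis even_Suc)
  have "count N' v \<noteq> 0" using odd' by (metis even_zero)
  then have cv: "2 \<le> count N v" using cnt by linarith
  obtain Y where Y: "v \<notin> Y" "Y \<subseteq> V" "Y = {} \<or> (S.tight v Y \<and> u \<in> Y \<and> v \<in> insert v Y)"
    "S.n Y < S.n (V - insert v Y)"
    "\<And>b. b \<in># N' \<Longrightarrow> b \<noteq> v \<Longrightarrow> b \<notin> Y \<Longrightarrow>
       \<exists>B. S.tight v B \<and> b \<in> B \<and> B \<inter> Y = {} \<and> \<not> (u \<in> B \<and> v \<in> insert v B)"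
    using S.obstacle_structure[OF obs uv[symmetric], of v] by blast
  let ?P = "\<lambda>B. S.tight v B \<and> B \<inter> Y = {} \<and> u \<notin> B"
  have c: "\<exists>B. ?P B \<and> b \<in> B" if "b \<in># N'" "b \<noteq> v" "b \<notin> Y" for b
    using Y(5)[OF that] by blast
  have T: "tight v B" if "?P B" for B using tight_of_S[of v B] that uv by blast
  show "split_ok v v"
  proof (rule ccontr)
    assume not: "\<not> split_ok v v"
    obtain I J where M: "max_dangerous I J" "v \<in> I"
      using split_blocked[OF pair_subset_same[OF cv] not] tightD(3) by blast
    have "0 < S.n (V - insert v Y)" using Y(4) by linarith
    then obtain b where b: "b \<in># N'" "b \<noteq> v" "b \<notin> Y" using weight_pos_iff[of N' "V - insert v Y"] by blast
    obtain B0 where "?P B0 \<and> b \<in> B0" using c[OF b] by blast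
    moreover have "\<forall>y. ?P y \<and> b \<in> y \<longrightarrow> card y < Suc (card V)"
      using S.tightD(2) fin card_mono le_imp_less_Suc by metis
    ultimately obtain B where B: "?P B" "b \<in> B" and Bmax: "\<And>A. ?P A \<Longrightarrow> b \<in> A \<Longrightarrow> card A \<le> card B"
      using ex_has_greatest_nat[of "\<lambda>B. ?P B \<and> b \<in> B" B0 card "Suc (card V)"] by blast
    \<comment> \<open>Otherwise \<open>B\<close> would carry at least the weight outside
      \<open>Y\<close> and leave at most the weight of \<open>Y\<close>, against the balance of a
      tight biset.\<close>
    have "\<exists>c. c \<in># N' \<and> c \<noteq> v \<and> c \<notin> Y \<and> c \<notin> B"
    proof (rule ccontr)
      assume h: "\<not> ?thesis"
      have "S.n (V - insert v Y) \<le> S.n B" by (rule weight_mono) (use h in blast)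
      moreover have "S.n (V - insert v B) \<le> S.n Y" by (rule weight_mono) (use h in blast)
      moreover have "S.n B \<le> S.n (V - insert v B)" using S.tight_half(1) B by blast
      ultimately show False using Y(4) by linarith
    qed
    then obtain a where a: "a \<in># N'" "a \<noteq> v" "a \<notin> Y" "a \<notin> B" by blast
    obtain C where C: "?P C" "a \<in> C" using c[OF a(1-3)] by blast
    have "B - C \<noteq> {}"
    proof
      assume "B - C = {}"
      then have BC: "B \<subset> C" using C a by blast
      have "C \<subseteq> V" using C(1) S.tightD(2)[of v C] by blast
      then have "card B < card C" using psubset_card_mono[OF sub_finite BC] by blast
      moreover have "b \<in> C" using B(2) BC by blast
      ultimately show False using Bmax[OF C(1)] by (meson leD)
    qed
    then have CB: "tight v (C - B)" using tight_Diff(2)[OF T[OF B(1)] T[OF C(1)]] C a by blast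
    have sub: "Z \<subseteq> I" if "tight v Z" for Z
      using tight_subset_max_dangerous_loop[OF cv T[OF B(1)] CB _ M that] by blast
    have sub': "d \<in> I" if "d \<in># N'" "d \<notin> Y" for d
      using c[OF that(1) _ that(2)] T sub M(2) by blast
    note D = dangerousD[OF max_dangerousD(1)[OF M(1)]]
    have "S.n (insert v (V - insert v Y)) \<le> S.n I"
      by (rule weight_mono) (use sub' M in auto)
    moreover have "S.n (insert v (V - insert v Y)) = count N' v + S.n (V - insert v Y)"
      by (rule weight_insert) simp
    moreover have "S.n (V - J) \<le> S.n Y"
      by (rule weight_mono) (use sub' D(1) in blast)
    moreover have "n I = S.n I + of_bool (u \<in> I) + 1" "n (V - J) = S.n (V - J) + of_bool (u \<in> V - J)"
      using n_eq M(2) D(1) by auto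
    moreover have "u \<in> V - J \<Longrightarrow> u \<notin> I" using D by blast
    ultimately have "count N' v + S.n Y + 1 + 1 + of_bool (u \<in> I) \<le> S.n Y + of_bool (u \<in> V - J) + 1"
      using D(8) Y(4) by linarith
    moreover have "count N' v \<ge> 1" using cnt cv by linarith
    ultimately show False by (simp only: of_bool_def split: if_splits)
  qed
qed

end

context split_graph
begin

lemma split_stepI: "split_ok u v \<Longrightarrow> split_step k V E N u v"
  by unfold_locales

lemma near_imp_good_split:
  assumes near_obstacle: "near_obstacle t0" and noobs: "\<And>t. \<not> obstacle t"
  shows "\<exists>u v. split_ok u v \<and> (\<forall>t. \<not> obstacle_after u v t)"
proof -
  obtain t where t: "near_obstacle t" "\<And>r. near_obstacle r \<Longrightarrow> n (uncovered t) \<le> n (uncovered r)"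
    using ex_has_least_nat[of near_obstacle t0 "\<lambda>t. n (uncovered t)"] near_obstacle by blast
  have "uncovered t \<noteq> {}" using t(1) noobs[of t] unfolding near_obstacle_def obstacle_iff by blast
  then obtain w where w: "w \<in> uncovered t" by blast
  have ok: "split_ok t w" using near_split_ok[OF t(1) w] .
  then show ?thesis
    using split_step.no_obstacle_after_near[OF split_stepI[OF ok] t(1) _ noobs w] t(2) by blast
qed

text \<open>Without near obstacles, \<open>near_after\<close> confines a new obstacle to an end of
  the split pair. The count there was even before, and a loop at this end is admissible. Splitting
  off the loop keeps the count even, so no obstacle arises there, and an obstacle elsewhere would
  have been a near obstacle.\<close>

lemma good_split:
  assumes N: "N \<noteq> {#}" and noobs: "\<And>t. \<not> obstacle t"
  shows "\<exists>u v. split_ok u v \<and> (\<forall>t. \<not> obstacle_after u v t)"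
proof (rule ccontr)
  assume bad: "\<not> ?thesis"
  then have nonear: "\<not> near_obstacle t" for t using near_imp_good_split noobs by blast
  obtain u where u: "u \<in># N" "\<And>x. count N x \<le> count N u"
  proof -
    have "\<forall>y. count N y < Suc (size N)" using count_le_size[of N] by (simp add: less_Suc_eq_le)
    moreover obtain a where "a \<in># N" using N by blast
    ultimately obtain u where "\<And>x. count N x \<le> count N u"
      using ex_has_greatest_nat[of "\<lambda>_. True" a "count N" "Suc (size N)"] by blast
    then show thesis using that[of u] \<open>a \<in># N\<close>
      by (metis count_greater_zero_iff less_le_trans)
  qed
  obtain v where ok: "split_ok u v" using stuck_imp_obstacle[OF u] noobs by blast
  interpret S: split_step k V E N u v using split_stepI[OF ok] .
  obtain t where t: "S.S.obstacle t" using bad ok by blast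
  have tuv: "t = u \<or> t = v" using S.near_after[OF t] nonear by blast
  \<comment> \<open>A loop preserves the parity at \<open>u\<close> and the value of every biset
    with wall \<open>u\<close>, so an obstacle there would be an old one.\<close>
  have uv: "u \<noteq> v"
  proof
    assume uv: "u = v"
    have tu: "t = u" using tuv uv by blast
    have "odd (count N u)" using t S.count_same[OF uv] tu unfolding S.S.obstacle_def by (metis even_add even_numeral)
    moreover have "\<exists>A. tight u A \<and> b \<in> A" if b: "b \<in># N" "b \<noteq> u" for b
    proof -
      obtain A where A: "S.S.tight u A" "b \<in> A"
        using t S.in_N'[OF b(1)] b uv tu unfolding S.S.obstacle_def by blast
      note D = S.S.tightD[OF A(1)]
      have "F A (insert u A) = 2 * k" using S.F_eq[of A "insert u A"] D uv by simp
      then show ?thesis using A D unfolding tight_def by blast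
    qed
    ultimately show False using noobs[of u] unfolding obstacle_def by blast
  qed
  have "split_ok t t \<and> even (count N t)"
  proof (cases "t = v")
    case True
    then show ?thesis using S.loop_split_ok[OF uv] t by blast
  next
    case False
    then have tu: "t = u" using tuv by blast
    have e: "Upair v u = Upair u v" "{#v, u#} = {#u, v#}" by (auto simp: add_mset_commute)
    have ok': "split_ok v u" using ok unfolding split_ok_def e .
    interpret S': split_step k V E N v u using split_stepI[OF ok'] .
    have "S'.S.obstacle u" using t unfolding tu e .
    then show ?thesis using S'.loop_split_ok uv tu by blast
  qed
  then have ok2: "split_ok t t" and ev: "even (count N t)" by auto
  interpret S2: split_step k V E N t t using split_stepI[OF ok2] .
  obtain r where r: "S2.S.obstacle r" using bad ok2 by blast
  have "r \<noteq> t" using r S2.count_same[OF refl] ev unfolding S2.S.obstacle_def by (metis even_add even_numeral)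
  then show False using S2.near_after[OF r] nonear by blast
qed

end

lemma complete_splitting:
  assumes "split_graph k V E N" "\<And>t. \<not> split_graph.obstacle k V E N t"
  shows "\<exists>F. (\<Sum>e\<in>#F. ends e) = N \<and> mix_conn k V (E + F) {#}"
  using assms
proof (induction "size N" arbitrary: E N rule: less_induct)
  case less
  interpret split_graph k V E N by (rule less.prems)
  show ?case
  proof (cases "N = {#}")
    case True
    then show ?thesis using conn by (intro exI[of _ "{#}"]) simp
  next
    case False
    obtain u v where ok: "split_ok u v" and no: "\<And>t. \<not> obstacle_after u v t"
      using good_split[OF False] less.prems(2) by blast
    interpret S: split_step k V E N u v using split_stepI[OF ok] .
    have "size S.N' < size N" by (subst (2) S.N_eq) simp
    then obtain F where F: "(\<Sum>e\<in>#F. ends e) = S.N'" "mix_conn k V (S.E' + F) {#}"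
      using less.hyps[OF _ S.S.split_graph_axioms no] by blast
    have "(\<Sum>e\<in>#add_mset (Upair u v) F. ends e) = N"
      using F(1) by (subst S.N_eq) simp
    moreover have "mix_conn k V (E + add_mset (Upair u v) F) {#}" using F(2) by simp
    ultimately show ?thesis by blast
  qed
qed

section \<open>Minimal graphs\<close>

lemma cut_pos: "e \<in># E \<Longrightarrow> cross I J e \<Longrightarrow> 0 < cut E I J"
  unfolding cut_def by (auto simp: nonempty_has_size[symmetric])

lemma cut_Upair_out: "a \<notin> J \<Longrightarrow> I \<subseteq> J \<Longrightarrow> cut (image_mset (Upair a) N) I J = weight N I"
  by (induction N) auto

lemma cut_Upair_in: "a \<in> I \<Longrightarrow> I \<subseteq> J \<Longrightarrow> cut (image_mset (Upair a) N) I J = weight N (- J)"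
  by (induction N) auto

lemma cut_singleton_insert:
  "x \<noteq> a \<Longrightarrow> cut E {a} {a} = cut E {a} {a, x} + count E (Upair a x)"
proof (induction E)
  case (add e E)
  then show ?case by (cases e) (auto split: if_splits)
qed simp

text \<open>With no edges from \<open>p\<close> to the rest of \<open>A\<close>, moving
  \<open>p\<close> out of \<open>A\<close> separates the crossing edges into those at
  \<open>p\<close> and the others.\<close>

lemma cut_remove_vertex:
  assumes "A \<subseteq> B" "p \<in> A" "\<And>q. q \<in> A \<Longrightarrow> q \<noteq> p \<Longrightarrow> Upair p q \<notin># E"
  shows "cut E {p} (insert p (B - A)) + cut E (A - {p}) (B - {p}) \<le> cut E A B"
  using assms(3)
proof (induction E)
  case (add e E)
  obtain x y where e: "e = Upair x y" by (cases e)
  have "\<And>q. q \<in> A \<Longrightarrow> q \<noteq> p \<Longrightarrow> Upair p q \<notin># E" using add.prems by auto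
  then have IH: "cut E {p} (insert p (B - A)) + cut E (A - {p}) (B - {p}) \<le> cut E A B"
    using add.IH by blast
  have "\<not> (x = p \<and> y \<in> A \<and> y \<noteq> p)" "\<not> (y = p \<and> x \<in> A \<and> x \<noteq> p)"
    using add.prems[of y] add.prems[of x] e by (auto simp: Upair_inject)
  then have "cross {p} (insert p (B - A)) e \<Longrightarrow> cross A B e \<and> \<not> cross (A - {p}) (B - {p}) e"
    "cross (A - {p}) (B - {p}) e \<Longrightarrow> cross A B e"
    using assms(1,2) unfolding e cross_Upair by blast+
  then show ?case using IH by (auto simp: of_bool_def)
qed simp

lemma edges_at_vertex:
  assumes "Upair a a \<notin># E"
  shows "\<exists>N. filter_mset (\<lambda>e. a \<in> set_uprod e) E = image_mset (Upair a) N \<and> a \<notin># N"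
  using assms
proof (induction E)
  case (add e E)
  then obtain N where N: "filter_mset (\<lambda>e. a \<in> set_uprod e) E = image_mset (Upair a) N" "a \<notin># N"
    by auto
  show ?case
  proof (cases "a \<in> set_uprod e")
    case True
    then obtain y where y: "e = Upair a y"
      by (cases e) (auto simp: Upair_inject)
    then have "y \<noteq> a" using add.prems by auto
    then show ?thesis using N True y by (intro exI[of _ "add_mset y N"]) simp
  next
    case False
    then show ?thesis using N by (intro exI[of _ N]) simp
  qed
qed simp

locale min_graph =
  fixes k :: nat and V :: "'a set" and E :: "'a uprod multiset"
  assumes fin: "finite V" and even_k: "even k" and k_ge: "2 \<le> k"
    and E_V: "\<forall>e\<in>#E. set_uprod e \<subseteq> V" and conn: "mix_conn k V E {#}"
    and minimal: "\<And>e. e \<in># E \<Longrightarrow> \<not> mix_conn k V (E - {#e#}) {#}"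
    and card_V: "4 \<le> card V"
begin

sublocale G: split_graph k V E "{#}"
  using fin k_ge E_V conn by unfold_locales auto

lemma pair_ne_V: "{y, z} \<noteq> V" "{y} \<noteq> V"
proof -
  have "card {y, z} \<le> 2" "card {y} \<le> 2" by (cases "y = z"; simp)+
  then show "{y, z} \<noteq> V" "{y} \<noteq> V" using card_V by (metis le_trans numeral_le_iff semiring_norm(69,71))+
qed

lemma F_G: "G.F I J = cut E I J + k * card (J - I)"
  unfolding G.F_def by simp

lemma F_G_compl: "I \<subseteq> J \<Longrightarrow> J \<subseteq> V \<Longrightarrow> G.F (V - J) (V - I) = G.F I J"
  using G.F_compl[of I J] by simp

lemma F_G_ge: "I \<subseteq> J \<Longrightarrow> J \<subseteq> V \<Longrightarrow> I \<noteq> {} \<and> J \<noteq> V \<or> 2 \<le> card (J - I) \<Longrightarrow> 2 * k \<le> G.F I J"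
  using G.F_ge[of I J] G.F_ge_wall[of J I] by auto

lemma cross_wall:
  assumes "e \<in># E" "cross I J e" "G.F I J \<le> 2 * k"
  shows "card (J - I) \<le> 1"
proof (rule ccontr)
  assume "\<not> ?thesis"
  then have "k * 2 \<le> k * card (J - I)" by (intro mult_le_mono2) simp
  then show False using cut_pos[OF assms(1,2)] assms(3) unfolding F_G by linarith
qed

text \<open>Deleting \<open>e\<close> must violate the bound for some biset; since it held before,
  \<open>e\<close> crosses this biset and the value was exactly \<open>2 * k\<close>.\<close>

lemma edge_crosses:
  assumes e: "e \<in># E"
  obtains I J where "I \<subseteq> J" "J \<subseteq> V" "I \<noteq> {}" "J \<noteq> V" "G.F I J = 2 * k" "cross I J e" "card (J - I) \<le> 1"
proof -
  obtain I J where IJ: "I \<subseteq> J" "J \<subseteq> V" "I \<noteq> {}" "J \<noteq> V" "cut (E - {#e#}) I J + k * card (J - I) < 2 * k"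
    using minimal[OF e] unfolding mix_conn_def by (auto simp: not_le)
  have "cut E I J = of_bool (cross I J e) + cut (E - {#e#}) I J"
    using cut_add_mset[of e "E - {#e#}" I J] e by simp
  moreover have "2 * k \<le> G.F I J" using G.F_ge IJ by blast
  ultimately have "cross I J e" "G.F I J = 2 * k"
    using IJ(5) unfolding F_G by (auto simp: of_bool_def split: if_splits)
  then show thesis using that IJ cross_wall[OF e, of I J] by simp
qed

lemma no_loop: "Upair x x \<notin># E"
proof
  assume "Upair x x \<in># E"
  then obtain I J where "I \<subseteq> J" "cross I J (Upair x x)" using edge_crosses by metis
  then show False by auto
qed

text \<open>Only a wall \<open>{x}\<close> causes work. Exactly \<open>k\<close> edges at
  \<open>a\<close> avoid \<open>x\<close>, so by the degree bound at least \<open>k\<close> go to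
  \<open>x\<close>. A tight biset crossed by such an edge is uncrossed with the given one to produce
  \<open>{a}\<close> with empty wall.\<close>

lemma degree_2k_singleton:
  assumes X: "A \<subseteq> B" "B \<subseteq> V" "a \<in> A" "A = {a}" "G.F A B = 2 * k" "card (B - A) \<le> 1" "2 \<le> card (V - B)"
  shows "G.F {a} {a} = 2 * k"
proof (cases "B = {a}")
  case True
  then show ?thesis using X by simp
next
  case False
  then obtain x where x: "x \<in> B" "x \<noteq> a" using X by blast
  have B: "B = {a, x}"
    using G.wall2[of "B - A" x] X(1-6) x by fastforce
  have aV: "a \<in> V" "x \<in> V" using X x by auto
  have cab: "cut E {a} {a, x} = k"
  proof -
    have "{a, x} - {a} = {x}" using x by auto
    then show ?thesis using X(5) unfolding F_G B X(4) by simp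
  qed
  note V1 = pair_ne_V
  have ge: "2 * k \<le> G.F {a} {a}" by (rule G.F_ge) (use aV V1 in auto)
  have m: "cut E {a} {a} = k + count E (Upair a x)" using cut_singleton_insert[of x a E] x cab by simp
  have "k \<le> count E (Upair a x)" using ge m unfolding F_G by simp
  then have e: "Upair a x \<in># E" using k_ge by (metis not_in_iff le_zero_eq not_numeral_le_zero)
  have key: "G.F {a} {a} \<le> 2 * k"
    if Y: "I \<subseteq> J" "J \<subseteq> V" "J \<noteq> V" "G.F I J = 2 * k" "a \<in> I" "x \<notin> J" for I J
  proof -
    have e1: "{a} \<inter> I = {a}" "{a, x} \<inter> J = {a}" "{a} \<union> I = I" "{a, x} \<union> J = insert x J"
      using Y by auto
    have P: "G.F {a} {a} + G.F I (insert x J) \<le> 4 * k"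
      using G.F_Int_Un[of "{a}" "{a, x}" I J] Y aV X(5) unfolding e1 B X(4) by auto
    show ?thesis
    proof (cases "2 * k \<le> G.F I (insert x J)")
      case True
      then show ?thesis using P by linarith
    next
      case False
      then have J: "insert x J = V" "\<not> 2 \<le> card (insert x J - I)"
        using F_G_ge[of I "insert x J"] Y aV by blast+
      have "J \<subseteq> I"
      proof
        fix z assume z: "z \<in> J"
        show "z \<in> I"
        proof (rule ccontr)
          assume "z \<notin> I"
          then have "2 \<le> card (insert x J - I)"
            by (intro G.wall2[of _ x z]) (use z Y aV in auto)
          then show False using J by blast
        qed
      qed
      \<comment> \<open>In this exceptional case the complement shows that \<open>x\<close> has
        degree \<open>2 * k\<close>. At least \<open>k\<close> of its edges avoid \<open>a\<close>,
        so at most \<open>k\<close> edges join \<open>a\<close> and \<open>x\<close>.\<close>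
      then have IJ: "I = V - {x}" "J = V - {x}" using J Y by blast+
      have "V - (V - {x}) = {x}" using aV by blast
      then have Fx: "G.F {x} {x} = 2 * k" using F_G_compl[of I J] Y unfolding IJ by simp
      have "2 * k \<le> G.F {x} {x, a}" by (rule G.F_ge) (use aV V1 in auto)
      moreover have "{x, a} - {x} = {a}" using x by auto
      ultimately have "k \<le> cut E {x} {x, a}" unfolding F_G by simp
      moreover have "cut E {x} {x} = cut E {x} {x, a} + count E (Upair a x)"
      proof -
        have "Upair x a = Upair a x" by simp
        then show ?thesis using cut_singleton_insert[OF x(2)[symmetric], of E] by argo
      qed
      moreover have "cut E {x} {x} = 2 * k" using Fx unfolding F_G by simp
      ultimately have "count E (Upair a x) \<le> k" by linarith
      then show ?thesis using m unfolding F_G by simp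
    qed
  qed
  obtain I J where Y: "I \<subseteq> J" "J \<subseteq> V" "I \<noteq> {}" "J \<noteq> V" "G.F I J = 2 * k" "cross I J (Upair a x)" "card (J - I) \<le> 1"
    using edge_crosses[OF e] by blast
  from Y(6) consider "a \<in> I" "x \<notin> J" | "x \<in> I" "a \<notin> J" by auto
  then have "G.F {a} {a} \<le> 2 * k"
  proof cases
    case 1
    then show ?thesis using key[of I J] Y by blast
  next
    case 2
    have "G.F (V - J) (V - I) = 2 * k" using F_G_compl[OF Y(1,2)] Y(5) by simp
    then show ?thesis by (rule key[rotated 3]) (use 2 Y(1,2,3) aV in auto)
  qed
  then show ?thesis using ge by linarith
qed

text \<open>In a tight biset with smallest inner set \<open>A\<close>, an edge inside
  \<open>A\<close> crosses another tight biset. It also crosses the intersection and the difference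
  of the two, so by minimality neither is tight. Then both union and opposite difference are
  degenerate, and everything outside \<open>B\<close> lies in a wall with at most one vertex,
  against the last hypothesis. So \<open>A\<close> is a single vertex.\<close>

lemma degree_2k_inside:
  assumes X: "I \<subseteq> J" "J \<subseteq> V" "I \<noteq> {}" "G.F I J = 2 * k" "card (J - I) \<le> 1" "2 \<le> card (V - J)"
  obtains a where "a \<in> I" "G.F {a} {a} = 2 * k"
proof -
  define P where "P A \<longleftrightarrow> (\<exists>B. A \<subseteq> B \<and> B \<subseteq> J \<and> A \<subseteq> I \<and> A \<noteq> {} \<and> G.F A B = 2 * k \<and> card (B - A) \<le> 1)" for A
  have "P I" unfolding P_def using X by blast
  then obtain A where A: "P A" and Amin: "\<And>A'. P A' \<Longrightarrow> card A \<le> card A'"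
    using ex_has_least_nat[of P I card] by blast
  then obtain B where B: "A \<subseteq> B" "B \<subseteq> J" "A \<subseteq> I" "A \<noteq> {}" "G.F A B = 2 * k" "card (B - A) \<le> 1"
    unfolding P_def by blast
  have BV: "B \<subseteq> V" "A \<subseteq> V" using B X by auto
  have finA: "finite A" using G.sub_finite[OF BV(2)] .
  have cVB: "2 \<le> card (V - B)"
    using X(6) card_mono[of "V - B" "V - J"] fin B by (meson Diff_mono finite_Diff order_refl order_trans)
  have BneV: "B \<noteq> V" using cVB by auto
  have sm: False if s: "A' \<subseteq> B'" "B' \<subseteq> B" "A' \<subseteq> A" "A' \<noteq> A" "e \<in># E" "cross A' B' e" "G.F A' B' \<le> 2 * k" for A' B' e
  proof -
    have A': "A' \<noteq> {}" using s(1,6) by (auto simp: cross_def)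
    then have "2 * k \<le> G.F A' B'" by (intro G.F_ge) (use s BV BneV in auto)
    then have "G.F A' B' = 2 * k" using s(7) by linarith
    then have "P A'" unfolding P_def
      by (intro exI[of _ B']) (use cross_wall[OF s(5,6,7)] s(1,2,3) B(2,3) A' in auto)
    then have "card A \<le> card A'" by (rule Amin)
    moreover have "card A' < card A" using psubset_card_mono[OF finA] s(3,4) by blast
    ultimately show False by linarith
  qed
  obtain p where p: "p \<in> A" using B by blast
  show thesis
  proof (cases "A = {p}")
    case True
    then show thesis using that[of p] degree_2k_singleton[OF B(1) BV(1) p True B(5,6) cVB] p B by blast
  next
    case False
    have "\<exists>q. q \<in> A \<and> q \<noteq> p \<and> Upair p q \<in># E"
    proof (rule ccontr)
      assume "\<not> ?thesis"
      then have c: "cut E {p} (insert p (B - A)) + cut E (A - {p}) (B - {p}) \<le> cut E A B"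
        using cut_remove_vertex[OF B(1) p] by blast
      have w: "insert p (B - A) - {p} = B - A" "B - {p} - (A - {p}) = B - A" using p by auto
      have "2 * k \<le> G.F {p} (insert p (B - A))"
        by (rule G.F_ge) (use p BV B BneV in auto)
      moreover have "2 * k \<le> G.F (A - {p}) (B - {p})"
        by (rule G.F_ge) (use p BV B BneV False in auto)
      moreover have "k * card (B - A) \<le> k" using B(6) by simp
      \<comment> \<open>Without an edge at \<open>p\<close> inside \<open>A\<close> the two parts
        need \<open>4 * k\<close> in total, but the cut and the wall counted twice supply at most
        \<open>3 * k\<close>.\<close>
      ultimately show False using c B(5) k_ge unfolding F_G w by linarith
    qed
    then obtain q where q: "q \<in> A" "q \<noteq> p" "Upair p q \<in># E" by blast
    obtain I' J' where Y: "I' \<subseteq> J'" "J' \<subseteq> V" "I' \<noteq> {}" "J' \<noteq> V" "G.F I' J' = 2 * k" "cross I' J' (Upair p q)"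
      "card (J' - I') \<le> 1"
      using edge_crosses[OF q(3)] by blast
    obtain p' q' where pq: "p' \<in> I'" "q' \<notin> J'" "p' \<in> A" "q' \<in> A" "Upair p' q' \<in># E"
      using Y(6) p q by (auto simp: Upair_inject) (metis Upair_inject)
    have P: "G.F (A \<inter> I') (B \<inter> J') + G.F (A \<union> I') (B \<union> J') \<le> 4 * k"
      using G.F_Int_Un[OF B(1) Y(1) BV(1) Y(2)] B(5) Y(5) by linarith
    have D: "G.F (A - J') (B - I') + G.F (I' - B) (J' - A) \<le> 4 * k"
      using G.F_Diff[OF B(1) Y(1) BV(1) Y(2)] B(5) Y(5) by linarith
    have "\<not> G.F (A \<inter> I') (B \<inter> J') \<le> 2 * k"
    proof
      have c: "cross (A \<inter> I') (B \<inter> J') (Upair p' q')" using pq by simp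
      assume h: "G.F (A \<inter> I') (B \<inter> J') \<le> 2 * k"
      show False by (rule sm[OF _ _ _ _ pq(5) c h]) (use pq B(1) Y(1) in blast)+
    qed
    then have "\<not> 2 * k \<le> G.F (A \<union> I') (B \<union> J')" using P by linarith
    then have V: "B \<union> J' = V" using F_G_ge[of "A \<union> I'" "B \<union> J'"] B Y BV by blast
    have "\<not> G.F (A - J') (B - I') \<le> 2 * k"
    proof
      have c: "cross (A - J') (B - I') (Upair p' q')" using pq B(1) by auto
      assume h: "G.F (A - J') (B - I') \<le> 2 * k"
      show False by (rule sm[OF _ _ _ _ pq(5) c h]) (use pq B(1) Y(1) in blast)+
    qed
    then have "\<not> 2 * k \<le> G.F (I' - B) (J' - A)" using D by linarith
    then have "I' \<subseteq> B" using F_G_ge[of "I' - B" "J' - A"] B Y BV p by blast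
    then have "V - B \<subseteq> J' - I'" using V by blast
    then have "card (V - B) \<le> card (J' - I')"
      using card_mono[of "J' - I'" "V - B"] G.sub_finite[OF Y(2)] by blast
    then show thesis using cVB Y(7) by linarith
  qed
qed

text \<open>Two outside vertices are required because a tight biset of the graph without
  \<open>a\<close> has \<open>a\<close> and another vertex outside. If no such biset exists, no
  obstacle with another neighbour can occur, and any vertex of degree \<open>2 * k\<close> will
  do.\<close>

lemma good_vertex_candidate:
  obtains (plain) a where "a \<in> V" "G.F {a} {a} = 2 * k" "\<And>t A. G.tight t A \<Longrightarrow> \<not> 2 \<le> card (V - insert t A)"
  | (wall) a t Z where "G.tight t Z" "a \<in> Z" "G.F {a} {a} = 2 * k"
      "\<And>s A. G.tight s A \<Longrightarrow> 2 \<le> card (V - insert s A) \<Longrightarrow> card Z \<le> card A"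
      "2 \<le> card (V - insert t Z)"
proof (cases "\<exists>t A. G.tight t A \<and> 2 \<le> card (V - insert t A)")
  case True
  define P where "P A \<longleftrightarrow> (\<exists>t. G.tight t A \<and> 2 \<le> card (V - insert t A))" for A
  obtain A0 where "P A0" using True unfolding P_def by blast
  then obtain Z where Z: "P Z" "\<And>A. P A \<Longrightarrow> card Z \<le> card A"
    using ex_has_least_nat[of P A0 card] by blast
  have min: "\<And>s A. G.tight s A \<Longrightarrow> 2 \<le> card (V - insert s A) \<Longrightarrow> card Z \<le> card A"
    using Z(2) unfolding P_def by blast
  obtain t where Z: "G.tight t Z" "2 \<le> card (V - insert t Z)" using Z(1) unfolding P_def by blast
  note D = G.tightD[OF Z(1)]
  have "insert t Z - Z = {t}" using D by auto
  then obtain a where "a \<in> Z" "G.F {a} {a} = 2 * k"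
    using degree_2k_inside[OF D(8,6,4,7) _ Z(2)] by auto
  then show thesis using wall Z min by blast
next
  case False
  have Vne: "V \<noteq> {}" using card_V by auto
  then obtain v where v: "v \<in> V" by blast
  have "2 * k \<le> G.F {v} {v}" by (rule G.F_ge) (use v pair_ne_V in auto)
  then have "0 < cut E {v} {v}" using k_ge unfolding F_G by simp
  then obtain e where e: "e \<in># E" unfolding cut_def by (auto simp: nonempty_has_size[symmetric])
  obtain I J where Y: "I \<subseteq> J" "J \<subseteq> V" "I \<noteq> {}" "J \<noteq> V" "G.F I J = 2 * k" "cross I J e" "card (J - I) \<le> 1"
    using edge_crosses[OF e] by blast
  have "\<exists>a\<in>V. G.F {a} {a} = 2 * k"
  proof (cases "2 \<le> card (V - J)")
    case True
    then show ?thesis using degree_2k_inside[OF Y(1,2,3,5,7)] Y by (metis subsetD)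
  next
    case c: False
    have "card V = card (V - J) + card J" "card J = card (J - I) + card I"
      using Y fin G.sub_finite[OF Y(2)] card_Diff_subset[of J V] card_Diff_subset[of I J] card_mono[of V J] card_mono[of J I]
        finite_subset[of I J] by auto
    then have "2 \<le> card I" using c card_V Y(7) by linarith
    moreover have "V - (V - I) = I" "V - I - (V - J) = J - I" using Y by auto
    moreover have "V - J \<subseteq> V - I" "V - I \<subseteq> V" "V - J \<noteq> {}" using Y by auto
    moreover have "G.F (V - J) (V - I) = 2 * k" using F_G_compl[OF Y(1,2)] Y(5) by simp
    ultimately show ?thesis
      using degree_2k_inside[of "V - J" "V - I"] Y(7) by (metis DiffD1)
  qed
  then show thesis using plain False by blast
qed

end

section \<open>Excluding obstacles at a vertex of degree 2k\<close>

locale vertex_graph = min_graph +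
  fixes a and N :: "'a multiset" and E0 :: "'a uprod multiset"
  assumes a: "a \<in> V" and deg: "G.F {a} {a} = 2 * k" and E: "E = E0 + image_mset (Upair a) N"
    and E0: "\<forall>e\<in>#E0. a \<notin> set_uprod e" and aN: "a \<notin># N"
begin

lemma cut_out: "I \<subseteq> J \<Longrightarrow> a \<notin> J \<Longrightarrow> cut E I J = cut E0 I J + weight N I"
  unfolding E using cut_Upair_out[of a J I N] by simp

lemma cut_in: "I \<subseteq> J \<Longrightarrow> a \<in> I \<Longrightarrow> weight N (- J) \<le> cut E I J"
  unfolding E using cut_Upair_in[of a I J N] by simp

lemma cut_E0: "cut E0 {a} J = 0"
proof -
  have "filter_mset (cross {a} J) E0 = filter_mset (\<lambda>_. False) E0"
    by (rule filter_mset_cong) (use E0 in \<open>auto simp: cross_def\<close>)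
  then show ?thesis by (simp add: cut_def)
qed

lemma cut_a: "a \<in> J \<Longrightarrow> cut E {a} J = weight N (- J)"
  unfolding E using cut_Upair_in[of a "{a}" J N] cut_E0 by simp

lemma size_N: "size N = 2 * k"
proof -
  have "weight N (- {a}) = size N" by (rule weight_size) (use aN in auto)
  then show ?thesis using deg cut_a[of "{a}"] unfolding F_G by simp
qed

lemma N_V: "set_mset N \<subseteq> V - {a}"
proof
  fix v assume v: "v \<in># N"
  then have "Upair a v \<in># E" unfolding E by (simp del: Upair_inject)
  then have "v \<in> V" using E_V by fastforce
  then show "v \<in> V - {a}" using v aN by auto
qed

lemma E0_V: "\<forall>e\<in>#E0. set_uprod e \<subseteq> V - {a}"
  using E0 E_V unfolding E by fastforce

lemma conn0: "mix_conn k (V - {a}) E0 N"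
  unfolding mix_conn_def
proof (intro allI impI)
  fix I J assume h: "I \<subseteq> J \<and> J \<subseteq> V - {a} \<and> I \<noteq> {} \<and> J \<noteq> V - {a}"
  have "2 * k \<le> G.F I J" by (rule G.F_ge) (use h a in auto)
  moreover have "a \<notin> J" using h by blast
  ultimately show "2 * k \<le> cut E0 I J + weight N I + k * card (J - I)"
    unfolding F_G using cut_out[of I J] h by simp
qed

sublocale A: split_graph k "V - {a}" E0 N
  using fin k_ge E0_V N_V size_N conn0 by unfold_locales auto

text \<open>Deleting \<open>x\<close> leaves at least \<open>k\<close> of the \<open>2 * k\<close>
  edges at \<open>a\<close>. This yields the degree condition of the pinching that is being
  undone.\<close>

lemma count_le: "x \<in> V \<Longrightarrow> x \<noteq> a \<Longrightarrow> count N x \<le> k"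
proof -
  assume x: "x \<in> V" "x \<noteq> a"
  have "{a, x} \<noteq> V" by (rule pair_ne_V)
  then have "2 * k \<le> G.F {a} {a, x}" by (intro G.F_ge) (use a x in auto)
  moreover have "{a, x} - {a} = {x}" using x by auto
  ultimately have "k \<le> weight N (- {a, x})" unfolding F_G using cut_a[of "{a, x}"] by simp
  moreover have "weight N (- {a, x}) + count N x \<le> size N"
    using weight_disj[of "- {a, x}" "{x}" N] weight_mono[of N "- {a, x} \<union> {x}" UNIV] weight_size[of N UNIV] by simp
  ultimately show ?thesis using size_N by linarith
qed

lemma tight_G:
  assumes "A.tight t B"
  shows "G.tight t B" "a \<notin> B" "t \<noteq> a" "2 \<le> card (V - insert t B)"
proof -
  note D = A.tightD[OF assms]
  show aB: "a \<notin> B" "t \<noteq> a" using D by auto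
  have "G.F B (insert t B) = A.F B (insert t B)"
    unfolding F_G A.F_def using cut_out[of B "insert t B"] aB by auto
  then show "G.tight t B" unfolding G.tight_def using D a by auto
  obtain z where "z \<in> V - {a}" "z \<notin> insert t B" using D by blast
  then show "2 \<le> card (V - insert t B)" by (intro G.wall2[of _ a z]) (use a aB in auto)
qed

text \<open>Only \<open>k\<close> edges pass from \<open>Z\<close> beyond its wall, so at least
  \<open>k\<close> of the edges at \<open>a\<close> stay in \<open>insert t Z\<close>; all of them
  go to \<open>x\<close>.\<close>

lemma outside_count:
  assumes Z: "G.tight t Z" "a \<in> Z" and x: "x \<in> V" "x \<noteq> a"
    and out: "\<And>b. b \<in># N \<Longrightarrow> b \<in> insert t Z \<Longrightarrow> b = x"
  shows "count N x = k"
proof -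
  note D = G.tightD[OF Z(1)]
  have "insert t Z - Z = {t}" using D by auto
  then have "cut E Z (insert t Z) = k" using D(7) unfolding F_G by simp
  then have "weight N (- insert t Z) \<le> k" using cut_in[OF D(8) Z(2)] by simp
  moreover have "size N = weight N (- insert t Z \<union> {x})" by (rule weight_size[symmetric]) (use out in auto)
  moreover have "weight N (- insert t Z \<union> {x}) \<le> weight N (- insert t Z) + count N x"
    using weight_Un_Int[of N "- insert t Z" "{x}"] by simp
  ultimately have "k \<le> count N x" using size_N by linarith
  then show ?thesis using count_le[OF x] by linarith
qed

text \<open>Whatever the position of \<open>r\<close>, tight bisets covering the neighbours of
  \<open>a\<close> must avoid \<open>Z\<close>, since uncrossing them with \<open>Z\<close> would
  give a smaller tight biset. Then \<open>outside_count\<close> applies to \<open>r\<close> or to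
  \<open>t\<close>.\<close>

lemma no_obstacle_minimal:
  assumes Z: "G.tight t Z" "a \<in> Z"
    and min: "\<And>s A. G.tight s A \<Longrightarrow> 2 \<le> card (V - insert s A) \<Longrightarrow> card Z \<le> card A"
    and card: "2 \<le> card (V - insert t Z)"
  shows "\<not> A.obstacle r"
proof
  assume "A.obstacle r"
  then have odd: "odd (count N r)" and all: "\<And>v. v \<in># N \<Longrightarrow> v \<noteq> r \<Longrightarrow> \<exists>A. A.tight r A \<and> v \<in> A"
    unfolding A.obstacle_def by blast+
  note z = G.tightD[OF Z(1)]
  have finZ: "finite Z" using G.sub_finite[OF z(2)] .
  have rN: "r \<in># N" using odd by (metis even_zero not_in_iff)
  then have r: "r \<in> V" "r \<noteq> a" using N_V by auto
  have minA: "card Z \<le> card B" if "A.tight r B" for B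
    using min tight_G[OF that] by blast
  have small: False if s: "G.tight s A" "insert s A \<subseteq> insert t Z" "A \<subseteq> Z" "A \<noteq> Z" for s A
  proof -
    have "2 \<le> card (V - insert s A)"
      using card card_mono[of "V - insert s A" "V - insert t Z"] fin s(2) by (meson Diff_mono finite_Diff order_refl order_trans)
    then have "card Z \<le> card A" using min s by blast
    moreover have "card A < card Z" using psubset_card_mono[OF finZ] s by blast
    ultimately show False by linarith
  qed
  have notsub: "\<not> B \<subseteq> Z" if "A.tight r B" for B
  proof
    assume "B \<subseteq> Z"
    then have "B \<subset> Z" using tight_G(2)[OF that] Z by blast
    then show False using psubset_card_mono[OF finZ, of B] minA[OF that] by linarith
  qed
  \<comment> \<open>The companion \<open>C\<close> ensures that the union of \<open>Z\<close> and
    \<open>B\<close> with its wall does not exhaust \<open>V\<close>, so that \<open>F_ge\<close>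
    applies to it.\<close>
  have disj: "\<exists>B C. A.tight r B \<and> b \<in> B \<and> A.tight r C \<and> B \<inter> C = {}" if "b \<in># N" "b \<noteq> r" for b
    using A.tight_disjoint[OF all that] by blast
  consider "r = t" | "r \<noteq> t" "r \<notin> Z" | "r \<noteq> t" "r \<in> Z" by blast
  then show False
  proof cases
    case rt: 1
    have out: "Z \<inter> B = {}" if B: "A.tight r B" for B
    proof (rule ccontr)
      assume h: "Z \<inter> B \<noteq> {}"
      have "G.tight t (Z - B)"
        using G.tight_Diff(1)[of t Z B] tight_G[OF B] Z rt notsub[OF B] by blast
      then show False using small[of t "Z - B"] h by blast
    qed
    have "count N r = k"
      by (rule outside_count[OF Z r]) (use disj out rt in blast)
    then show False using odd even_k by simp
  next
    case rt: 2
    have out1: "Z \<inter> B = {}" if B: "A.tight r B" and tB: "t \<notin> B" for B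
    proof (rule ccontr)
      assume h: "Z \<inter> B \<noteq> {}"
      note b = G.tightD[OF tight_G(1)[OF B]]
      have e: "Z - insert r B = Z - B" "insert t Z - B = insert t (Z - B)" "B - insert t Z = B - Z"
        "insert r B - Z = insert r (B - Z)" using rt tB by auto
      have D: "G.F (Z - B) (insert t (Z - B)) + G.F (B - Z) (insert r (B - Z)) \<le> 4 * k"
        using G.F_Diff[OF z(8) b(8) z(6) b(6)] z(7) b(7) unfolding e by linarith
      have "2 * k \<le> G.F (B - Z) (insert r (B - Z))"
        by (rule G.F_ge) (use b notsub[OF B] in auto)
      moreover have "2 * k \<le> G.F (Z - B) (insert t (Z - B))"
        by (rule G.F_ge) (use z Z tight_G(2)[OF B] in auto)
      ultimately have "G.F (Z - B) (insert t (Z - B)) = 2 * k" using D by linarith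
      then have "G.tight t (Z - B)" unfolding G.tight_def using z Z tight_G(2)[OF B] by auto
      then show False using small[of t "Z - B"] h by blast
    qed
    have out: "Z \<inter> B = {}" if B: "A.tight r B" and C: "A.tight r C" "B \<inter> C = {}" for B C
    proof (cases "t \<in> B")
      case False
      then show ?thesis using out1 B by blast
    next
      case tB: True
      show ?thesis
      proof (rule ccontr)
        assume h: "Z \<inter> B \<noteq> {}"
        note b = G.tightD[OF tight_G(1)[OF B]] and c = G.tightD[OF tight_G(1)[OF C(1)]]
        have e: "insert t Z \<inter> insert r B = insert t (Z \<inter> B)" "insert t Z \<union> insert r B = insert r (Z \<union> B)"
          using rt tB by auto
        have P: "G.F (Z \<inter> B) (insert t (Z \<inter> B)) + G.F (Z \<union> B) (insert r (Z \<union> B)) \<le> 4 * k"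
          using G.F_Int_Un[OF z(8) b(8) z(6) b(6)] z(7) b(7) unfolding e by linarith
        have "t \<notin> C" using tB C by blast
        then have CZ: "Z \<inter> C = {}" using out1 C by blast
        then have V: "insert r (Z \<union> B) \<noteq> V" using c C(2) by blast
        have "2 * k \<le> G.F (Z \<union> B) (insert r (Z \<union> B))"
          by (rule G.F_ge) (use z b V in auto)
        moreover have ge: "2 * k \<le> G.F (Z \<inter> B) (insert t (Z \<inter> B))"
          by (rule G.F_ge) (use z h in auto)
        ultimately have "G.F (Z \<inter> B) (insert t (Z \<inter> B)) = 2 * k" using P by linarith
        then have "G.tight t (Z \<inter> B)" unfolding G.tight_def using z h by auto
        then show False using small[of t "Z \<inter> B"] tight_G(2)[OF B] Z by blast
      qed
    qed
    have "t \<noteq> a" using z(3) Z(2) by blast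
    then have "count N t = k"
      by (intro outside_count[OF Z z(1)]) (use disj out rt in blast)+
    then have "t \<in># N" using k_ge by (simp add: count_greater_zero_iff[symmetric] del: count_greater_zero_iff)
    \<comment> \<open>A tight biset around \<open>t\<close> carries at least \<open>k\<close> edges
      and leaves at least as many outside; with the edges to its wall \<open>r\<close> this exceeds
      \<open>2 * k\<close>.\<close>
    then obtain T where T: "A.tight r T" "t \<in> T" using all rt by blast
    have "k \<le> A.n T" using A.n_ge_count[OF T(2)] \<open>count N t = k\<close> by simp
    moreover have "0 < count N r" using rN by simp
    ultimately show False using A.tight_half[OF T(1)] size_N by linarith
  next
    case rt: 3
    have tB: "t \<notin> B" if B: "A.tight r B" for B
    proof
      assume tB: "t \<in> B"
      note b = G.tightD[OF tight_G(1)[OF B]]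
      have aB: "a \<notin> B" using tight_G(2)[OF B] .
      have e: "insert t Z - B = insert r (Z - insert r B)" "insert r B - Z = insert t (B - insert t Z)"
        using rt tB b z by auto
      have D: "G.F (Z - insert r B) (insert r (Z - insert r B)) + G.F (B - insert t Z) (insert t (B - insert t Z)) \<le> 4 * k"
        using G.F_Diff[OF z(8) b(8) z(6) b(6)] z(7) b(7) unfolding e by linarith
      \<comment> \<open>Such a \<open>B\<close> would omit \<open>a\<close> and \<open>r\<close>
        from \<open>Z\<close> and gain at most \<open>t\<close>, so it would be smaller than
        \<open>Z\<close>.\<close>
      have ne: "\<not> B \<subseteq> insert t Z"
      proof
        assume "B \<subseteq> insert t Z"
        then have "B \<subseteq> insert t (Z - {a, r})" using aB b(3) by blast
        then have "card B \<le> card (insert t (Z - {a, r}))" using finZ by (intro card_mono) auto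
        also have "\<dots> \<le> Suc (card (Z - {a, r}))" using finZ by (simp add: card_insert_if)
        also have "card (Z - {a, r}) = card Z - 2"
          using card_Diff_subset[of "{a, r}" Z] rt Z r by auto
        finally show False
          using minA[OF B] card_mono[OF finZ, of "{a, r}"] rt Z r by auto
      qed
      have "2 * k \<le> G.F (B - insert t Z) (insert t (B - insert t Z))"
        by (rule G.F_ge) (use z b ne aB Z in auto)
      moreover have "2 * k \<le> G.F (Z - insert r B) (insert r (Z - insert r B))"
        by (rule G.F_ge) (use z b ne aB Z r tB in auto)
      ultimately have "G.F (Z - insert r B) (insert r (Z - insert r B)) = 2 * k" using D by linarith
      then have "G.tight r (Z - insert r B)" unfolding G.tight_def using z b aB Z r tB by auto
      then show False using small[of r "Z - insert r B"] rt by blast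
    qed
    have out: "Z \<inter> B = {}" if B: "A.tight r B" and C: "A.tight r C" "B \<inter> C = {}" for B C
    proof (rule ccontr)
      assume h: "Z \<inter> B \<noteq> {}"
      note b = G.tightD[OF tight_G(1)[OF B]] and c = G.tightD[OF tight_G(1)[OF C(1)]]
      have e: "insert t Z \<inter> insert r B = insert r (Z \<inter> B)" "insert t Z \<union> insert r B = insert t (Z \<union> B)"
        using rt tB[OF B] by auto
      have P: "G.F (Z \<inter> B) (insert r (Z \<inter> B)) + G.F (Z \<union> B) (insert t (Z \<union> B)) \<le> 4 * k"
        using G.F_Int_Un[OF z(8) b(8) z(6) b(6)] z(7) b(7) unfolding e by linarith
      have V: "insert t (Z \<union> B) \<noteq> V" using c(2) C(2) notsub[OF C(1)] tB[OF C(1)] by blast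
      have "2 * k \<le> G.F (Z \<union> B) (insert t (Z \<union> B))"
        by (rule G.F_ge) (use z b V in auto)
      moreover have "2 * k \<le> G.F (Z \<inter> B) (insert r (Z \<inter> B))"
        by (rule G.F_ge) (use z b h in auto)
      ultimately have "G.F (Z \<inter> B) (insert r (Z \<inter> B)) = 2 * k" using P by linarith
      then have "G.tight r (Z \<inter> B)" unfolding G.tight_def using b h by auto
      then show False using small[of r "Z \<inter> B"] rt tight_G(2)[OF B] Z by blast
    qed
    have "count N r = k"
      by (rule outside_count[OF Z r]) (use disj out tB in blast)
    then show False using odd even_k by simp
  qed
qed

lemma no_obstacle_plain:
  assumes "\<And>t A. G.tight t A \<Longrightarrow> \<not> 2 \<le> card (V - insert t A)"
  shows "\<not> A.obstacle r"
proof
  assume h: "A.obstacle r"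
  then have odd: "odd (count N r)" unfolding A.obstacle_def by blast
  then have "r \<in># N" by (metis even_zero not_in_iff)
  then have "count N r \<le> k" using count_le N_V by blast
  moreover have "size N = count N r + A.n (- {r})"
    using weight_disj[of "{r}" "- {r}" N] weight_size[of N "{r} \<union> - {r}"] by auto
  ultimately have "0 < A.n (- {r})" using size_N k_ge by linarith
  then obtain b where "b \<in># N" "b \<noteq> r" using weight_pos_iff[of N "- {r}"] by blast
  then obtain B where "A.tight r B" using h unfolding A.obstacle_def by blast
  then show False using tight_G assms by blast
qed

end

context min_graph
begin

lemma good_vertex:
  obtains a N E0 F where "a \<in> V" "E = E0 + image_mset (Upair a) N" "\<forall>e\<in>#E0. set_uprod e \<subseteq> V - {a}"
    "set_mset N \<subseteq> V - {a}" "size N = 2 * k" "\<And>x. x \<in> V - {a} \<Longrightarrow> count N x \<le> k"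
    "(\<Sum>e\<in>#F. ends e) = N" "mix_conn k (V - {a}) (E0 + F) {#}"
proof -
  note result = that
  have main: thesis if a: "a \<in> V" "G.F {a} {a} = 2 * k"
    and no: "\<And>N E0 r. vertex_graph k V E a N E0 \<Longrightarrow> \<not> split_graph.obstacle k (V - {a}) E0 N r" for a
  proof -
    define E0 where "E0 = filter_mset (\<lambda>e. a \<notin> set_uprod e) E"
    obtain N where N: "filter_mset (\<lambda>e. a \<in> set_uprod e) E = image_mset (Upair a) N" "a \<notin># N"
      using edges_at_vertex[OF no_loop, of a] by blast
    have E: "E = E0 + image_mset (Upair a) N"
      using multiset_partition[of E "\<lambda>e. a \<in> set_uprod e"] unfolding E0_def N(1) by (simp add: add.commute)
    interpret vertex_graph k V E a N E0
      by (unfold_locales, rule a(1), rule a(2), rule E, simp add: E0_def, rule N(2))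
    obtain F where "(\<Sum>e\<in>#F. ends e) = N" "mix_conn k (V - {a}) (E0 + F) {#}"
      using complete_splitting[OF A.split_graph_axioms] no[OF vertex_graph_axioms] by blast
    then show thesis using result[of a E0 N F] a(1) E E0_V N_V size_N count_le by blast
  qed
  show thesis
  proof (cases rule: good_vertex_candidate)
    case (plain a)
    show thesis
      by (rule main[OF plain(1,2)], erule vertex_graph.no_obstacle_plain, rule plain(3))
  next
    case (wall a t Z)
    have "a \<in> V" using wall(2) G.tightD(2)[OF wall(1)] by blast
    then show thesis
      by (rule main[OF _ wall(3)]) (erule vertex_graph.no_obstacle_minimal[OF _ wall(1,2,4,5)])
  qed
qed

end

section \<open>The construction\<close>

lemma cut_mono: "E \<subseteq># E' \<Longrightarrow> cut E I J \<le> cut E' I J"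
  by (metis cut_union le_add1 subset_mset.add_diff_inverse)

lemma mix_conn_mono: "mix_conn k V E {#} \<Longrightarrow> E \<subseteq># E' \<Longrightarrow> mix_conn k V E' {#}"
  unfolding mix_conn_def using cut_mono[of E E'] by (meson add_le_mono1 order_trans)

lemma edge_connected_iff_cut:
  assumes wf: "wf_multigraph G" and ne: "verts G \<noteq> {}"
  shows "edge_connected l G \<longleftrightarrow> (\<forall>A. A \<subseteq> verts G \<and> A \<noteq> {} \<and> A \<noteq> verts G \<longrightarrow> l \<le> cut (edges G) A A)"
proof
  assume ec: "edge_connected l G"
  show "\<forall>A. A \<subseteq> verts G \<and> A \<noteq> {} \<and> A \<noteq> verts G \<longrightarrow> l \<le> cut (edges G) A A"
  proof (intro allI impI, rule ccontr)
    fix A assume A: "A \<subseteq> verts G \<and> A \<noteq> {} \<and> A \<noteq> verts G" and lt: "\<not> l \<le> cut (edges G) A A"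
    let ?D = "filter_mset (cross A A) (edges G)"
    have "connected_multigraph (delete_edges G ?D)"
      using ec lt unfolding edge_connected_def cut_def by simp
    moreover obtain u v where uv: "u \<in> A" "v \<in> verts G" "v \<notin> A" using A by blast
    ultimately have "(adjacent (delete_edges G ?D))\<^sup>*\<^sup>* u v"
      using A unfolding connected_multigraph_def delete_edges_def by auto
    then have "v \<in> A"
    proof (induction rule: rtranclp_induct)
      case base
      then show ?case using uv by simp
    next
      case (step y z)
      have "edges G - ?D = filter_mset (\<lambda>e. \<not> cross A A e) (edges G)"
        using multiset_partition[of "edges G" "cross A A"] by (metis add_diff_cancel_left')
      then have "\<not> cross A A (Upair y z)"
        using step(2) unfolding adjacent_def delete_edges_def by simp
      then show ?case using step(3) by simp
    qed
    then show False using uv by blast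
  qed
next
  assume c: "\<forall>A. A \<subseteq> verts G \<and> A \<noteq> {} \<and> A \<noteq> verts G \<longrightarrow> l \<le> cut (edges G) A A"
  show "edge_connected l G"
    unfolding edge_connected_def
  proof (intro allI impI, elim conjE)
    fix D assume D: "D \<subseteq># edges G" "size D < l"
    let ?H = "delete_edges G D"
    have "(adjacent ?H)\<^sup>*\<^sup>* u v" if uv: "u \<in> verts G" "v \<in> verts G" for u v
    proof (rule ccontr)
      assume no: "\<not> ?thesis"
      \<comment> \<open>The component of \<open>u\<close> after the deletion: every edge leaving it
        belongs to \<open>D\<close>, so its cut has fewer than \<open>l\<close> edges.\<close>
      define A where "A = {w \<in> verts G. (adjacent ?H)\<^sup>*\<^sup>* u w}"
      have "A \<subseteq> verts G" "u \<in> A" "v \<notin> A" unfolding A_def using uv no by auto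
      then have "l \<le> cut (edges G) A A" using c uv by blast
      moreover have "cut (edges G - D) A A = 0"
      proof -
        have "\<not> cross A A e" if e: "e \<in># edges G - D" for e
        proof
          assume "cross A A e"
          then obtain p q where pq: "e = Upair p q" "p \<in> A" "q \<notin> A" unfolding cross_def by blast
          have "set_uprod e \<subseteq> verts G" using wf in_diffD[OF e] unfolding wf_multigraph_def by blast
          then have "q \<in> verts G" using pq by simp
          moreover have "adjacent ?H p q" using e pq unfolding adjacent_def delete_edges_def by simp
          ultimately show False using pq(2,3) unfolding A_def by (auto dest: rtranclp.rtrancl_into_rtrancl)
        qed
        then have "filter_mset (cross A A) (edges G - D) = filter_mset (\<lambda>_. False) (edges G - D)"
          by (intro filter_mset_cong) auto
        then show ?thesis by (simp add: cut_def)
      qed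
      moreover have "cut (edges G) A A = cut (edges G - D) A A + cut D A A"
        using D(1) cut_union by (metis subset_mset.diff_add)
      moreover have "cut D A A \<le> size D" unfolding cut_def by (simp add: size_filter_mset_lesseq)
      ultimately show False using D(2) by linarith
    qed
    then show "connected_multigraph ?H"
      using ne unfolding connected_multigraph_def by (simp add: delete_edges_def)
  qed
qed

lemma cut_delete_vertex:
  "v \<notin> A \<Longrightarrow> cut (filter_mset (\<lambda>e. v \<notin> set_uprod e) E) A A = cut E A (insert v A)"
proof (induction E)
  case (add e E)
  then show ?case by (cases e) auto
qed simp

text \<open>Empty walls express \<open>2 * k\<close>-edge-connectivity. A wall \<open>{v}\<close>
  pays \<open>k\<close>, which leaves the cut condition for the graph without \<open>v\<close>;
  larger walls impose nothing.\<close>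

lemma mixed_connected_iff:
  assumes wf: "wf_multigraph G"
  shows "mixed_connected (2 * k) k G \<longleftrightarrow> 3 \<le> card (verts G) \<and> mix_conn k (verts G) (edges G) {#}"
proof (cases "3 \<le> card (verts G)")
  case False
  then show ?thesis unfolding mixed_connected_def by simp
next
  case c3: True
  let ?V = "verts G" and ?E = "edges G"
  have fin: "finite ?V" using wf unfolding wf_multigraph_def by blast
  have ne: "?V \<noteq> {}" using c3 by auto
  have del: "edge_connected k (delete_vertex G v) \<longleftrightarrow>
    (\<forall>A. A \<subseteq> ?V - {v} \<and> A \<noteq> {} \<and> A \<noteq> ?V - {v} \<longrightarrow> k \<le> cut ?E A (insert v A))" if v: "v \<in> ?V" for v
  proof -
    have "wf_multigraph (delete_vertex G v)"
      using wf unfolding wf_multigraph_def delete_vertex_def by auto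
    moreover have "card (?V - {v}) \<noteq> 0" using c3 v fin by simp
    then have "verts (delete_vertex G v) \<noteq> {}" unfolding delete_vertex_def by (metis card.empty select_convs(1))
    moreover have "cut (edges (delete_vertex G v)) A A = cut ?E A (insert v A)" if "A \<subseteq> ?V - {v}" for A
      unfolding delete_vertex_def using cut_delete_vertex[of v A ?E] that by auto
    ultimately show ?thesis by (subst edge_connected_iff_cut) (auto simp: delete_vertex_def)
  qed
  show ?thesis
  proof
    assume m: "mixed_connected (2 * k) k G"
    have e2: "2 * k \<le> cut ?E A A" if "A \<subseteq> ?V" "A \<noteq> {}" "A \<noteq> ?V" for A
      using m edge_connected_iff_cut[OF wf ne] that unfolding mixed_connected_def by blast
    have e1: "k \<le> cut ?E A (insert v A)" if "v \<in> ?V" "A \<subseteq> ?V - {v}" "A \<noteq> {}" "A \<noteq> ?V - {v}" for v A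
      using m del[OF that(1)] that unfolding mixed_connected_def by blast
    show "3 \<le> card ?V \<and> mix_conn k ?V ?E {#}"
    proof
      show "mix_conn k ?V ?E {#}"
        unfolding mix_conn_def
      proof (intro allI impI, elim conjE)
        fix I J assume h: "I \<subseteq> J" "J \<subseteq> ?V" "I \<noteq> {}" "J \<noteq> ?V"
        have fJ: "finite (J - I)" using fin h finite_subset by blast
        consider "card (J - I) = 0" | "card (J - I) = 1" | "2 \<le> card (J - I)" by linarith
        then show "2 * k \<le> cut ?E I J + weight {#} I + k * card (J - I)"
        proof cases
          case 1
          then have "J = I" using fJ h by auto
          then show ?thesis using e2[of I] h by auto
        next
          case 2
          then obtain v where v: "J - I = {v}" using card_1_singletonE by blast
          then have "J = insert v I" using h by blast
          then show ?thesis using e1[of v I] h v by auto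
        next
          case 3
          then have "k * 2 \<le> k * card (J - I)" by (rule mult_le_mono2)
          then show ?thesis by linarith
        qed
      qed
    qed (rule c3)
  next
    assume "3 \<le> card ?V \<and> mix_conn k ?V ?E {#}"
    then have mc: "2 * k \<le> cut ?E I J + k * card (J - I)" if "I \<subseteq> J" "J \<subseteq> ?V" "I \<noteq> {}" "J \<noteq> ?V" for I J
      using that unfolding mix_conn_def by simp
    have "edge_connected (2 * k) G"
      unfolding edge_connected_iff_cut[OF wf ne]
    proof (intro allI impI)
      fix A assume "A \<subseteq> ?V \<and> A \<noteq> {} \<and> A \<noteq> ?V"
      then show "2 * k \<le> cut ?E A A" using mc[of A A] by simp
    qed
    moreover have "edge_connected k (delete_vertex G v)" if v: "v \<in> ?V" for v
      unfolding del[OF v]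
    proof (intro allI impI)
      fix A assume A: "A \<subseteq> ?V - {v} \<and> A \<noteq> {} \<and> A \<noteq> ?V - {v}"
      have "2 * k \<le> cut ?E A (insert v A) + k * card (insert v A - A)"
        by (rule mc) (use A v in auto)
      moreover have "insert v A - A = {v}" using A by auto
      ultimately show "k \<le> cut ?E A (insert v A)" by simp
    qed
    ultimately show "mixed_connected (2 * k) k G" unfolding mixed_connected_def using c3 by blast
  qed
qed

section \<open>Pinching preserves mixed connectivity\<close>

abbreviation all_ends :: "'a uprod multiset \<Rightarrow> 'a multiset" where
  "all_ends F \<equiv> (\<Sum>e\<in>#F. ends e)"

lemma pinch_edges: "(\<Sum>e\<in>#F. image_mset (Upair s) (ends e)) = image_mset (Upair s) (all_ends F)"
  by (induction F) auto

lemma size_ends: "size (ends e) = 2"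
  by (cases e) simp

lemma size_all_ends: "size (all_ends F) = 2 * size F"
  by (induction F) (auto simp: size_ends)

lemma set_ends: "set_mset (ends e) = set_uprod e"
  by (cases e) simp

lemma set_all_ends: "set_mset (all_ends F) \<subseteq> V \<longleftrightarrow> (\<forall>e\<in>#F. set_uprod e \<subseteq> V)"
  by (induction F) (auto simp: set_ends)

lemma degree_in_eq: "degree_in F v = count (all_ends F) v"
  unfolding degree_in_def by (induction F) auto

lemma cut_le_weight: "I \<subseteq> J \<Longrightarrow> cut F I J \<le> weight (all_ends F) I"
proof (induction F)
  case (add e F)
  then show ?case by (cases e) auto
qed simp

lemma cut_le_size: "cut F I J \<le> size F"
  unfolding cut_def by (rule size_filter_mset_lesseq)

text \<open>For \<open>J\<close> inside \<open>V\<close>, each crossing edge of \<open>F\<close> is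
  compensated by an edge to \<open>s\<close>. If \<open>J = V\<close>, all \<open>2 * k\<close>
  edges at \<open>s\<close> are available, and the degree bound controls those lost to a one-vertex
  wall. If \<open>s\<close> is the whole wall, at most \<open>k\<close> of the \<open>2 * k\<close>
  crossing edges are gone. The case \<open>s \<in> I\<close> follows by complementation.\<close>

lemma mix_conn_pinch:
  assumes conn: "mix_conn k V E {#}" and E_V: "\<forall>e\<in>#E. set_uprod e \<subseteq> V" and fin: "finite V"
    and F: "F \<subseteq># E" "size F = k" "\<forall>v\<in>V. degree_in F v \<le> k" and s: "s \<notin> V"
  shows "mix_conn k (insert s V) (E - F + image_mset (Upair s) (all_ends F)) {#}"
proof -
  let ?N = "all_ends F" and ?V = "insert s V"
  let ?E = "E - F + image_mset (Upair s) ?N"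
  have FV: "\<forall>e\<in>#F. set_uprod e \<subseteq> V" using F(1) E_V by (meson mset_subset_eqD)
  then have NV: "set_mset ?N \<subseteq> V" using set_all_ends[of F V] by blast
  have EV: "\<forall>e\<in>#?E. set_uprod e \<subseteq> ?V" using E_V NV by (auto dest: in_diffD)
  have cE: "cut E I J = cut (E - F) I J + cut F I J" for I J
    using F(1) cut_union by (metis subset_mset.diff_add)
  have mc: "2 * k \<le> cut E I J + k * card (J - I)" if "I \<subseteq> J" "J \<subseteq> V" "I \<noteq> {}" "J \<noteq> V" for I J
    using conn that unfolding mix_conn_def by simp
  have c: "card (J - I) = 0 \<and> J = I \<or> (\<exists>v. J - I = {v}) \<or> 2 * k \<le> k * card (J - I)"
    if h: "I \<subseteq> J" "J \<subseteq> ?V" for I J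
  proof -
    have fJ: "finite (J - I)" using fin h finite_subset by blast
    consider "card (J - I) = 0" | "card (J - I) = 1" | "2 \<le> card (J - I)" by linarith
    then show ?thesis
    proof cases
      case 1
      then show ?thesis using fJ h by auto
    next
      case 2
      then show ?thesis using card_1_singletonE by blast
    next
      case 3
      then have "k * 2 \<le> k * card (J - I)" by (rule mult_le_mono2)
      then show ?thesis by simp
    qed
  qed
  have out: "2 * k \<le> cut ?E I J + k * card (J - I)"
    if h: "I \<subseteq> J" "J \<subseteq> V" "I \<noteq> {}" for I J
  proof -
    have e: "cut ?E I J = cut (E - F) I J + weight ?N I"
      using cut_Upair_out[of s J I ?N] h s by auto
    show ?thesis
    proof (cases "J = V")
      case False
      then show ?thesis using mc[of I J] h cE[of I J] cut_le_weight[OF h(1), of F] e by simp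
    next
      case True
      have sz: "weight ?N (V - I) + weight ?N I = 2 * k"
        using weight_Diff[of I V ?N] weight_size[OF NV] size_all_ends[of F] F(2) h by simp
      from c[of I J] h consider "J = I" | v where "J - I = {v}" | "2 * k \<le> k * card (J - I)" by blast
      then show ?thesis
      proof cases
        case 1
        then show ?thesis using e sz True by simp
      next
        case 2
        then have "v \<in> V" using h by blast
        then have "count ?N v \<le> k" using F(3) degree_in_eq by metis
        then show ?thesis using e sz True 2 by simp
      next
        case 3
        then show ?thesis by linarith
      qed
    qed
  qed
  show ?thesis
    unfolding mix_conn_def
  proof (intro allI impI, elim conjE)
    fix I J assume h: "I \<subseteq> J" "J \<subseteq> ?V" "I \<noteq> {}" "J \<noteq> ?V"
    consider "s \<notin> J" | "s \<in> I" | "s \<in> J" "s \<notin> I" by blast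
    then have "2 * k \<le> cut ?E I J + k * card (J - I)"
    proof cases
      case 1
      then show ?thesis using out[of I J] h by blast
    next
      case 2
      have "2 * k \<le> cut ?E (?V - J) (?V - I) + k * card ((?V - I) - (?V - J))"
        by (rule out) (use h 2 s in auto)
      moreover have "(?V - I) - (?V - J) = J - I" using h by auto
      ultimately show ?thesis using cut_compl[OF EV, of J I] by simp
    next
      case 3
      have "s \<in> J - I" using 3 by blast
      then have "J - I = {s} \<or> 2 * k \<le> k * card (J - I)" using c[OF h(1,2)] by (metis Diff_cancel empty_iff singletonD)
      then consider "J - I = {s}" | "2 * k \<le> k * card (J - I)" by blast
      then show ?thesis
      proof cases
        case 1
        then have J: "J = insert s I" using h by blast
        then have I: "I \<subseteq> V" "I \<noteq> V" using h 3 by auto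
        have "cut (E - F) I J = cut (E - F) I I"
        proof -
          have "cross I J e = cross I I e" if "e \<in># E - F" for e
          proof -
            have "s \<notin> set_uprod e" using E_V s that by (meson in_diffD subsetD)
            then show ?thesis unfolding J by (cases e) auto
          qed
          then have "filter_mset (cross I J) (E - F) = filter_mset (cross I I) (E - F)"
            by (intro filter_mset_cong) auto
          then show ?thesis unfolding cut_def by simp
        qed
        moreover have "2 * k \<le> cut E I I" using mc[of I I] I h by simp
        moreover have "cut F I I \<le> k" using cut_le_size[of F I I] F(2) by simp
        ultimately show ?thesis using cE[of I I] 1 by simp
      next
        case 2
        then show ?thesis by linarith
      qed
    qed
    then show "2 * k \<le> cut ?E I J + weight {#} I + k * card (J - I)" by simp
  qed
qed

section \<open>Graphs on three vertices\<close>

definition K3_edges :: "nat \<Rightarrow> 'a \<Rightarrow> 'a \<Rightarrow> 'a \<Rightarrow> 'a uprod multiset" where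
  "K3_edges k a b c = replicate_mset k (Upair a b) + replicate_mset k (Upair b c) + replicate_mset k (Upair a c)"

lemma cut_replicate: "cut (replicate_mset m e) I J = m * of_bool (cross I J e)"
  by (induction m) auto

lemma mix_conn_K3:
  assumes "a \<noteq> b" "b \<noteq> c" "a \<noteq> c"
  shows "mix_conn k {a, b, c} (K3_edges k a b c) {#}"
  unfolding mix_conn_def
proof (intro allI impI, elim conjE)
  fix I J assume h: "I \<subseteq> J" "J \<subseteq> {a, b, c}" "I \<noteq> {}" "J \<noteq> {a, b, c}"
  have "card (J - I) = (\<Sum>v\<in>{a, b, c}. of_bool (v \<in> J - I))"
    using h(2) by (simp add: sum.If_cases of_bool_def Int_absorb1 Diff_subset order_trans[OF Diff_subset] del: Diff_iff)
  also have "\<dots> = of_bool (a \<in> J - I) + of_bool (b \<in> J - I) + of_bool (c \<in> J - I)"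
    using assms by simp
  finally have cd: "card (J - I) = of_bool (a \<in> J - I) + of_bool (b \<in> J - I) + of_bool (c \<in> J - I)" .
  have "2 \<le> (of_bool (cross I J (Upair a b)) + of_bool (cross I J (Upair b c)) + of_bool (cross I J (Upair a c))
     + card (J - I) :: nat)"
  proof -
    have "a \<in> I \<or> b \<in> I \<or> c \<in> I" "a \<notin> J \<or> b \<notin> J \<or> c \<notin> J" using h by auto
    moreover have "a \<in> I \<Longrightarrow> a \<in> J" "b \<in> I \<Longrightarrow> b \<in> J" "c \<in> I \<Longrightarrow> c \<in> J" using h(1) by auto
    ultimately show ?thesis
      unfolding cd
      by (cases "a \<in> I"; cases "a \<in> J"; cases "b \<in> I"; cases "b \<in> J"; cases "c \<in> I"; cases "c \<in> J"; simp)
  qed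
  then have "k * 2 \<le> k * (of_bool (cross I J (Upair a b)) + of_bool (cross I J (Upair b c)) + of_bool (cross I J (Upair a c))
     + card (J - I))" by (rule mult_le_mono2)
  then show "2 * k \<le> cut (K3_edges k a b c) I J + weight {#} I + k * card (J - I)"
    unfolding K3_edges_def by (simp only: cut_union cut_replicate weight_empty_mset distrib_left mult.commute[of 2] add_0_right)
qed

lemma cut_three_vertices:
  assumes "\<forall>e\<in>#E. set_uprod e \<subseteq> {x, y, z}" "x \<noteq> y" "y \<noteq> z"
  shows "cut E {x} {x, z} = count E (Upair x y)"
  using assms(1)
proof (induction E)
  case (add e E)
  then show ?case using assms(2,3) by (cases e) auto
qed simp

text \<open>Deleting one of the three vertices leaves two, which must still be joined by
  \<open>k\<close> edges.\<close>

lemma K3_edges_subset: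
  assumes conn: "mix_conn k {x, y, z} E {#}" and EV: "\<forall>e\<in>#E. set_uprod e \<subseteq> {x, y, z}"
    and ne: "x \<noteq> y" "y \<noteq> z" "x \<noteq> z"
  shows "K3_edges k x y z \<subseteq># E"
proof -
  have c: "k \<le> count E (Upair p q)" if "{p, q, r} = {x, y, z}" "p \<noteq> q" "q \<noteq> r" "p \<noteq> r" for p q r
  proof -
    have "2 * k \<le> cut E {p} {p, r} + weight {#} {p} + k * card ({p, r} - {p})"
    proof (rule conn[unfolded mix_conn_def, rule_format], intro conjI)
      show "{p, r} \<noteq> {x, y, z}" unfolding that(1)[symmetric] using that by auto
      show "{p, r} \<subseteq> {x, y, z}" unfolding that(1)[symmetric] by auto
    qed auto
    moreover have "{p, r} - {p} = {r}" using that by auto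
    moreover have "cut E {p} {p, r} = count E (Upair p q)"
      by (rule cut_three_vertices) (use EV that in auto)
    ultimately show ?thesis by simp
  qed
  have "k \<le> count E (Upair x y)" "k \<le> count E (Upair y z)" "k \<le> count E (Upair x z)"
    using c[of x y z] c[of y z x] c[of x z y] ne by auto
  then show ?thesis
    using ne unfolding K3_edges_def subseteq_mset_def by (auto simp: Upair_inject)
qed

section \<open>Relabelling vertices\<close>

definition map_graph :: "('a \<Rightarrow> 'b) \<Rightarrow> 'a multigraph \<Rightarrow> 'b multigraph" where
  "map_graph g G = \<lparr>verts = g ` verts G, edges = image_mset (map_uprod g) (edges G)\<rparr>"

lemma map_uprod_cong_set: "(\<And>x. x \<in> set_uprod e \<Longrightarrow> f x = g x) \<Longrightarrow> map_uprod f e = map_uprod g e"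
  by (cases e) auto

lemma isomorphic_map_graph:
  assumes wf: "wf_multigraph G" and inj: "inj_on g (verts G)"
  shows "isomorphic (map_graph g G) G"
proof -
  let ?f = "inv_into (verts G) g"
  have "bij_betw ?f (g ` verts G) (verts G)" using inj by (simp add: bij_betw_inv_into inj_on_imp_bij_betw)
  moreover have "image_mset (\<lambda>e. map_uprod ?f (map_uprod g e)) (edges G) = image_mset (\<lambda>e. e) (edges G)"
  proof (rule image_mset_cong)
    fix e assume "e \<in># edges G"
    then have e: "set_uprod e \<subseteq> verts G" using wf unfolding wf_multigraph_def by blast
    show "map_uprod ?f (map_uprod g e) = e"
      using e inj by (cases e) auto
  qed
  ultimately show ?thesis unfolding isomorphic_def map_graph_def
    by (intro exI[of _ ?f]) (simp add: multiset.map_comp comp_def)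
qed

lemma mix_conn_isomorphic:
  assumes wf: "wf_multigraph H" and iso: "isomorphic H G" and conn: "mix_conn k (verts H) (edges H) {#}"
  shows "mix_conn k (verts G) (edges G) {#}" "card (verts G) = card (verts H)"
proof -
  obtain f where f: "bij_betw f (verts H) (verts G)" "edges G = image_mset (map_uprod f) (edges H)"
    using iso unfolding isomorphic_def by blast
  show "card (verts G) = card (verts H)" using bij_betw_same_card[OF f(1)] by simp
  have inj: "inj_on f (verts H)" and img: "f ` verts H = verts G" using f(1) unfolding bij_betw_def by auto
  show "mix_conn k (verts G) (edges G) {#}"
    unfolding mix_conn_def
  proof (intro allI impI, elim conjE)
    fix I J assume h: "I \<subseteq> J" "J \<subseteq> verts G" "I \<noteq> {}" "J \<noteq> verts G"
    define I' J' where "I' = {x \<in> verts H. f x \<in> I}" and "J' = {x \<in> verts H. f x \<in> J}"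
    have "2 * k \<le> cut (edges H) I' J' + weight {#} I' + k * card (J' - I')"
    proof (rule conn[unfolded mix_conn_def, rule_format], intro conjI)
      show "I' \<subseteq> J'" "J' \<subseteq> verts H" unfolding I'_def J'_def using h by auto
      obtain y where "y \<in> I" using h by blast
      then obtain x where "x \<in> verts H" "f x \<in> I" using h img by (metis imageE subsetD)
      then show "I' \<noteq> {}" unfolding I'_def by blast
      obtain y where "y \<in> verts G" "y \<notin> J" using h by blast
      then obtain x where "x \<in> verts H" "f x \<notin> J" using img by (metis imageE)
      then show "J' \<noteq> verts H" unfolding J'_def by blast
    qed
    moreover have "card (J - I) = card (J' - I')"
    proof -
      have "y \<in> f ` (J' - I')" if y: "y \<in> J - I" for y
      proof -
        obtain x where "x \<in> verts H" "y = f x" using y h img by (metis DiffD1 imageE subsetD)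
        then show ?thesis using y unfolding I'_def J'_def by blast
      qed
      then have "J - I = f ` (J' - I')" unfolding I'_def J'_def by auto
      moreover have "inj_on f (J' - I')" by (rule inj_on_subset[OF inj]) (auto simp: J'_def)
      ultimately show ?thesis by (simp add: card_image)
    qed
    moreover have "cut (image_mset (map_uprod f) E) I J = cut E I' J'" if "\<forall>e\<in>#E. set_uprod e \<subseteq> verts H" for E
      using that
    proof (induction E)
      case (add e E)
      then show ?case by (cases e) (auto simp: I'_def J'_def)
    qed simp
    then have "cut (edges G) I J = cut (edges H) I' J'" using f(2) wf unfolding wf_multigraph_def by simp
    ultimately show "2 * k \<le> cut (edges G) I J + weight {#} I + k * card (J - I)" by simp
  qed
qed

lemma operation_preserves:
  assumes op: "operation k G H" and wf: "wf_multigraph G"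
    and c3: "3 \<le> card (verts G)" and conn: "mix_conn k (verts G) (edges G) {#}"
  shows "wf_multigraph H \<and> 3 \<le> card (verts H) \<and> mix_conn k (verts H) (edges H) {#}"
  using op
proof cases
  case (adding u v)
  then show ?thesis
    using wf c3 mix_conn_mono[OF conn, of "add_mset (Upair u v) (edges G)"]
    unfolding wf_multigraph_def add_edge_def by auto
next
  case (pinching F s)
  have fin: "finite (verts G)" and EV: "\<forall>e\<in>#edges G. set_uprod e \<subseteq> verts G"
    using wf unfolding wf_multigraph_def by auto
  have "\<forall>e\<in>#F. set_uprod e \<subseteq> verts G" using pinching(2) EV by (meson mset_subset_eqD)
  then have NV: "set_mset (all_ends F) \<subseteq> verts G" using set_all_ends[of F "verts G"] by blast
  have H: "verts H = insert s (verts G)" "edges H = edges G - F + image_mset (Upair s) (all_ends F)"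
    using pinching(1) unfolding pinch_def pinch_edges by auto
  have "mix_conn k (verts H) (edges H) {#}"
    unfolding H by (rule mix_conn_pinch[OF conn EV fin pinching(2-5)])
  moreover have "wf_multigraph H" unfolding wf_multigraph_def H using fin EV NV by (auto dest: in_diffD)
  moreover have "3 \<le> card (verts H)" unfolding H using c3 fin pinching(5) by simp
  ultimately show ?thesis by blast
qed

lemma reachable_mixed:
  assumes "(operation k)\<^sup>*\<^sup>* (multi_K3 k) H"
  shows "wf_multigraph H \<and> 3 \<le> card (verts H) \<and> mix_conn k (verts H) (edges H) {#}"
  using assms
proof (induction rule: rtranclp_induct)
  case base
  show ?case
    using mix_conn_K3[of "0::nat" 1 2 k] unfolding K3_edges_def multi_K3_def wf_multigraph_def by auto
next
  case (step G H)
  then show ?case using operation_preserves by blast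
qed

lemma ends_map: "ends (map_uprod g e) = image_mset g (ends e)"
  by (cases e) simp

lemma all_ends_map: "all_ends (image_mset (map_uprod g) F) = image_mset g (all_ends F)"
  by (induction F) (auto simp: ends_map)

lemma count_image_inj_on:
  assumes "inj_on g V" "v \<in> V" "set_mset N \<subseteq> V"
  shows "count (image_mset g N) (g v) = count N v"
  using assms(3)
proof (induction N)
  case (add x N)
  then show ?case using assms(1,2) by (auto simp: inj_on_def)
qed simp

text \<open>The construction starts from a graph on natural numbers, so steps between graphs over
  \<open>'a\<close> are carried over along an injection. A pinching extends the injection by a fresh
  number for the new vertex.\<close>

lemma operation_map:
  fixes G H :: "'a multigraph" and g :: "'a \<Rightarrow> nat"
  assumes op: "operation k G H" and wf: "wf_multigraph G" and inj: "inj_on g (verts G)"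
  shows "\<exists>g' :: 'a \<Rightarrow> nat. inj_on g' (verts H) \<and> operation k (map_graph g G) (map_graph g' H)"
  using op
proof cases
  case (adding u v)
  have "map_graph g H = add_edge (g u) (g v) (map_graph g G)"
    unfolding adding(1) map_graph_def add_edge_def by simp
  moreover have "operation k (map_graph g G) (add_edge (g u) (g v) (map_graph g G))"
    by (rule operation.adding) (use adding in \<open>auto simp: map_graph_def\<close>)
  moreover have "verts H = verts G" unfolding adding(1) add_edge_def by simp
  ultimately show ?thesis using inj by metis
next
  case (pinching F s)
  have fin: "finite (verts G)" and EV: "\<forall>e\<in>#edges G. set_uprod e \<subseteq> verts G"
    using wf unfolding wf_multigraph_def by auto
  have FV: "\<forall>e\<in>#F. set_uprod e \<subseteq> verts G" using pinching(2) EV by (meson mset_subset_eqD)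
  have NV: "set_mset (all_ends F) \<subseteq> verts G" using FV set_all_ends[of F "verts G"] by blast
  obtain s' :: nat where s': "s' \<notin> g ` verts G" using fin ex_new_if_finite[OF infinite_UNIV_nat] by blast
  let ?g = "g(s := s')"
  have sv: "?g x = g x" if "x \<in> verts G" for x using that pinching(5) by auto
  have inj': "inj_on ?g (verts H)"
    using inj s' pinching(1,5) unfolding pinch_def by (auto simp: inj_on_def)
  have map_eq: "image_mset (map_uprod ?g) M = image_mset (map_uprod g) M"
    if "\<forall>e\<in>#M. set_uprod e \<subseteq> verts G" for M
    by (rule image_mset_cong, rule map_uprod_cong_set) (use that sv in blast)
  have "image_mset (map_uprod ?g) (image_mset (Upair s) (all_ends F)) = image_mset (\<lambda>x. Upair s' (g x)) (all_ends F)"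
    unfolding multiset.map_comp
  proof (rule image_mset_cong)
    fix x assume "x \<in># all_ends F"
    then have "?g x = g x" using NV sv by blast
    then show "(map_uprod ?g \<circ> Upair s) x = Upair s' (g x)" by simp
  qed
  then have new: "image_mset (map_uprod ?g) (image_mset (Upair s) (all_ends F)) =
      image_mset (Upair s') (all_ends (image_mset (map_uprod g) F))"
    unfolding all_ends_map by (simp add: multiset.map_comp comp_def)
  have old: "image_mset (map_uprod ?g) (edges G - F) = image_mset (map_uprod g) (edges G) - image_mset (map_uprod g) F"
    using map_eq[of "edges G - F"] EV image_mset_Diff[OF pinching(2)] by (metis in_diffD)
  have "?g ` insert s (verts G) = insert s' (g ` verts G)"
    using image_cong[OF refl sv, of "verts G"] by (simp only: image_insert fun_upd_same)
  then have eq: "map_graph ?g H = pinch (image_mset (map_uprod g) F) s' (map_graph g G)"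
    unfolding pinching(1) map_graph_def pinch_def pinch_edges using new old by simp
  have "operation k (map_graph g G) (map_graph ?g H)"
    unfolding eq
  proof (rule operation.pinching)
    show "image_mset (map_uprod g) F \<subseteq># edges (map_graph g G)"
      unfolding map_graph_def using pinching(2) by (simp add: image_mset_subseteq_mono)
    show "size (image_mset (map_uprod g) F) = k" using pinching(3) by simp
    show "s' \<notin> verts (map_graph g G)" using s' unfolding map_graph_def by simp
    show "\<forall>v\<in>verts (map_graph g G). degree_in (image_mset (map_uprod g) F) v \<le> k"
    proof
      fix w assume "w \<in> verts (map_graph g G)"
      then obtain v where v: "v \<in> verts G" "w = g v" unfolding map_graph_def by auto
      then show "degree_in (image_mset (map_uprod g) F) w \<le> k"
        using pinching(4) count_image_inj_on[OF inj v(1) NV] unfolding degree_in_eq all_ends_map by simp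
    qed
  qed
  then show ?thesis using inj' by blast
qed

text \<open>The sum of the numbers of vertices and edges drops in both reductions: by one when an
  added edge is removed, and by \<open>k + 1\<close> when a pinching is undone, as
  \<open>2 * k\<close> edges become \<open>k\<close>.\<close>

lemma mixed_reachable:
  fixes G :: "'a multigraph"
  assumes k: "even k" "2 \<le> k" and wf: "wf_multigraph G" and c3: "3 \<le> card (verts G)"
    and conn: "mix_conn k (verts G) (edges G) {#}"
  shows "\<exists>g :: 'a \<Rightarrow> nat. inj_on g (verts G) \<and> (operation k)\<^sup>*\<^sup>* (multi_K3 k) (map_graph g G)"
  using wf c3 conn
proof (induction "card (verts G) + size (edges G)" arbitrary: G rule: less_induct)
  case less
  let ?V = "verts G" and ?E = "edges G"
  have fin: "finite ?V" and EV: "\<forall>e\<in>#?E. set_uprod e \<subseteq> ?V"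
    using less.prems(1) unfolding wf_multigraph_def by auto
  have step: ?case
    if G0: "operation k G0 G" "wf_multigraph G0" "3 \<le> card (verts G0)" "mix_conn k (verts G0) (edges G0) {#}"
      "card (verts G0) + size (edges G0) < card ?V + size ?E" for G0 :: "'a multigraph"
  proof -
    obtain g :: "'a \<Rightarrow> nat" where g: "inj_on g (verts G0)" "(operation k)\<^sup>*\<^sup>* (multi_K3 k) (map_graph g G0)"
      using less.hyps[OF G0(5,2,3,4)] by blast
    then show ?thesis using operation_map[OF G0(1,2) g(1)] by (meson rtranclp.rtrancl_into_rtrancl)
  qed
  show ?case
  proof (cases "\<exists>e\<in>#?E. mix_conn k ?V (?E - {#e#}) {#}")
    case True
    then obtain e where e: "e \<in># ?E" "mix_conn k ?V (?E - {#e#}) {#}" by blast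
    obtain u v where uv: "e = Upair u v" by (cases e)
    let ?G = "\<lparr>verts = ?V, edges = ?E - {#e#}\<rparr>"
    have "add_edge u v ?G = G" unfolding add_edge_def using e uv by simp
    moreover have "operation k ?G (add_edge u v ?G)"
      by (rule operation.adding) (use EV e uv in auto)
    ultimately have op: "operation k ?G G" by simp
    have "size (?E - {#e#}) < size ?E" using e(1) by (metis size_Diff1_less)
    then show ?thesis
      using less.prems e(2) EV fin by (intro step[OF op]) (auto simp: wf_multigraph_def dest: in_diffD)
  next
    case minimal: False
    show ?thesis
    proof (cases "4 \<le> card ?V")
      case True
      interpret min_graph k ?V ?E
        by unfold_locales (use fin k EV less.prems(3) minimal True in auto)
      obtain a N E0 F where a: "a \<in> verts G" "?E = E0 + image_mset (Upair a) N" "\<forall>e\<in>#E0. set_uprod e \<subseteq> ?V - {a}"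
        "set_mset N \<subseteq> ?V - {a}" "size N = 2 * k" "\<And>x. x \<in> ?V - {a} \<Longrightarrow> count N x \<le> k"
        "all_ends F = N" "mix_conn k (?V - {a}) (E0 + F) {#}"
        by (rule good_vertex) (rule that; assumption)
      let ?G = "\<lparr>verts = ?V - {a}, edges = E0 + F\<rparr>"
      have F_V: "\<forall>e\<in>#F. set_uprod e \<subseteq> ?V - {a}" using set_all_ends[of F "?V - {a}"] a(4,7) by blast
      have sF: "size F = k" using size_all_ends[of F] a(5,7) by simp
      have "pinch F a ?G = G"
        unfolding pinch_def pinch_edges a(7) using a(1,2) by (simp add: insert_absorb)
      moreover have "operation k ?G (pinch F a ?G)"
        by (rule operation.pinching) (use sF a(6,7) in \<open>auto simp: degree_in_eq\<close>)
      ultimately have op: "operation k ?G G" by simp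
      have cV: "card (?V - {a}) = card ?V - 1" using a(1) by simp
      show ?thesis
      proof (rule step[OF op])
        show "wf_multigraph ?G" unfolding wf_multigraph_def using fin a(3) F_V by auto
        show "3 \<le> card (verts ?G)" using cV True by simp
        show "mix_conn k (verts ?G) (edges ?G) {#}" using a(8) by simp
        have "size ?E = size E0 + 2 * k" using arg_cong[OF a(2), of size] a(5) by simp
        then show "card (verts ?G) + size (edges ?G) < card ?V + size ?E" using sF cV True by simp
      qed
    next
      case False
      then have "card ?V = 3" using less.prems(2) by simp
      then obtain x y z where V: "?V = {x, y, z}" and ne: "x \<noteq> y" "y \<noteq> z" "x \<noteq> z"
        by (auto simp: card_3_iff)
      have sub: "K3_edges k x y z \<subseteq># ?E"
        using K3_edges_subset[of k x y z ?E] less.prems(3) EV ne unfolding V by blast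
      have E: "?E = K3_edges k x y z"
      proof (rule ccontr)
        assume "?E \<noteq> K3_edges k x y z"
        then obtain M where M: "?E = K3_edges k x y z + M" "M \<noteq> {#}"
          using sub by (metis subset_mset.add_diff_inverse add.right_neutral)
        then obtain e where e: "e \<in># M" by blast
        then have "?E - {#e#} = K3_edges k x y z + (M - {#e#})"
          unfolding M(1) by (rule diff_union_single_conv)
        then have "K3_edges k x y z \<subseteq># ?E - {#e#}" by simp
        then have "mix_conn k ?V (?E - {#e#}) {#}"
          using mix_conn_mono[OF mix_conn_K3[OF ne]] V by simp
        then show False using minimal e M(1) by simp
      qed
      let ?g = "(\<lambda>_. 0)(y := 1, z := 2) :: 'a \<Rightarrow> nat"
      have "map_graph ?g G = multi_K3 k"
        unfolding map_graph_def multi_K3_def E V K3_edges_def using ne by auto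
      moreover have "inj_on ?g ?V" unfolding V using ne by (auto simp: inj_on_def)
      ultimately show ?thesis by (intro exI[of _ ?g]) simp
    qed
  qed
qed

theorem theorem7p2:
  fixes k :: nat and G :: "'a multigraph"
  assumes "even k" and "k > 0" and "wf_multigraph G"
  shows "mixed_connected (2 * k) k G \<longleftrightarrow>
    (\<exists>H. (operation k)\<^sup>*\<^sup>* (multi_K3 k) H \<and> isomorphic H G)"
proof
  have k2: "2 \<le> k" using assms(1,2) by presburger
  assume "mixed_connected (2 * k) k G"
  then have "3 \<le> card (verts G)" "mix_conn k (verts G) (edges G) {#}"
    using mixed_connected_iff[OF assms(3)] by blast+
  then obtain g :: "'a \<Rightarrow> nat" where "inj_on g (verts G)" "(operation k)\<^sup>*\<^sup>* (multi_K3 k) (map_graph g G)"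
    using mixed_reachable[OF assms(1) k2 assms(3)] by blast
  then show "\<exists>H. (operation k)\<^sup>*\<^sup>* (multi_K3 k) H \<and> isomorphic H G"
    using isomorphic_map_graph[OF assms(3)] by blast
next
  assume "\<exists>H. (operation k)\<^sup>*\<^sup>* (multi_K3 k) H \<and> isomorphic H G"
  then obtain H where H: "(operation k)\<^sup>*\<^sup>* (multi_K3 k) H" "isomorphic H G" by blast
  then show "mixed_connected (2 * k) k G"
    using mixed_connected_iff[OF assms(3)] reachable_mixed[OF H(1)] mix_conn_isomorphic[OF _ H(2)] by metis
qed

end
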